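(* Let $H\in\mathcal{H}_2$, $\hat H_k\in\mathcal{M}$, $\alpha_k>0$, and let $f:\mathcal{M}\to\mathbb{R}$, $f(\hat H)=\|H-\hat H\|_{\mathcal{H}_2}^2$. Let $$\hat H_{k+1}=\mathrm{R}_{\hat H_k}\bigl(-\alpha_k\operatorname{grad}f(\hat H_k)\bigr)$$ be obtained via Riemannian gradient descent with step size $\alpha_k$, where $\mathrm{R}$ is the orthographic retraction (assumed defined at this tangent vector). Define $$H_{k,\alpha_k}=(1-\alpha_k)\hat H_k+\alpha_kH.$$ Then $$H_{k,\alpha_k}-\hat H_{k+1}\perp\mathrm{T}_{\hat H_k}\mathcal{M},$$ and thus $\hat H_{k+1}$ is a bitangential Hermite interpolant to $H_{k,\alpha_k}$, in the following sense: if $\hat H_k(s)=\sum_{i=1}^r\frac{c_ib_i^*}{s-\lambda_i}$ with pairwise distinct poles $\lambda_i$, then for $i=1,\dots,r$ $$H_{k,\alpha_k}(-\overline{\lambda_i})b_i=\hat H_{k+1}(-\overline{\lambda_i})b_i,\quad c_i^*H_{k,\alpha_k}(-\overline{\lambda_i})=c_i^*\hat H_{k+1}(-\overline{\lambda_i}),\quad c_i^*H_{k,\alpha_k}'(-\overline{\lambda_i})b_i=c_i^*\hat H_{k+1}'(-\overline{\lambda_i})b_i.$$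
   Context: $\mathcal{H}_2=\mathcal{H}_2^{p\times m}(\mathbb{C}^+)$ is the Hardy space of analytic functions $F:\mathbb{C}^+\to\mathbb{C}^{p\times m}$ on the open right half-plane with $\sup_{\xi>0}\int_{-\infty}^{\infty}\|F(\xi+\mathrm{i}\omega)\|_{\mathrm{F}}^2\,d\omega<\infty$ and inner product $\langle F,G\rangle_{\mathcal{H}_2}=\frac{1}{2\pi}\int_{-\infty}^{\infty}\operatorname{tr}(F(\mathrm{i}\omega)^*G(\mathrm{i}\omega))\,d\omega$; $\perp$ is orthogonality in this inner product. $\mathcal{M}$ is the set of $\hat C(sI-\hat A)^{-1}\hat B$ with $\hat A\in\mathbb{C}^{r\times r}$ Hurwitz (all eigenvalues in the open left half-plane), $\hat B\in\mathbb{C}^{r\times m}$, $\hat C\in\mathbb{C}^{p\times r}$, and $(\hat A,\hat B,\hat C)$ minimal (least possible order). $\mathcal{M}$ is an embedded submanifold of $\mathcal{H}_2$ of complex dimension $r(m+p)$; its tangent space $\mathrm{T}_{\hat H}\mathcal{M}$ is viewed as a finite-dimensional subspace of $\mathcal{H}_2$, namely the set of velocities $\gamma'(0)$ of smooth curves $\gamma$ in $\mathcal{M}$ with $\gamma(0)=\hat H$; $\mathcal{M}$ inherits the inner product of $\mathcal{H}_2$ as Riemannian metric. Gradient convention: using the Wirtinger gradient $\nabla_{\overline G}\|H-G\|_{\mathcal{H}_2}^2=G-H$, the Riemannian gradient is $\operatorname{grad}f(\hat H)=\operatorname{Proj}_{\hat H}(\hat H-H)$, where $\operatorname{Proj}_{\hat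 H}:\mathcal{H}_2\to\mathrm{T}_{\hat H}\mathcal{M}$ is the orthogonal projector. Orthographic retraction: $\mathrm{R}$ assigns to $\hat H\in\mathcal{M}$ and $G$ in an open subset of $\mathrm{T}_{\hat H}\mathcal{M}$ containing $0$ an element $\mathrm{R}_{\hat H}(G)\in\mathcal{M}$ with $\hat H+G-\mathrm{R}_{\hat H}(G)\perp\mathrm{T}_{\hat H}\mathcal{M}$. *)

theory Defs
  imports
    "HOL-Complex_Analysis.Complex_Analysis"
    "HOL-Library.Function_Algebras"
    "Jordan_Normal_Form.Schur_Decomposition"
    "Jordan_Normal_Form.Gauss_Jordan_Elimination"
begin

section \<open>The Hardy space\<close>

definition rhp :: "complex set" where
  "rhp = {s. Re s > 0}"

definition frob_sq :: "complex mat \<Rightarrow> real" where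
  "frob_sq X = (\<Sum>i<dim_row X. \<Sum>j<dim_col X. (cmod (X $$ (i, j)))\<^sup>2)"

definition mat_tr :: "complex mat \<Rightarrow> complex" where
  "mat_tr X = (\<Sum>i<dim_row X. X $$ (i, i))"

text \<open>An element is a function on the open right half-plane. It is represented by its extension
  by the zero matrix, so that equality in the Hardy space is equality of functions. Sums and
  differences of elements are the pointwise ones.\<close>

definition H2 :: "nat \<Rightarrow> nat \<Rightarrow> (complex \<Rightarrow> complex mat) set" where
  "H2 p m = {F. (\<forall>s. F s \<in> carrier_mat p m) \<and> (\<forall>s. s \<notin> rhp \<longrightarrow> F s = 0\<^sub>m p m) \<and>
     (\<forall>i<p. \<forall>j<m. (\<lambda>s. F s $$ (i, j)) holomorphic_on rhp) \<and>
     (SUP \<xi>\<in>{0<..}. \<integral>\<^sup>+\<omega>. ennreal (frob_sq (F (Complex \<xi> \<omega>))) \<partial>lborel) < \<infinity>}"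

definition h2_scale :: "complex \<Rightarrow> (complex \<Rightarrow> complex mat) \<Rightarrow> complex \<Rightarrow> complex mat" where
  "h2_scale c F = (\<lambda>s. c \<cdot>\<^sub>m F s)"

text \<open>The values on the imaginary axis that enter the inner product are the boundary values:
  \<open>h2_boundary p m F \<omega>\<close> stands for \<open>F(i\<omega>)\<close> and is the limit of \<open>F(\<xi> + i\<omega>)\<close> as \<open>\<xi>\<close> decreases
  to 0, in the sense of square-integrable functions of \<open>\<omega>\<close>. It is unique up to a null set, and
  it agrees almost everywhere with the restriction to the axis if \<open>F\<close> extends continuously.\<close>

definition h2_boundary :: "nat \<Rightarrow> nat \<Rightarrow> (complex \<Rightarrow> complex mat) \<Rightarrow> real \<Rightarrow> complex mat" where
  "h2_boundary p m F = (SOME g. (\<forall>\<omega>. g \<omega> \<in> carrier_mat p m) \<and>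
     (\<forall>i<p. \<forall>j<m. (\<lambda>\<omega>. g \<omega> $$ (i, j)) \<in> borel_measurable borel) \<and>
     ((\<lambda>\<xi>. \<integral>\<^sup>+\<omega>. ennreal (frob_sq (F (Complex \<xi> \<omega>) - g \<omega>)) \<partial>lborel) \<longlongrightarrow> 0) (at_right 0))"

definition h2_inner ::
  "nat \<Rightarrow> nat \<Rightarrow> (complex \<Rightarrow> complex mat) \<Rightarrow> (complex \<Rightarrow> complex mat) \<Rightarrow> complex" where
  "h2_inner p m F G = complex_of_real (1 / (2 * pi)) *
     (LINT \<omega>|lborel. mat_tr (mat_adjoint (h2_boundary p m F \<omega>) * h2_boundary p m G \<omega>))"

definition h2_norm :: "nat \<Rightarrow> nat \<Rightarrow> (complex \<Rightarrow> complex mat) \<Rightarrow> real" where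
  "h2_norm p m F = sqrt (Re (h2_inner p m F F))"

definition h2_perp ::
  "nat \<Rightarrow> nat \<Rightarrow> (complex \<Rightarrow> complex mat) \<Rightarrow> (complex \<Rightarrow> complex mat) set \<Rightarrow> bool" where
  "h2_perp p m F T \<longleftrightarrow> (\<forall>V\<in>T. h2_inner p m F V = 0)"

section \<open>The manifold of stable systems of order r\<close>

definition hurwitz :: "complex mat \<Rightarrow> bool" where
  "hurwitz A \<longleftrightarrow> (\<forall>k. eigenvalue A k \<longrightarrow> Re k < 0)"

text \<open>Only meaningful if \<open>s\<close> is not an eigenvalue of \<open>A\<close>.\<close>

definition transfer ::
  "complex mat \<Rightarrow> complex mat \<Rightarrow> complex mat \<Rightarrow> complex \<Rightarrow> complex mat" where
  "transfer A B C s = C * the (mat_inverse (s \<cdot>\<^sub>m 1\<^sub>m (dim_row A) - A)) * B"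

definition realization ::
  "nat \<Rightarrow> nat \<Rightarrow> nat \<Rightarrow> complex mat \<Rightarrow> complex mat \<Rightarrow> complex mat \<Rightarrow> bool" where
  "realization p m r A B C \<longleftrightarrow>
     A \<in> carrier_mat r r \<and> B \<in> carrier_mat r m \<and> C \<in> carrier_mat p r"

text \<open>No realization of smaller order, stable or not, has the same transfer function.
  Equality of the two rational functions is tested away from both spectra.\<close>

definition minimal_realization ::
  "nat \<Rightarrow> nat \<Rightarrow> nat \<Rightarrow> complex mat \<Rightarrow> complex mat \<Rightarrow> complex mat \<Rightarrow> bool" where
  "minimal_realization p m r A B C \<longleftrightarrow> realization p m r A B C \<and>
     \<not> (\<exists>q<r. \<exists>A' B' C'. realization p m q A' B' C' \<and>
         (\<forall>s. \<not> eigenvalue A s \<and> \<not> eigenvalue A' s \<longrightarrow> transfer A' B' C' s = transfer A B C s))"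

definition rat_manifold :: "nat \<Rightarrow> nat \<Rightarrow> nat \<Rightarrow> (complex \<Rightarrow> complex mat) set" where
  "rat_manifold p m r = {F. \<exists>A B C. minimal_realization p m r A B C \<and> hurwitz A \<and>
     F = (\<lambda>s. if s \<in> rhp then transfer A B C s else 0\<^sub>m p m)}"

definition h2_has_derivative_at ::
  "nat \<Rightarrow> nat \<Rightarrow> (real \<Rightarrow> complex \<Rightarrow> complex mat) \<Rightarrow> (complex \<Rightarrow> complex mat) \<Rightarrow> real \<Rightarrow> bool" where
  "h2_has_derivative_at p m \<gamma> V t \<longleftrightarrow>
     ((\<lambda>h. h2_norm p m (h2_scale (complex_of_real (1 / h)) (\<gamma> (t + h) - \<gamma> t) - V)) \<longlongrightarrow> 0) (at 0)"

text \<open>As the manifold is embedded in the Hardy space, a smooth curve in the manifold is a smooth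
  curve in the Hardy space whose values lie in the manifold. Here \<open>\<Gamma> n\<close> is the n-th derivative
  of the curve \<open>\<Gamma> 0\<close>, taken with respect to a real parameter.\<close>

definition tangent_space ::
  "nat \<Rightarrow> nat \<Rightarrow> nat \<Rightarrow> (complex \<Rightarrow> complex mat) \<Rightarrow> (complex \<Rightarrow> complex mat) set" where
  "tangent_space p m r G = {V. \<exists>\<epsilon>>0. \<exists>\<Gamma> :: nat \<Rightarrow> real \<Rightarrow> complex \<Rightarrow> complex mat.
     (\<forall>t\<in>{-\<epsilon><..<\<epsilon>}. \<Gamma> 0 t \<in> rat_manifold p m r) \<and>
     (\<forall>n. \<forall>t\<in>{-\<epsilon><..<\<epsilon>}. \<Gamma> n t \<in> H2 p m \<and> h2_has_derivative_at p m (\<Gamma> n) (\<Gamma> (Suc n) t) t) \<and>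
     \<Gamma> 0 0 = G \<and> V = \<Gamma> 1 0}"

section \<open>Gradient and retraction\<close>

definition orthogonal_projector ::
  "nat \<Rightarrow> nat \<Rightarrow> (complex \<Rightarrow> complex mat) set \<Rightarrow>
   ((complex \<Rightarrow> complex mat) \<Rightarrow> complex \<Rightarrow> complex mat) \<Rightarrow> bool" where
  "orthogonal_projector p m T P \<longleftrightarrow> (\<forall>X\<in>H2 p m. P X \<in> T \<and> h2_perp p m (X - P X) T)"

text \<open>The factor 2 is that of the Wirtinger convention, in which the gradient of the squared
  distance to \<open>H\<close> at \<open>G\<close> is \<open>G - H\<close>.\<close>

definition is_wirtinger_gradient ::
  "nat \<Rightarrow> nat \<Rightarrow> ((complex \<Rightarrow> complex mat) \<Rightarrow> real) \<Rightarrow> (complex \<Rightarrow> complex mat) \<Rightarrow>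
   (complex \<Rightarrow> complex mat) \<Rightarrow> bool" where
  "is_wirtinger_gradient p m f G W \<longleftrightarrow> W \<in> H2 p m \<and>
     (\<forall>\<epsilon>>0. \<exists>\<delta>>0. \<forall>V\<in>H2 p m. h2_norm p m V < \<delta> \<longrightarrow>
        \<bar>f (G + V) - f G - 2 * Re (h2_inner p m W V)\<bar> \<le> \<epsilon> * h2_norm p m V)"

text \<open>\<open>P G\<close> is the orthogonal projector onto the tangent space at \<open>G\<close>.\<close>

definition riemannian_gradient ::
  "nat \<Rightarrow> nat \<Rightarrow> ((complex \<Rightarrow> complex mat) \<Rightarrow> (complex \<Rightarrow> complex mat) \<Rightarrow> complex \<Rightarrow> complex mat) \<Rightarrow>
   ((complex \<Rightarrow> complex mat) \<Rightarrow> real) \<Rightarrow> (complex \<Rightarrow> complex mat) \<Rightarrow> complex \<Rightarrow> complex mat" where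
  "riemannian_gradient p m P f G = P G (THE W. is_wirtinger_gradient p m f G W)"

text \<open>\<open>D G\<close> is the domain of the retraction at \<open>G\<close>, a neighbourhood of 0 that is open relative
  to the tangent space.\<close>

definition orthographic_retraction ::
  "nat \<Rightarrow> nat \<Rightarrow> nat \<Rightarrow> ((complex \<Rightarrow> complex mat) \<Rightarrow> (complex \<Rightarrow> complex mat) set) \<Rightarrow>
   ((complex \<Rightarrow> complex mat) \<Rightarrow> (complex \<Rightarrow> complex mat) \<Rightarrow> complex \<Rightarrow> complex mat) \<Rightarrow> bool" where
  "orthographic_retraction p m r D R \<longleftrightarrow> (\<forall>G\<in>rat_manifold p m r.
     D G \<subseteq> tangent_space p m r G \<and> (\<lambda>s. 0\<^sub>m p m) \<in> D G \<and>
     (\<forall>V\<in>D G. \<exists>\<epsilon>>0. \<forall>V'\<in>tangent_space p m r G. h2_norm p m (V' - V) < \<epsilon> \<longrightarrow> V' \<in> D G) \<and>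
     (\<forall>V\<in>D G. R G V \<in> rat_manifold p m r \<and>
        h2_perp p m (G + V - R G V) (tangent_space p m r G)))"

section \<open>Interpolation\<close>

definition mat_deriv :: "nat \<Rightarrow> nat \<Rightarrow> (complex \<Rightarrow> complex mat) \<Rightarrow> complex \<Rightarrow> complex mat" where
  "mat_deriv p m F s = mat p m (\<lambda>(i, j). deriv (\<lambda>z. F z $$ (i, j)) s)"

text \<open>The row vector \<open>c\<^sup>* X\<close>, as a vector.\<close>

definition adj_vec_mult_mat :: "complex vec \<Rightarrow> complex mat \<Rightarrow> complex vec" where
  "adj_vec_mult_mat c X = transpose_mat X *\<^sub>v conjugate c"

text \<open>\<open>F(s) = (\<Sum>i<r. c\<^sub>i b\<^sub>i\<^sup>* / (s - lam\<^sub>i))\<close>, written entrywise.\<close>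

definition pole_residue_form ::
  "nat \<Rightarrow> nat \<Rightarrow> nat \<Rightarrow> (nat \<Rightarrow> complex) \<Rightarrow> (nat \<Rightarrow> complex vec) \<Rightarrow> (nat \<Rightarrow> complex vec) \<Rightarrow>
   (complex \<Rightarrow> complex mat) \<Rightarrow> bool" where
  "pole_residue_form p m r lam b c F \<longleftrightarrow>
     (\<forall>i<r. b i \<in> carrier_vec m \<and> c i \<in> carrier_vec p) \<and>
     (\<forall>s\<in>rhp. (\<forall>i<r. s \<noteq> lam i) \<longrightarrow>
        F s = mat p m (\<lambda>(k, l). \<Sum>i<r. vec_index (c i) k * cnj (vec_index (b i) l) / (s - lam i)))"

definition hermite_interpolant ::
  "nat \<Rightarrow> nat \<Rightarrow> nat \<Rightarrow> (nat \<Rightarrow> complex) \<Rightarrow> (nat \<Rightarrow> complex vec) \<Rightarrow> (nat \<Rightarrow> complex vec) \<Rightarrow>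
   (complex \<Rightarrow> complex mat) \<Rightarrow> (complex \<Rightarrow> complex mat) \<Rightarrow> bool" where
  "hermite_interpolant p m r lam b c F G \<longleftrightarrow> (\<forall>i<r. let \<sigma> = - cnj (lam i) in
     F \<sigma> *\<^sub>v b i = G \<sigma> *\<^sub>v b i \<and>
     adj_vec_mult_mat (c i) (F \<sigma>) = adj_vec_mult_mat (c i) (G \<sigma>) \<and>
     adj_vec_mult_mat (c i) (mat_deriv p m F \<sigma>) \<bullet> b i =
       adj_vec_mult_mat (c i) (mat_deriv p m G \<sigma>) \<bullet> b i)"

end

theory Submission
  imports Defs "HOL-Probability.Sinc_Integral" "HOL-Real_Asymp.Real_Asymp"
begin

text \<open>
  Since \<open>grad f(H\<^sub>k) = P(H\<^sub>k - H)\<close>, the vector \<open>H\<^sub>k\<^sub>,\<^sub>\<alpha> - H\<^sub>k\<^sub>+\<^sub>1\<close> is the retraction residual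
  \<open>H\<^sub>k - \<alpha> grad f(H\<^sub>k) - H\<^sub>k\<^sub>+\<^sub>1\<close> minus \<open>\<alpha>\<close> times the projection residual of \<open>H\<^sub>k - H\<close>; both are
  orthogonal to the tangent space. Moving one \<open>c\<^sub>i\<close>, \<open>b\<^sub>i\<close> or \<open>\<lambda>\<^sub>i\<close> in the pole-residue form shows that the
  tangent space contains \<open>e b\<^sub>i\<^sup>* / (s - \<lambda>\<^sub>i)\<close>, \<open>c\<^sub>i e\<^sup>* / (s - \<lambda>\<^sub>i)\<close> and \<open>c\<^sub>i b\<^sub>i\<^sup>* / (s - \<lambda>\<^sub>i)\<^sup>2\<close>. The inner
  product with \<open>c b\<^sup>* / (s - \<lambda>)\<close> evaluates \<open>c\<^sup>* E b\<close> at \<open>- cnj \<lambda>\<close> by Cauchy's formula, so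
  orthogonality to these three families is the interpolation property.

  For \<open>F\<^sub>\<xi> = F(\<xi> + i\<cdot>)\<close>, Cauchy's theorem makes \<open>\<langle>F\<^sub>\<xi>, F\<^sub>\<eta>\<rangle>\<close> a function \<open>h(\<xi> + \<eta>)\<close>, so
  \<open>\<parallel>F\<^sub>\<xi> - F\<^sub>\<eta>\<parallel>\<^sup>2 = h(2\<xi>) + h(2\<eta>) - 2h(\<xi> + \<eta>)\<close>. Thus \<open>h\<close> is midpoint convex; being bounded, it is
  decreasing and converges at 0, hence \<open>F\<^sub>\<xi>\<close> is Cauchy in \<open>L\<^sup>2\<close> and the boundary values exist.
\<close>

section \<open>Square-integrable functions on the line\<close>

text \<open>Most of the work is analytic. \<open>h2_boundary\<close> is a Hilbert choice: nothing is
  known about it before a limit in square mean has been produced, and it is fixed only up to null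
  sets, so the boundary function of a sum need not be the pointwise sum. Hence the laws of the inner
  product are not proved on the axis. They hold on the lines Re s = \<xi> > 0, where values are
  those of the functions themselves, and pass to the axis as \<xi> tends to 0. Membership in the
  Hardy space gives square-integrability on vertical lines but no explicit pointwise decay. The
  horizontal edges in Cauchy's theorem are therefore controlled by Fubini, which yields heights at
  which they are small. Minimality quantifies over all smaller realizations and enters in two
  opposite directions, both through residues of rational functions: a member with distinct poles has
  stable poles and nonzero residues, and such data always give a member. The second direction keeps
  the perturbed systems inside the manifold, so that they form curves in it.\<close>

lemma has_bochner_integral_lorentzian:
  fixes a y :: real
  assumes "a > 0"
  shows "has_bochner_integral lborel (\<lambda>x. 1 / ((x - y)\<^sup>2 + a\<^sup>2)) (pi / a)"
proof -
  have e: "einterval (-\<infinity>) \<infinity> = (UNIV :: real set)"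
    by (auto simp: einterval_def)
  have i: "integrable lborel (\<lambda>x::real. inverse (1 + x\<^sup>2))"
    using integrable_inverse_1_plus_square by (simp add: e set_integrable_def)
  have "(LBINT x::real. inverse (1 + x\<^sup>2)) = pi"
    using LBINT_inverse_1_plus_square
    by (simp add: e interval_lebesgue_integral_def set_lebesgue_integral_def)
  with i have "has_bochner_integral lborel (\<lambda>x::real. inverse (1 + x\<^sup>2)) pi"
    by (simp add: has_bochner_integral_iff)
  then have "has_bochner_integral lborel (\<lambda>x. inverse (1 + (- y / a + (1 / a) * x)\<^sup>2)) (pi /\<^sub>R \<bar>1 / a\<bar>)"
    using assms by (subst (asm) lborel_has_bochner_integral_real_affine_iff[of "1 / a" _ _ "- y / a"]) auto
  then have "has_bochner_integral lborel (\<lambda>x. (1 / a\<^sup>2) * inverse (1 + (- y / a + (1 / a) * x)\<^sup>2)) ((1 / a\<^sup>2) * (pi /\<^sub>R \<bar>1 / a\<bar>))"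
    by (rule has_bochner_integral_mult_right)
  moreover have "(1 / a\<^sup>2) * inverse (1 + (- y / a + (1 / a) * x)\<^sup>2) = 1 / ((x - y)\<^sup>2 + a\<^sup>2)" for x
  proof -
    have "- y / a + (1 / a) * x = (x - y) / a" by (simp add: diff_divide_distrib)
    moreover have "1 + ((x - y) / a)\<^sup>2 = ((x - y)\<^sup>2 + a\<^sup>2) / a\<^sup>2"
      using assms by (simp add: power_divide field_simps)
    ultimately show ?thesis using assms by simp
  qed
  moreover have "(1 / a\<^sup>2) * (pi /\<^sub>R \<bar>1 / a\<bar>) = pi / a"
    using assms by (simp add: power2_eq_square field_simps)
  ultimately show ?thesis by simp
qed

text \<open>The squared norm with values in \<open>ennreal\<close>, so that bounds can be chained
  before finiteness is known. Without roots, \<open>sq_int_add_le\<close> with its factors 2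
  replaces the triangle inequality.\<close>

definition sq_int :: "(real \<Rightarrow> complex) \<Rightarrow> ennreal" where
  "sq_int u = (\<integral>\<^sup>+x. ennreal ((cmod (u x))\<^sup>2) \<partial>lborel)"

definition L2 :: "(real \<Rightarrow> complex) set" where
  "L2 = {u. u \<in> borel_measurable borel \<and> sq_int u < \<infinity>}"

lemma L2_measurable: "u \<in> L2 \<Longrightarrow> u \<in> borel_measurable borel"
  by (simp add: L2_def)

lemma L2_finite: "u \<in> L2 \<Longrightarrow> sq_int u < \<infinity>"
  by (simp add: L2_def)

lemma cmod_add_sq_le: "(cmod (a + b))\<^sup>2 \<le> 2 * (cmod a)\<^sup>2 + 2 * (cmod b)\<^sup>2"
proof -
  have "(cmod (a + b))\<^sup>2 \<le> (cmod a + cmod b)\<^sup>2"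
    by (intro power_mono norm_triangle_ineq) auto
  also have "\<dots> \<le> 2 * (cmod a)\<^sup>2 + 2 * (cmod b)\<^sup>2"
    using zero_le_power2[of "cmod a - cmod b"] by (simp add: power2_diff power2_sum)
  finally show ?thesis .
qed

lemma sq_int_add_le:
  assumes [measurable]: "u \<in> borel_measurable borel" "v \<in> borel_measurable borel"
  shows "sq_int (\<lambda>x. u x + v x) \<le> 2 * sq_int u + 2 * sq_int v"
proof -
  have "sq_int (\<lambda>x. u x + v x) \<le> (\<integral>\<^sup>+x. 2 * ennreal ((cmod (u x))\<^sup>2) + 2 * ennreal ((cmod (v x))\<^sup>2) \<partial>lborel)"
    unfolding sq_int_def
  proof (rule nn_integral_mono)
    fix x
    have "ennreal ((cmod (u x + v x))\<^sup>2) \<le> ennreal (2 * (cmod (u x))\<^sup>2 + 2 * (cmod (v x))\<^sup>2)"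
      by (intro ennreal_leI cmod_add_sq_le)
    then show "ennreal ((cmod (u x + v x))\<^sup>2) \<le> 2 * ennreal ((cmod (u x))\<^sup>2) + 2 * ennreal ((cmod (v x))\<^sup>2)"
      by (simp add: ennreal_plus ennreal_mult)
  qed
  also have "\<dots> = 2 * sq_int u + 2 * sq_int v"
    unfolding sq_int_def by (simp add: nn_integral_add nn_integral_cmult)
  finally show ?thesis .
qed

lemma sq_int_cmult:
  assumes [measurable]: "u \<in> borel_measurable borel"
  shows "sq_int (\<lambda>x. c * u x) = ennreal ((cmod c)\<^sup>2) * sq_int u"
  unfolding sq_int_def by (simp add: norm_mult power_mult_distrib ennreal_mult nn_integral_cmult)

lemma sq_int_minus_commute: "sq_int (\<lambda>x. u x - v x) = sq_int (\<lambda>x. v x - u x)"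
  unfolding sq_int_def by (simp add: norm_minus_commute)

lemma L2_add: "u \<in> L2 \<Longrightarrow> v \<in> L2 \<Longrightarrow> (\<lambda>x. u x + v x) \<in> L2"
  unfolding L2_def
  using sq_int_add_le[of u v]
  by (auto intro!: borel_measurable_add elim!: le_less_trans simp: ennreal_mult_less_top)

lemma L2_cmult: "u \<in> L2 \<Longrightarrow> (\<lambda>x. c * u x) \<in> L2"
  unfolding L2_def
  by (auto intro!: borel_measurable_times simp: sq_int_cmult ennreal_mult_less_top)

lemma L2_diff: "u \<in> L2 \<Longrightarrow> v \<in> L2 \<Longrightarrow> (\<lambda>x. u x - v x) \<in> L2"
  using L2_add[of u "\<lambda>x. (-1) * v x"] L2_cmult[of v "-1"] by simp

lemma borel_measurable_cnj [measurable (raw)]: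
  "f \<in> borel_measurable M \<Longrightarrow> (\<lambda>x. cnj (f x)) \<in> borel_measurable M"
  by (rule measurable_compose[OF _ borel_measurable_continuous_onI]) (auto intro: continuous_intros)

lemma L2_cnj: "u \<in> L2 \<Longrightarrow> (\<lambda>x. cnj (u x)) \<in> L2"
  by (auto simp: L2_def sq_int_def intro: borel_measurable_cnj)

text \<open>Both parts come from the inequality for nonnegative integrals, applied to the moduli.
  The squared form avoids roots in \<open>ennreal\<close>.\<close>

lemma Cauchy_Schwarz_L2:
  assumes "u \<in> L2" "v \<in> L2"
  shows "integrable lborel (\<lambda>x. cnj (u x) * v x)"
    and "(ennreal (cmod (LBINT x. cnj (u x) * v x)))\<^sup>2 \<le> sq_int u * sq_int v"
proof -
  note [measurable] = assms[THEN L2_measurable]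
  have "(\<integral>\<^sup>+x. ennreal (cmod (cnj (u x) * v x)) \<partial>lborel)\<^sup>2
      = (\<integral>\<^sup>+x. ennreal (cmod (u x)) * ennreal (cmod (v x)) \<partial>lborel)\<^sup>2"
    by (simp add: norm_mult ennreal_mult)
  also have "\<dots> \<le> sq_int u * sq_int v"
    unfolding sq_int_def
    using Cauchy_Schwarz_nn_integral[of "\<lambda>x. ennreal (cmod (u x))" lborel "\<lambda>x. ennreal (cmod (v x))"]
    by (simp add: ennreal_power)
  finally have *: "(\<integral>\<^sup>+x. ennreal (cmod (cnj (u x) * v x)) \<partial>lborel)\<^sup>2 \<le> sq_int u * sq_int v" .
  also have "\<dots> < \<infinity>"
    using assms L2_finite by (fastforce simp: ennreal_mult_less_top)
  finally have "(\<integral>\<^sup>+x. ennreal (cmod (cnj (u x) * v x)) \<partial>lborel) < \<infinity>"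
    by (auto simp: power2_eq_square ennreal_mult_less_top)
  moreover have "(\<lambda>x. cnj (u x) * v x) \<in> borel_measurable borel" by measurable
  ultimately show i: "integrable lborel (\<lambda>x. cnj (u x) * v x)"
    by (subst integrable_iff_bounded) simp
  have "ennreal (cmod (LBINT x. cnj (u x) * v x)) \<le> (\<integral>\<^sup>+x. ennreal (cmod (cnj (u x) * v x)) \<partial>lborel)"
    by (rule integral_norm_bound_ennreal[OF i])
  then have "(ennreal (cmod (LBINT x. cnj (u x) * v x)))\<^sup>2 \<le> (\<integral>\<^sup>+x. ennreal (cmod (cnj (u x) * v x)) \<partial>lborel)\<^sup>2"
    by (intro power_mono) auto
  with * show "(ennreal (cmod (LBINT x. cnj (u x) * v x)))\<^sup>2 \<le> sq_int u * sq_int v"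
    by (rule order_trans[rotated])
qed

lemma sq_int_eq_integral:
  assumes "u \<in> L2"
  shows "(LBINT x. cnj (u x) * u x) = complex_of_real (LBINT x. (cmod (u x))\<^sup>2)"
    and "sq_int u = ennreal (LBINT x. (cmod (u x))\<^sup>2)"
    and "integrable lborel (\<lambda>x. (cmod (u x))\<^sup>2)"
proof -
  note [measurable] = assms[THEN L2_measurable]
  have eq: "cnj (u x) * u x = complex_of_real ((cmod (u x))\<^sup>2)" for x
    by (metis complex_norm_square mult.commute)
  show i: "integrable lborel (\<lambda>x. (cmod (u x))\<^sup>2)"
    using L2_finite[OF assms] by (simp add: integrable_iff_bounded sq_int_def)
  then show "(LBINT x. cnj (u x) * u x) = complex_of_real (LBINT x. (cmod (u x))\<^sup>2)"
    unfolding eq by (simp only: integral_complex_of_real)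
  from i show "sq_int u = ennreal (LBINT x. (cmod (u x))\<^sup>2)"
    unfolding sq_int_def by (rule nn_integral_eq_integral) auto
qed

lemma tendsto_of_ennreal_sq_le:
  fixes f :: "'a \<Rightarrow> complex"
  assumes le: "eventually (\<lambda>x. (ennreal (cmod (f x)))\<^sup>2 \<le> B x) F" and B: "(B \<longlongrightarrow> 0) F"
  shows "(f \<longlongrightarrow> 0) F"
proof (rule tendstoI)
  fix e :: real assume e: "e > 0"
  have "eventually (\<lambda>x. B x < ennreal (e\<^sup>2)) F"
    using B e by (intro order_tendstoD(2)) auto
  with le show "eventually (\<lambda>x. dist (f x) 0 < e) F"
  proof eventually_elim
    case (elim x)
    then have "ennreal ((cmod (f x))\<^sup>2) < ennreal (e\<^sup>2)"
      by (simp add: ennreal_power le_less_trans)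
    then have "(cmod (f x))\<^sup>2 < e\<^sup>2" by (simp add: ennreal_less_iff)
    then show ?case using e power_less_imp_less_base[of "cmod (f x)" 2 e] by simp
  qed
qed

text \<open>With U' = U - u and V' = V - v, the inner product splits as (U, V) = (U', V') + (U', v)
  + (u, V') + (u, v), and Cauchy-Schwarz sends the first three terms to 0.\<close>

lemma tendsto_L2_inner:
  assumes u: "eventually (\<lambda>t. U t \<in> L2) F" "u \<in> L2" "((\<lambda>t. sq_int (\<lambda>x. U t x - u x)) \<longlongrightarrow> 0) F"
    and v: "eventually (\<lambda>t. V t \<in> L2) F" "v \<in> L2" "((\<lambda>t. sq_int (\<lambda>x. V t x - v x)) \<longlongrightarrow> 0) F"
  shows "((\<lambda>t. LBINT x. cnj (U t x) * V t x) \<longlongrightarrow> (LBINT x. cnj (u x) * v x)) F"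
proof -
  define a where "a t = (LBINT x. cnj (U t x - u x) * (V t x - v x))" for t
  define b where "b t = (LBINT x. cnj (U t x - u x) * v x)" for t
  define c where "c t = (LBINT x. cnj (u x) * (V t x - v x))" for t
  have ev: "eventually (\<lambda>t. U t \<in> L2 \<and> V t \<in> L2) F"
    using u(1) v(1) by (rule eventually_conj)
  have fin: "sq_int u \<noteq> \<infinity>" "sq_int v \<noteq> \<infinity>" using u v L2_finite by force+
  have "(a \<longlongrightarrow> 0) F"
  proof (rule tendsto_of_ennreal_sq_le)
    show "eventually (\<lambda>t. (ennreal (cmod (a t)))\<^sup>2 \<le> sq_int (\<lambda>x. U t x - u x) * sq_int (\<lambda>x. V t x - v x)) F"
      using ev unfolding a_def
      by eventually_elim (intro Cauchy_Schwarz_L2 L2_diff u(2) v(2), auto)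
    show "((\<lambda>t. sq_int (\<lambda>x. U t x - u x) * sq_int (\<lambda>x. V t x - v x)) \<longlongrightarrow> 0) F"
      using tendsto_mult_ennreal[OF u(3) v(3)] by simp
  qed
  moreover have "(b \<longlongrightarrow> 0) F"
  proof (rule tendsto_of_ennreal_sq_le)
    show "eventually (\<lambda>t. (ennreal (cmod (b t)))\<^sup>2 \<le> sq_int (\<lambda>x. U t x - u x) * sq_int v) F"
      using ev unfolding b_def
      by eventually_elim (intro Cauchy_Schwarz_L2 L2_diff u(2) v(2), auto)
    show "((\<lambda>t. sq_int (\<lambda>x. U t x - u x) * sq_int v) \<longlongrightarrow> 0) F"
      using tendsto_mult_ennreal[OF u(3) tendsto_const[of "sq_int v"]] fin by simp
  qed
  moreover have "(c \<longlongrightarrow> 0) F"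
  proof (rule tendsto_of_ennreal_sq_le)
    show "eventually (\<lambda>t. (ennreal (cmod (c t)))\<^sup>2 \<le> sq_int u * sq_int (\<lambda>x. V t x - v x)) F"
      using ev unfolding c_def
      by eventually_elim (intro Cauchy_Schwarz_L2 L2_diff u(2) v(2), auto)
    show "((\<lambda>t. sq_int u * sq_int (\<lambda>x. V t x - v x)) \<longlongrightarrow> 0) F"
      using tendsto_mult_ennreal[OF tendsto_const[of "sq_int u"] v(3)] fin by simp
  qed
  ultimately have "((\<lambda>t. a t + b t + c t + (LBINT x. cnj (u x) * v x)) \<longlongrightarrow> (0 + 0 + 0 + (LBINT x. cnj (u x) * v x))) F"
    by (intro tendsto_add tendsto_const)
  moreover have "eventually (\<lambda>t. a t + b t + c t + (LBINT x. cnj (u x) * v x) = (LBINT x. cnj (U t x) * V t x)) F"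
    using ev
  proof eventually_elim
    case (elim t)
    note i = Cauchy_Schwarz_L2(1)
    have "a t + b t + c t + (LBINT x. cnj (u x) * v x)
        = (LBINT x. cnj (U t x - u x) * (V t x - v x) + cnj (U t x - u x) * v x
            + cnj (u x) * (V t x - v x) + cnj (u x) * v x)"
      unfolding a_def b_def c_def
      using elim u(2) v(2)
      by (simp only: Bochner_Integration.integral_add Bochner_Integration.integrable_add i L2_diff)
    then show ?case by (simp add: algebra_simps)
  qed
  ultimately show ?thesis by (simp add: tendsto_cong)
qed

text \<open>The Riesz-Fischer theorem for a family indexed by t > 0. The modulus \<open>w\<close>
  depends on the larger parameter only, so one value \<open>w t\<close> controls everything closer
  to 0.\<close>

lemma L2_complete_at_right_0:
  fixes U :: "real \<Rightarrow> real \<Rightarrow> complex" and w :: "real \<Rightarrow> real"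
  assumes U: "\<And>t. t > 0 \<Longrightarrow> U t \<in> L2"
    and w: "\<And>t t'. 0 < t' \<Longrightarrow> t' \<le> t \<Longrightarrow> sq_int (\<lambda>x. U t x - U t' x) \<le> ennreal (w t)"
    and lim: "(w \<longlongrightarrow> 0) (at_right 0)"
  shows "\<exists>u\<in>L2. ((\<lambda>t. sq_int (\<lambda>x. U t x - u x)) \<longlongrightarrow> 0) (at_right 0)"
proof -
  have small: "\<exists>t>0. t \<le> s \<and> w t < e" if "s > 0" "e > 0" for s e
  proof -
    have "eventually (\<lambda>t. w t < e) (at_right 0)"
      using lim \<open>e > 0\<close> by (rule order_tendstoD)
    moreover have "eventually (\<lambda>t. 0 < t \<and> t \<le> s) (at_right 0)"
      using \<open>s > 0\<close> by (auto simp: eventually_at_right_field)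
    ultimately have "eventually (\<lambda>t. 0 < t \<and> t \<le> s \<and> w t < e) (at_right 0)"
      by eventually_elim auto
    then show ?thesis using eventually_happens'[of "at_right (0::real)"] by force
  qed
  \<comment> \<open>The rate 1/8 leaves room for a weight 4^n: the weighted squared increments have
    integrals at most 2^-n, which are summable, and almost everywhere the increments themselves
    decay like 2^-n.\<close>
  have "\<exists>t. \<forall>n. (t n > 0 \<and> w (t n) < (1/8) ^ n) \<and> t (Suc n) \<le> t n"
  proof (rule dependent_nat_choice)
    show "\<exists>t. t > 0 \<and> w t < (1/8) ^ 0" using small[of 1 1] by auto
    show "\<exists>s. (s > 0 \<and> w s < (1/8) ^ Suc n) \<and> s \<le> t" if "t > 0 \<and> w t < (1/8) ^ n" for t and n :: nat
      using small[of t "(1/8) ^ Suc n"] that by auto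
  qed
  then obtain t where t: "\<And>n. t n > 0" "\<And>n. w (t n) < (1/8) ^ n" "\<And>n. t (Suc n) \<le> t n"
    by auto
  have "decseq t" using t(3) by (rule decseq_SucI)
  note [measurable] = U[THEN L2_measurable, OF t(1)]
  define d where "d n x = U (t n) x - U (t (Suc n)) x" for n x
  have [measurable]: "d n \<in> borel_measurable borel" for n unfolding d_def by measurable
  have "(\<integral>\<^sup>+x. (\<Sum>n. ennreal (4 ^ n * (cmod (d n x))\<^sup>2)) \<partial>lborel)
      = (\<Sum>n. \<integral>\<^sup>+x. ennreal (4 ^ n * (cmod (d n x))\<^sup>2) \<partial>lborel)"
    by (rule nn_integral_suminf) measurable
  also have "\<dots> \<le> (\<Sum>n. ennreal ((1/2) ^ n))"
  proof (rule suminf_le)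
    fix n
    have "(\<integral>\<^sup>+x. ennreal (4 ^ n * (cmod (d n x))\<^sup>2) \<partial>lborel) = ennreal (4 ^ n) * sq_int (d n)"
      unfolding sq_int_def by (simp add: ennreal_mult nn_integral_cmult)
    also have "\<dots> \<le> ennreal (4 ^ n) * ennreal ((1/8) ^ n)"
    proof (rule mult_left_mono)
      have "sq_int (d n) \<le> ennreal (w (t n))"
        unfolding d_def by (intro w t)
      also have "\<dots> \<le> ennreal ((1/8) ^ n)" using t(2)[of n] by (intro ennreal_leI) simp
      finally show "sq_int (d n) \<le> ennreal ((1/8) ^ n)" .
    qed simp
    also have "\<dots> = ennreal ((1/2) ^ n)"
      by (simp flip: ennreal_mult power_mult_distrib)
    finally show "(\<integral>\<^sup>+x. ennreal (4 ^ n * (cmod (d n x))\<^sup>2) \<partial>lborel) \<le> ennreal ((1/2) ^ n)" .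
  qed auto
  also have "\<dots> = ennreal (\<Sum>n. (1/2) ^ n)"
    by (rule suminf_ennreal2) auto
  also have "\<dots> < \<infinity>" by simp
  finally have "(\<integral>\<^sup>+x. (\<Sum>n. ennreal (4 ^ n * (cmod (d n x))\<^sup>2)) \<partial>lborel) \<noteq> \<infinity>" by simp
  then have "AE x in lborel. (\<Sum>n. ennreal (4 ^ n * (cmod (d n x))\<^sup>2)) \<noteq> \<infinity>"
    by (intro nn_integral_PInf_AE) auto
  then have ae: "AE x in lborel. convergent (\<lambda>n. U (t n) x)"
  proof eventually_elim
    case (elim x)
    define K where "K = (\<Sum>n. 4 ^ n * (cmod (d n x))\<^sup>2)"
    have s: "summable (\<lambda>n. 4 ^ n * (cmod (d n x))\<^sup>2)"
      using elim by (intro summable_suminf_not_top) auto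
    have "summable (\<lambda>n. d n x)"
    proof (rule summable_comparison_test')
      show "summable (\<lambda>n. sqrt K * (1/2) ^ n)"
        by (intro summable_mult summable_geometric) auto
      fix n
      have "4 ^ n * (cmod (d n x))\<^sup>2 \<le> K"
        unfolding K_def using sum_le_suminf[OF s, of "{n}"] by simp
      then have "sqrt (4 ^ n * (cmod (d n x))\<^sup>2) \<le> sqrt K" by simp
      moreover have "sqrt (4 ^ n * (cmod (d n x))\<^sup>2) = 2 ^ n * cmod (d n x)"
        by (simp add: real_sqrt_mult real_sqrt_power)
      ultimately show "cmod (d n x) \<le> sqrt K * (1/2) ^ n"
        by (simp add: field_simps power_divide)
    qed
    then have "convergent (\<lambda>n. U (t 0) x - (\<Sum>k<n. d k x))"
      by (intro convergent_diff convergent_const) (simp add: summable_iff_convergent)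
    moreover have "U (t 0) x - (\<Sum>k<n. d k x) = U (t n) x" for n
      by (induction n) (simp_all add: d_def algebra_simps)
    ultimately show ?case by simp
  qed
  \<comment> \<open>On the null set where the sequence diverges, \<open>lim\<close> is unspecified.
    Measurability holds all the same, and the integrals do not see this set.\<close>
  define u where "u x = lim (\<lambda>n. U (t n) x)" for x
  have [measurable]: "u \<in> borel_measurable borel"
    unfolding u_def by (rule borel_measurable_lim_metric) measurable
  have bound: "sq_int (\<lambda>x. U (t n) x - u x) \<le> ennreal (w (t n))" for n
  proof -
    \<comment> \<open>Fatou's lemma: with n frozen and m growing, the bound on the distance from
      \<open>U (t n)\<close> to \<open>U (t m)\<close> survives the limit.\<close>
    have "sq_int (\<lambda>x. U (t n) x - u x)
        = (\<integral>\<^sup>+x. liminf (\<lambda>m. ennreal ((cmod (U (t n) x - U (t m) x))\<^sup>2)) \<partial>lborel)"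
      unfolding sq_int_def
    proof (rule nn_integral_cong_AE)
      show "AE x in lborel. ennreal ((cmod (U (t n) x - u x))\<^sup>2)
          = liminf (\<lambda>m. ennreal ((cmod (U (t n) x - U (t m) x))\<^sup>2))"
        using ae
      proof eventually_elim
        case (elim x)
        then have "(\<lambda>m. U (t m) x) \<longlonglongrightarrow> u x"
          unfolding u_def by (simp add: convergent_LIMSEQ_iff)
        then have "(\<lambda>m. ennreal ((cmod (U (t n) x - U (t m) x))\<^sup>2)) \<longlonglongrightarrow> ennreal ((cmod (U (t n) x - u x))\<^sup>2)"
          by (intro tendsto_intros)
        then show ?case by (intro lim_imp_Liminf[symmetric]) auto
      qed
    qed
    also have "\<dots> \<le> liminf (\<lambda>m. sq_int (\<lambda>x. U (t n) x - U (t m) x))"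
      unfolding sq_int_def by (rule nn_integral_liminf) measurable
    also have "\<dots> \<le> ennreal (w (t n))"
    proof (rule Liminf_le)
      show "eventually (\<lambda>m. sq_int (\<lambda>x. U (t n) x - U (t m) x) \<le> ennreal (w (t n))) sequentially"
        using eventually_ge_at_top[of n]
      proof eventually_elim
        case (elim m)
        then show ?case using t(1) \<open>decseq t\<close> by (intro w) (auto simp: decseq_def)
      qed
    qed auto
    finally show ?thesis .
  qed
  have "(\<lambda>x. U (t 0) x - u x) \<in> L2"
    using bound[of 0] unfolding L2_def by (auto elim: le_less_trans)
  from L2_diff[OF U[OF t(1)[of 0]] this] have "u \<in> L2" by simp
  moreover have "((\<lambda>s. sq_int (\<lambda>x. U s x - u x)) \<longlongrightarrow> 0) (at_right 0)"
  proof (rule tendsto_zero_ennreal)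
    fix e :: real assume "e > 0"
    \<comment> \<open>Two squared distances, each at most (1/8)^n and each doubled by
      \<open>sq_int_add_le\<close>, account for the factor 4.\<close>
    obtain n where n: "(1/8) ^ n < e / 4"
      using real_arch_pow_inv[of "e / 4" "1/8"] \<open>e > 0\<close> by auto
    have "eventually (\<lambda>s. 0 < s \<and> s \<le> t n) (at_right 0)"
      using t(1)[of n] by (auto simp: eventually_at_right_field intro!: exI[of _ "t n"])
    then show "eventually (\<lambda>s. sq_int (\<lambda>x. U s x - u x) < ennreal e) (at_right 0)"
    proof eventually_elim
      case (elim s)
      have [measurable]: "U s \<in> borel_measurable borel" using elim U L2_measurable by auto
      have "sq_int (\<lambda>x. U s x - u x) = sq_int (\<lambda>x. (U s x - U (t n) x) + (U (t n) x - u x))"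
        by simp
      also have "\<dots> \<le> 2 * sq_int (\<lambda>x. U s x - U (t n) x) + 2 * sq_int (\<lambda>x. U (t n) x - u x)"
        by (rule sq_int_add_le) measurable
      also have "\<dots> \<le> 2 * ennreal (w (t n)) + 2 * ennreal (w (t n))"
        using elim w[of s "t n"] bound[of n]
        by (intro add_mono mult_left_mono) (auto simp: sq_int_minus_commute[of "U s"])
      also have "\<dots> \<le> ennreal (4 * (1/8) ^ n)"
      proof -
        have "ennreal (w (t n)) \<le> ennreal ((1/8) ^ n)" using t(2)[of n] by (intro ennreal_leI) simp
        then have "4 * ennreal (w (t n)) \<le> 4 * ennreal ((1/8) ^ n)" by (rule mult_left_mono) simp
        moreover have "2 * z + 2 * z = 4 * z" for z :: ennreal
          by (simp flip: distrib_right)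
        ultimately show ?thesis by (simp add: ennreal_mult)
      qed
      also have "\<dots> < ennreal e" using n \<open>e > 0\<close> by (intro ennreal_lessI) auto
      finally show ?case .
    qed
  qed
  ultimately show ?thesis by blast
qed

section \<open>Integrals over vertical lines\<close>

lemma integrable_continuous_tail:
  fixes u :: "real \<Rightarrow> complex"
  assumes cont: "continuous_on UNIV u"
    and tail: "(\<integral>\<^sup>+x. ennreal (cmod (u x)) * indicator (- {-T..T}) x \<partial>lborel) < \<infinity>"
  shows "integrable lborel u"
proof -
  have [measurable]: "u \<in> borel_measurable borel"
    using cont by (rule borel_measurable_continuous_onI)
  have 1: "set_integrable lborel {-T..T} u"
    by (intro borel_integrable_atLeastAtMost' continuous_on_subset[OF cont]) auto
  have "(\<integral>\<^sup>+x. ennreal (cmod (indicator (- {-T..T}) x *\<^sub>R u x)) \<partial>lborel)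
      = (\<integral>\<^sup>+x. ennreal (cmod (u x)) * indicator (- {-T..T}) x \<partial>lborel)"
    by (intro nn_integral_cong) (auto split: split_indicator)
  with tail have 2: "set_integrable lborel (- {-T..T}) u"
    unfolding set_integrable_def by (subst integrable_iff_bounded) simp
  have "set_integrable lborel ({-T..T} \<union> - {-T..T}) u"
    by (intro set_integrable_Un 1 2) auto
  then show ?thesis by (simp add: set_integrable_def)
qed

text \<open>A positive lower bound on a half-line would make the integral infinite. Smallness at
  some arbitrarily large argument takes the place of decay at infinity.\<close>

lemma nn_integral_finite_imp_small:
  fixes f :: "real \<Rightarrow> ennreal"
  assumes [measurable]: "f \<in> borel_measurable borel"
    and fin: "(\<integral>\<^sup>+x. f x * indicator {a<..} x \<partial>lborel) < \<infinity>" and e: "e > 0"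
  shows "\<exists>x\<ge>b. f x < e"
proof (rule ccontr)
  assume "\<not> ?thesis"
  then have ge: "f x \<ge> e" if "x \<ge> b" for x using that by (meson not_less)
  have "(\<integral>\<^sup>+x. e * indicator {max a b<..} x \<partial>lborel) \<le> (\<integral>\<^sup>+x. f x * indicator {a<..} x \<partial>lborel)"
    using ge by (intro nn_integral_mono) (auto split: split_indicator)
  moreover have "emeasure lborel {max a b<..} = \<infinity>"
  proof (rule ccontr)
    assume "emeasure lborel {max a b<..} \<noteq> \<infinity>"
    then obtain r where r: "r \<ge> 0" "emeasure lborel {max a b<..} = ennreal r"
      by (metis ennreal_cases infinity_ennreal_def)
    have "emeasure lborel {max a b<..max a b + (r + 1)} \<le> emeasure lborel {max a b<..}"
      by (intro emeasure_mono) auto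
    then have "ennreal (r + 1) \<le> ennreal r" using r by simp
    then show False using r by (simp add: ennreal_le_iff)
  qed
  ultimately show False
    using fin e by (auto simp: nn_integral_cmult_indicator ennreal_mult_top top_unique split: if_splits)
qed

lemma tendsto_integral_symmetric_at_top:
  fixes u :: "real \<Rightarrow> complex"
  assumes "integrable lborel u"
  shows "((\<lambda>T. LBINT x:{-T..T}. u x) \<longlongrightarrow> (LBINT x. u x)) at_top"
  unfolding set_lebesgue_integral_def
proof (rule integral_dominated_convergence_at_top)
  show [measurable]: "u \<in> borel_measurable lborel" using assms by simp
  show "(\<lambda>x. indicator {-T..T} x *\<^sub>R u x) \<in> borel_measurable lborel" for T by measurable
  show "integrable lborel (\<lambda>x. cmod (u x))" using assms by simp
  show "eventually (\<lambda>T. AE x in lborel. norm (indicator {-T..T} x *\<^sub>R u x) \<le> cmod (u x)) at_top"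
    by (intro always_eventually allI AE_I2) (auto split: split_indicator)
  show "AE x in lborel. ((\<lambda>T. indicator {-T..T} x *\<^sub>R u x) \<longlongrightarrow> u x) at_top"
  proof (rule AE_I2)
    fix x
    have "eventually (\<lambda>T. indicator {-T..T} x *\<^sub>R u x = u x) at_top"
      using eventually_ge_at_top[of "\<bar>x\<bar>"] by eventually_elim (auto split: split_indicator)
    then show "((\<lambda>T. indicator {-T..T} x *\<^sub>R u x) \<longlongrightarrow> u x) at_top"
      by (rule tendsto_eventually)
  qed
qed

lemma set_integral_eq_FTC:
  fixes h :: "real \<Rightarrow> complex"
  assumes "a \<le> b" "continuous_on {a..b} h"
    and "\<And>x. x \<in> {a..b} \<Longrightarrow> (\<Phi> has_vector_derivative h x) (at x within {a..b})"
  shows "(LBINT x:{a..b}. h x) = \<Phi> b - \<Phi> a"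
proof -
  have "set_integrable lborel {a..b} h"
    by (rule borel_integrable_atLeastAtMost'[OF assms(2)])
  then have "(LBINT x:{a..b}. h x) = integral {a..b} h"
    by (rule set_borel_integral_eq_integral)
  also have "\<dots> = \<Phi> b - \<Phi> a"
    using fundamental_theorem_of_calculus[OF assms(1) assms(3)] by (simp add: integral_unique)
  finally show ?thesis .
qed

lemma continuous_on_vertical_line:
  assumes "continuous_on S G" "\<And>\<omega>. Complex x \<omega> \<in> S"
  shows "continuous_on UNIV (\<lambda>\<omega>. G (Complex x \<omega>))"
proof (rule continuous_on_compose2[OF assms(1)])
  show "continuous_on UNIV (Complex x)"
    unfolding Complex_eq by (intro continuous_intros)
qed (use assms(2) in auto)

text \<open>A rectangle argument: a primitive on the convex set turns the integrals over the four
  edges into differences of its values. The bound \<open>K\<close> is uniform in x and concerns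
  heights beyond \<open>T\<close>; on the compact remainder continuity gives integrability.
  Integrating the bound over x makes the horizontal edges small at suitable heights.\<close>

lemma vertical_integral_shift:
  fixes G :: "complex \<Rightarrow> complex"
  assumes S: "open S" "convex S" "\<And>x \<omega>. x1 \<le> x \<Longrightarrow> x \<le> x2 \<Longrightarrow> Complex x \<omega> \<in> S"
    and hol: "G holomorphic_on S" and le: "x1 \<le> x2"
    and K: "\<And>x. x1 \<le> x \<Longrightarrow> x \<le> x2 \<Longrightarrow>
      (\<integral>\<^sup>+\<omega>. ennreal (cmod (G (Complex x \<omega>))) * indicator (- {-T..T}) \<omega> \<partial>lborel) \<le> ennreal K"
  shows "(LBINT \<omega>. G (Complex x1 \<omega>)) = (LBINT \<omega>. G (Complex x2 \<omega>))"
proof -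
  obtain \<Phi> where \<Phi>: "\<And>z. z \<in> S \<Longrightarrow> (\<Phi> has_field_derivative G z) (at z within S)"
    using holomorphic_convex_primitive'[OF S(2,1) hol] by blast
  then have \<Phi>: "(\<Phi> has_field_derivative G z) (at z)" if "z \<in> S" for z
    using that S(1) by (metis at_within_open)
  have contG: "continuous_on S G" using hol by (rule holomorphic_on_imp_continuous_on)
  have cont_v: "continuous_on UNIV (\<lambda>\<omega>. G (Complex x \<omega>))" if "x1 \<le> x" "x \<le> x2" for x
    using continuous_on_vertical_line[OF contG] S(3) that by blast
  have int: "integrable lborel (\<lambda>\<omega>. G (Complex x \<omega>))" if "x1 \<le> x" "x \<le> x2" for x
    using K[OF that] by (intro integrable_continuous_tail[OF cont_v[OF that]]) (auto elim: le_less_trans)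
  define I where "I x T = (LBINT \<omega>:{-T..T}. G (Complex x \<omega>))" for x T
  define h where "h \<omega> = (LBINT x:{x1..x2}. G (Complex x \<omega>))" for \<omega>
  have I: "\<i> * I x T = \<Phi> (Complex x T) - \<Phi> (Complex x (- T))" if "x1 \<le> x" "x \<le> x2" "T \<ge> 0" for x T
  proof -
    have "(LBINT \<omega>:{-T..T}. \<i> * G (Complex x \<omega>)) = \<Phi> (Complex x T) - \<Phi> (Complex x (- T))"
    proof (rule set_integral_eq_FTC)
      show "continuous_on {-T..T} (\<lambda>\<omega>. \<i> * G (Complex x \<omega>))"
        using that by (intro continuous_intros continuous_on_subset[OF cont_v]) auto
      fix \<omega>
      have "(Complex x has_vector_derivative \<i>) (at \<omega> within {-T..T})"
        unfolding Complex_eq by (auto intro!: derivative_eq_intros)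
      from field_vector_diff_chain_within[OF this has_field_derivative_at_within[OF \<Phi>]]
      show "((\<lambda>\<omega>. \<Phi> (Complex x \<omega>)) has_vector_derivative \<i> * G (Complex x \<omega>)) (at \<omega> within {-T..T})"
        using S(3) that by (simp add: o_def)
    qed (use that in auto)
    then show ?thesis by (simp add: I_def)
  qed
  have cont_h: "continuous_on {x1..x2} (\<lambda>x. G (Complex x \<omega>))" for \<omega>
  proof (rule continuous_on_compose2[OF contG])
    show "continuous_on {x1..x2} (\<lambda>x. Complex x \<omega>)"
      unfolding Complex_eq by (intro continuous_intros)
  qed (use S(3) in auto)
  have h: "h \<omega> = \<Phi> (Complex x2 \<omega>) - \<Phi> (Complex x1 \<omega>)" for \<omega>
    unfolding h_def
  proof (rule set_integral_eq_FTC[OF le cont_h])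
    fix x assume "x \<in> {x1..x2}"
    have "((\<lambda>x. Complex x \<omega>) has_vector_derivative 1) (at x within {x1..x2})"
      unfolding Complex_eq by (auto intro!: derivative_eq_intros)
    from field_vector_diff_chain_within[OF this has_field_derivative_at_within[OF \<Phi>]]
    show "((\<lambda>x. \<Phi> (Complex x \<omega>)) has_vector_derivative G (Complex x \<omega>)) (at x within {x1..x2})"
      using S(3) \<open>x \<in> _\<close> by (simp add: o_def)
  qed
  have diff: "\<i> * (I x2 T - I x1 T) = h T - h (- T)" if "T \<ge> 0" for T
    using I[of x1 T] I[of x2 T] that le by (simp add: h algebra_simps)
  \<comment> \<open>A bound for the horizontal edge at height \<omega> that is the integral of a
    nonnegative function, so the order of integration in x and \<omega> may be exchanged.\<close>
  define q where "q \<omega> = (\<integral>\<^sup>+x. ennreal (cmod (G (Complex x \<omega>))) * indicator {x1..x2} x \<partial>lborel)" for \<omega>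
  have hq: "ennreal (cmod (h \<omega>)) \<le> q \<omega>" for \<omega>
  proof -
    have "set_integrable lborel {x1..x2} (\<lambda>x. G (Complex x \<omega>))"
      by (rule borel_integrable_atLeastAtMost'[OF cont_h])
    then have "ennreal (cmod (h \<omega>)) \<le> (\<integral>\<^sup>+x. ennreal (cmod (indicator {x1..x2} x *\<^sub>R G (Complex x \<omega>))) \<partial>lborel)"
      unfolding h_def set_lebesgue_integral_def set_integrable_def by (rule integral_norm_bound_ennreal)
    also have "\<dots> = q \<omega>"
      unfolding q_def by (intro nn_integral_cong) (auto split: split_indicator)
    finally show ?thesis .
  qed
  \<comment> \<open>Cutting off inside the norm leaves a function continuous on a closed strip and
    zero elsewhere, which gives joint measurability.\<close>
  define g where "g = (\<lambda>z::real \<times> real. ennreal (cmod (indicator ({x1..x2} \<times> UNIV) z *\<^sub>R G (Complex (fst z) (snd z)))))"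
  have "continuous_on ({x1..x2} \<times> UNIV) (\<lambda>z. G (Complex (fst z) (snd z)))"
  proof (rule continuous_on_compose2[OF contG])
    show "continuous_on ({x1..x2} \<times> UNIV) (\<lambda>z. Complex (fst z) (snd z))"
      unfolding Complex_eq by (intro continuous_intros)
  qed (use S(3) in auto)
  then have "(\<lambda>z. indicator ({x1..x2} \<times> UNIV) z *\<^sub>R G (Complex (fst z) (snd z))) \<in> borel_measurable borel"
    by (intro borel_measurable_continuous_on_indicator borel_closed closed_Times) auto
  from measurable_compose[OF this borel_measurable_norm] have "(\<lambda>z. ennreal (cmod (indicator ({x1..x2} \<times> UNIV) z *\<^sub>R G (Complex (fst z) (snd z))))) \<in> borel_measurable borel"
    by (rule measurable_compose[OF _ measurable_ennreal])
  then have [measurable]: "g \<in> borel_measurable (lborel \<Otimes>\<^sub>M lborel)"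
    by (simp only: g_def lborel_prod measurable_lborel1 measurable_lborel2)
  have g: "g (x, \<omega>) = ennreal (cmod (G (Complex x \<omega>))) * indicator {x1..x2} x" for x \<omega>
    unfolding g_def by (auto split: split_indicator)
  have q: "q = (\<lambda>\<omega>. \<integral>\<^sup>+x. g (x, \<omega>) \<partial>lborel)"
    unfolding q_def g ..
  have [measurable]: "q \<in> borel_measurable borel"
  proof -
    have "(\<lambda>\<omega>. \<integral>\<^sup>+x. g (x, \<omega>) \<partial>lborel) \<in> borel_measurable lborel" by measurable
    then show ?thesis by (simp add: q)
  qed
  have "(\<integral>\<^sup>+\<omega>. q \<omega> * indicator (- {-T..T}) \<omega> \<partial>lborel)
      = (\<integral>\<^sup>+\<omega>. (\<integral>\<^sup>+x. g (x, \<omega>) * indicator (- {-T..T}) \<omega> \<partial>lborel) \<partial>lborel)"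
    unfolding q by (simp add: nn_integral_multc)
  also have "\<dots> = (\<integral>\<^sup>+x. (\<integral>\<^sup>+\<omega>. g (x, \<omega>) * indicator (- {-T..T}) \<omega> \<partial>lborel) \<partial>lborel)"
    by (rule lborel_pair.Fubini') measurable
  also have "\<dots> \<le> (\<integral>\<^sup>+x. ennreal K * indicator {x1..x2} x \<partial>lborel)"
  proof (rule nn_integral_mono)
    fix x
    show "(\<integral>\<^sup>+\<omega>. g (x, \<omega>) * indicator (- {-T..T}) \<omega> \<partial>lborel) \<le> ennreal K * indicator {x1..x2} x"
      using K[of x] by (auto simp: g split: split_indicator)
  qed
  also have "\<dots> < \<infinity>" using le by (simp add: nn_integral_cmult_indicator ennreal_mult_less_top)
  finally have fin: "(\<integral>\<^sup>+\<omega>. q \<omega> * indicator (- {-T..T}) \<omega> \<partial>lborel) < \<infinity>" .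
  have "(\<integral>\<^sup>+\<omega>. (q \<omega> + q (- \<omega>)) * indicator {\<bar>T\<bar><..} \<omega> \<partial>lborel)
      \<le> (\<integral>\<^sup>+\<omega>. q \<omega> * indicator (- {-T..T}) \<omega> + q (- \<omega>) * indicator (- {-T..T}) (- \<omega>) \<partial>lborel)"
    by (intro nn_integral_mono) (auto split: split_indicator)
  also have "\<dots> = (\<integral>\<^sup>+\<omega>. q \<omega> * indicator (- {-T..T}) \<omega> \<partial>lborel)
      + (\<integral>\<^sup>+\<omega>. q (- \<omega>) * indicator (- {-T..T}) (- \<omega>) \<partial>lborel)"
    by (rule nn_integral_add) measurable
  also have "(\<integral>\<^sup>+\<omega>. q (- \<omega>) * indicator (- {-T..T}) (- \<omega>) \<partial>lborel)
      = (\<integral>\<^sup>+\<omega>. q \<omega> * indicator (- {-T..T}) \<omega> \<partial>lborel)"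
    using nn_integral_real_affine[of "\<lambda>\<omega>. q \<omega> * indicator (- {-T..T}) \<omega>" "-1" 0] by simp
  finally have fin2: "(\<integral>\<^sup>+\<omega>. (q \<omega> + q (- \<omega>)) * indicator {\<bar>T\<bar><..} \<omega> \<partial>lborel) < \<infinity>"
    using fin by (auto elim!: le_less_trans)
  have "cmod ((LBINT \<omega>. G (Complex x2 \<omega>)) - (LBINT \<omega>. G (Complex x1 \<omega>))) \<le> 0 + e" if "e > 0" for e
  proof -
    have "((\<lambda>T. I x2 T - I x1 T) \<longlongrightarrow> (LBINT \<omega>. G (Complex x2 \<omega>)) - (LBINT \<omega>. G (Complex x1 \<omega>))) at_top"
      unfolding I_def using le by (intro tendsto_diff tendsto_integral_symmetric_at_top int) auto
    then have "eventually (\<lambda>T. dist (I x2 T - I x1 T) ((LBINT \<omega>. G (Complex x2 \<omega>)) - (LBINT \<omega>. G (Complex x1 \<omega>))) < e / 2) at_top"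
      using that by (intro tendstoD) auto
    then obtain T1 where T1: "\<And>T. T \<ge> T1 \<Longrightarrow> dist (I x2 T - I x1 T) ((LBINT \<omega>. G (Complex x2 \<omega>)) - (LBINT \<omega>. G (Complex x1 \<omega>))) < e / 2"
      by (auto simp: eventually_at_top_linorder)
    \<comment> \<open>The sum of \<open>q\<close> at \<omega> and at -\<omega> has finite integral
      far out, so the upper and the lower edge are small at the same height. One half of
      \<open>e\<close> goes to these edges, the other to truncating the vertical lines.\<close>
    obtain T2 where T2: "T2 \<ge> max 0 T1" "q T2 + q (- T2) < ennreal (e / 2)"
      using nn_integral_finite_imp_small[OF _ fin2, of "ennreal (e / 2)" "max 0 T1"] \<open>e > 0\<close> by auto
    have "cmod (I x2 T2 - I x1 T2) = cmod (h T2 - h (- T2))"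
      using diff[of T2] T2 by (metis max.bounded_iff mult_1 norm_ii norm_mult)
    also have "\<dots> \<le> cmod (h T2) + cmod (h (- T2))" by (rule norm_triangle_ineq4)
    also have "\<dots> < e / 2"
    proof -
      have "ennreal (cmod (h T2) + cmod (h (- T2))) \<le> q T2 + q (- T2)"
        using hq[of T2] hq[of "- T2"] by (simp add: ennreal_plus add_mono)
      also note T2(2)
      finally show ?thesis by (subst (asm) ennreal_less_iff) auto
    qed
    finally have "cmod (I x2 T2 - I x1 T2) < e / 2" .
    moreover have "cmod (((LBINT \<omega>. G (Complex x2 \<omega>)) - (LBINT \<omega>. G (Complex x1 \<omega>))) - (I x2 T2 - I x1 T2)) < e / 2"
      using T1[of T2] T2(1) by (simp add: dist_norm norm_minus_commute)
    ultimately show ?thesis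
      using norm_triangle_sub[of "(LBINT \<omega>. G (Complex x2 \<omega>)) - (LBINT \<omega>. G (Complex x1 \<omega>))" "I x2 T2 - I x1 T2"]
      by simp
  qed
  then have "cmod ((LBINT \<omega>. G (Complex x2 \<omega>)) - (LBINT \<omega>. G (Complex x1 \<omega>))) \<le> 0"
    by (rule field_le_epsilon)
  then show ?thesis by simp
qed

section \<open>The scalar Hardy space\<close>

definition hardy :: "(complex \<Rightarrow> complex) \<Rightarrow> bool" where
  "hardy f \<longleftrightarrow> f holomorphic_on rhp \<and>
     (\<exists>M. \<forall>\<xi>>0. sq_int (\<lambda>\<omega>. f (Complex \<xi> \<omega>)) \<le> ennreal M)"

lemma open_rhp: "open rhp" and convex_rhp: "convex rhp"
  unfolding rhp_def using open_halfspace_Re_gt[of 0] convex_halfspace_Re_gt[of 0] by auto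

lemma hardy_holomorphic: "hardy f \<Longrightarrow> f holomorphic_on rhp"
  by (simp add: hardy_def)

lemma hardy_bound:
  assumes "hardy f"
  obtains M where "M \<ge> 0" "\<And>\<xi>. \<xi> > 0 \<Longrightarrow> sq_int (\<lambda>\<omega>. f (Complex \<xi> \<omega>)) \<le> ennreal M"
proof -
  obtain M where "\<forall>\<xi>>0. sq_int (\<lambda>\<omega>. f (Complex \<xi> \<omega>)) \<le> ennreal M"
    using assms by (auto simp: hardy_def)
  moreover have "ennreal M \<le> ennreal (max 0 M)" by (simp add: ennreal_leI)
  ultimately show ?thesis by (intro that[of "max 0 M"]) (auto intro: order_trans)
qed

lemma hardy_L2:
  assumes "hardy f" "\<xi> > 0"
  shows "(\<lambda>\<omega>. f (Complex \<xi> \<omega>)) \<in> L2"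
proof -
  have "continuous_on UNIV (\<lambda>\<omega>. f (Complex \<xi> \<omega>))"
    using assms
    by (intro continuous_on_vertical_line[OF holomorphic_on_imp_continuous_on[OF hardy_holomorphic]])
       (auto simp: rhp_def)
  then have "(\<lambda>\<omega>. f (Complex \<xi> \<omega>)) \<in> borel_measurable borel"
    by (rule borel_measurable_continuous_onI)
  moreover obtain M where "sq_int (\<lambda>\<omega>. f (Complex \<xi> \<omega>)) \<le> ennreal M"
    using hardy_bound[OF assms(1)] assms(2) by blast
  then have "sq_int (\<lambda>\<omega>. f (Complex \<xi> \<omega>)) < \<infinity>" by (auto elim: le_less_trans)
  ultimately show ?thesis by (simp add: L2_def)
qed

text \<open>The integrand \<open>cnj (f (c - cnj s)) * f s\<close> is holomorphic in the strip \<open>0 < Re s < c\<close>.\<close>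

lemma hardy_correlation_shift_aux:
  assumes f: "hardy f" and pos: "0 < \<eta>" "\<eta> \<le> \<eta>'" "\<eta>' < c"
  shows "(LBINT \<omega>. cnj (f (Complex (c - \<eta>) \<omega>)) * f (Complex \<eta> \<omega>))
       = (LBINT \<omega>. cnj (f (Complex (c - \<eta>') \<omega>)) * f (Complex \<eta>' \<omega>))"
proof -
  define S where "S = {s. 0 < Re s \<and> Re s < c}"
  define G where "G s = cnj (f (cnj (complex_of_real c - s))) * f s" for s
  obtain M where M: "M \<ge> 0" "\<And>\<xi>. \<xi> > 0 \<Longrightarrow> sq_int (\<lambda>\<omega>. f (Complex \<xi> \<omega>)) \<le> ennreal M"
    using hardy_bound[OF f] by blast
  have G: "G (Complex x \<omega>) = cnj (f (Complex (c - x) \<omega>)) * f (Complex x \<omega>)" for x \<omega>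
  proof -
    have "cnj (complex_of_real c - Complex x \<omega>) = Complex (c - x) \<omega>" by (simp add: complex_eq_iff)
    then show ?thesis by (simp only: G_def)
  qed
  have "open S" "convex S"
    unfolding S_def Collect_conj_eq
    by (intro open_Int convex_Int open_halfspace_Re_gt open_halfspace_Re_lt convex_halfspace_Re_gt convex_halfspace_Re_lt)+
  moreover have "G holomorphic_on S"
  proof -
    have cnj_rhp: "cnj ` rhp = rhp"
      by (auto simp: rhp_def image_def intro!: exI[of _ "cnj _"])
    have "(cnj \<circ> f \<circ> cnj) holomorphic_on rhp"
      by (rule holomorphic_on_compose_cnj_cnj) (simp_all add: cnj_rhp open_rhp hardy_holomorphic[OF f])
    then have "((cnj \<circ> f \<circ> cnj) \<circ> (\<lambda>s. complex_of_real c - s)) holomorphic_on S"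
      by (rule holomorphic_on_compose_gen[rotated]) (auto simp: S_def rhp_def intro!: holomorphic_intros)
    moreover have "f holomorphic_on S"
      using hardy_holomorphic[OF f] by (rule holomorphic_on_subset) (auto simp: S_def rhp_def)
    ultimately show ?thesis unfolding G_def o_def by (intro holomorphic_on_mult)
  qed
  moreover have "(\<integral>\<^sup>+\<omega>. ennreal (cmod (G (Complex x \<omega>))) * indicator (- {-0..0}) \<omega> \<partial>lborel) \<le> ennreal (M + M)"
    if "\<eta> \<le> x" "x \<le> \<eta>'" for x
  proof -
    have [measurable]: "(\<lambda>\<omega>. f (Complex x \<omega>)) \<in> borel_measurable borel"
      "(\<lambda>\<omega>. f (Complex (c - x) \<omega>)) \<in> borel_measurable borel"
      using hardy_L2[OF f, of x] hardy_L2[OF f, of "c - x"] that pos L2_measurable by auto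
    have "(\<integral>\<^sup>+\<omega>. ennreal (cmod (G (Complex x \<omega>))) * indicator (- {-0..0}) \<omega> \<partial>lborel)
        \<le> (\<integral>\<^sup>+\<omega>. ennreal ((cmod (f (Complex (c - x) \<omega>)))\<^sup>2) + ennreal ((cmod (f (Complex x \<omega>)))\<^sup>2) \<partial>lborel)"
    proof (rule nn_integral_mono)
      fix \<omega>
      have "a * b \<le> a\<^sup>2 + b\<^sup>2" for a b :: real
        using sum_squares_bound[of a b] zero_le_power2[of a] zero_le_power2[of b] by linarith
      then have "cmod (G (Complex x \<omega>)) \<le> (cmod (f (Complex (c - x) \<omega>)))\<^sup>2 + (cmod (f (Complex x \<omega>)))\<^sup>2"
        unfolding G by (simp add: norm_mult)
      then have "ennreal (cmod (G (Complex x \<omega>))) \<le> ennreal ((cmod (f (Complex (c - x) \<omega>)))\<^sup>2) + ennreal ((cmod (f (Complex x \<omega>)))\<^sup>2)"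
        by (simp flip: ennreal_plus add: ennreal_leI)
      then show "ennreal (cmod (G (Complex x \<omega>))) * indicator (- {-0..0}) \<omega>
          \<le> ennreal ((cmod (f (Complex (c - x) \<omega>)))\<^sup>2) + ennreal ((cmod (f (Complex x \<omega>)))\<^sup>2)"
        by (auto split: split_indicator)
    qed
    also have "\<dots> = sq_int (\<lambda>\<omega>. f (Complex (c - x) \<omega>)) + sq_int (\<lambda>\<omega>. f (Complex x \<omega>))"
      unfolding sq_int_def by (rule nn_integral_add) measurable
    also have "\<dots> \<le> ennreal M + ennreal M"
      using that pos by (intro add_mono M) auto
    finally show ?thesis using M(1) by (simp only: ennreal_plus)
  qed
  ultimately have "(LBINT \<omega>. G (Complex \<eta> \<omega>)) = (LBINT \<omega>. G (Complex \<eta>' \<omega>))"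
    using pos by (intro vertical_integral_shift[where S = S and T = 0]) (auto simp: S_def)
  then show ?thesis unfolding G .
qed

text \<open>The argument is the sum of two abscissas, hence the half: the energy on the line Re s =
  \<xi> is \<open>line_energy f (2 * \<xi>)\<close>.\<close>

definition line_energy :: "(complex \<Rightarrow> complex) \<Rightarrow> real \<Rightarrow> real" where
  "line_energy f t = (LBINT \<omega>. (cmod (f (Complex (t / 2) \<omega>)))\<^sup>2)"

text \<open>The two lines are moved in opposite directions, keeping the sum of their abscissas,
  until they meet in the middle, where a correlation is an energy. The cases are the two orders in
  which the lines can lie.\<close>

lemma hardy_correlation:
  assumes f: "hardy f" and pos: "\<xi> > 0" "\<eta> > 0"
  shows "(LBINT \<omega>. cnj (f (Complex \<xi> \<omega>)) * f (Complex \<eta> \<omega>)) = complex_of_real (line_energy f (\<xi> + \<eta>))"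
proof -
  define c where "c = \<xi> + \<eta>"
  have "(LBINT \<omega>. cnj (f (Complex (c - \<eta>) \<omega>)) * f (Complex \<eta> \<omega>))
      = (LBINT \<omega>. cnj (f (Complex (c - c / 2) \<omega>)) * f (Complex (c / 2) \<omega>))"
  proof (cases "\<eta> \<le> c / 2")
    case True
    then show ?thesis using pos by (intro hardy_correlation_shift_aux[OF f]) (auto simp: c_def)
  next
    case False
    then show ?thesis using pos by (intro hardy_correlation_shift_aux[OF f, symmetric]) (auto simp: c_def)
  qed
  also have "\<dots> = complex_of_real (line_energy f c)"
    unfolding line_energy_def using sq_int_eq_integral(1)[OF hardy_L2[OF f, of "c / 2"]] pos
    by (simp add: c_def add_divide_distrib)
  finally show ?thesis by (simp add: c_def)
qed

lemma hardy_sq_int_diff: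
  assumes f: "hardy f" and pos: "\<xi> > 0" "\<eta> > 0"
  defines "d \<equiv> line_energy f (2 * \<xi>) + line_energy f (2 * \<eta>) - 2 * line_energy f (\<xi> + \<eta>)"
  shows "sq_int (\<lambda>\<omega>. f (Complex \<xi> \<omega>) - f (Complex \<eta> \<omega>)) = ennreal d" and "d \<ge> 0"
proof -
  let ?u = "\<lambda>\<omega>. f (Complex \<xi> \<omega>)" and ?v = "\<lambda>\<omega>. f (Complex \<eta> \<omega>)"
  have L: "?u \<in> L2" "?v \<in> L2" using hardy_L2[OF f] pos by auto
  note i = Cauchy_Schwarz_L2(1)
  have "complex_of_real (LBINT \<omega>. (cmod (?u \<omega> - ?v \<omega>))\<^sup>2) = (LBINT \<omega>. cnj (?u \<omega> - ?v \<omega>) * (?u \<omega> - ?v \<omega>))"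
    using sq_int_eq_integral(1)[OF L2_diff[OF L]] by simp
  also have "\<dots> = (LBINT \<omega>. (cnj (?u \<omega>) * ?u \<omega> + cnj (?v \<omega>) * ?v \<omega>) - (cnj (?u \<omega>) * ?v \<omega> + cnj (?v \<omega>) * ?u \<omega>))"
    by (simp add: algebra_simps)
  also have "\<dots> = ((LBINT \<omega>. cnj (?u \<omega>) * ?u \<omega>) + (LBINT \<omega>. cnj (?v \<omega>) * ?v \<omega>))
      - ((LBINT \<omega>. cnj (?u \<omega>) * ?v \<omega>) + (LBINT \<omega>. cnj (?v \<omega>) * ?u \<omega>))"
    by (simp only: Bochner_Integration.integral_add Bochner_Integration.integral_diff
        Bochner_Integration.integrable_add i L)
  also have "\<dots> = complex_of_real d"
    using pos by (simp add: hardy_correlation[OF f] d_def add.commute)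
  finally have eq: "(LBINT \<omega>. (cmod (?u \<omega> - ?v \<omega>))\<^sup>2) = d" using of_real_eq_iff by blast
  then show "sq_int (\<lambda>\<omega>. ?u \<omega> - ?v \<omega>) = ennreal d"
    using sq_int_eq_integral(2)[OF L2_diff[OF L]] by simp
  have "(LBINT \<omega>. (cmod (?u \<omega> - ?v \<omega>))\<^sup>2) \<ge> 0" by simp
  with eq show "d \<ge> 0" by simp
qed

text \<open>If \<open>h\<close> grew from a to b, midpoint convexity along the progression a, b, 2b
  - a, ... would make every later increment at least as large as the first, and \<open>h\<close>
  would exceed its bound.\<close>

lemma midpoint_convex_bounded_antimono:
  fixes h :: "real \<Rightarrow> real"
  assumes mid: "\<And>a b. a > 0 \<Longrightarrow> b > 0 \<Longrightarrow> 2 * h ((a + b) / 2) \<le> h a + h b"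
    and bd: "\<And>a. a > 0 \<Longrightarrow> h a \<le> M" and ab: "0 < a" "a \<le> b"
  shows "h b \<le> h a"
proof (rule ccontr)
  assume "\<not> ?thesis"
  define d where "d = b - a"
  define e where "e = h b - h a"
  have "e > 0" "d \<ge> 0" using \<open>\<not> _\<close> ab by (auto simp: e_def d_def)
  have step: "h (a + real (Suc n) * d) - h (a + real n * d) \<ge> e" for n
  proof (induction n)
    case 0
    then show ?case by (simp add: d_def e_def)
  next
    case (Suc n)
    have "((a + real n * d) + (a + real (Suc (Suc n)) * d)) / 2 = a + real (Suc n) * d"
      by (simp add: field_simps)
    moreover have "a + real k * d > 0" for k
      using ab \<open>d \<ge> 0\<close> by (simp add: add_pos_nonneg)
    ultimately have "2 * h (a + real (Suc n) * d) \<le> h (a + real n * d) + h (a + real (Suc (Suc n)) * d)"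
      using mid[of "a + real n * d" "a + real (Suc (Suc n)) * d"] by metis
    with Suc show ?case by linarith
  qed
  have ge: "h (a + real n * d) \<ge> h a + real n * e" for n
  proof (induction n)
    case (Suc n)
    then show ?case using step[of n] by (simp add: algebra_simps)
  qed simp
  obtain n :: nat where "real n * e > M - h a" using \<open>e > 0\<close> by (metis reals_Archimedean3)
  with ge[of n] bd[of "a + real n * d"] ab \<open>d \<ge> 0\<close> show False by (simp add: add_pos_nonneg)
qed

theorem hardy_boundary_value:
  assumes f: "hardy f"
  shows "\<exists>u\<in>L2. ((\<lambda>\<xi>. sq_int (\<lambda>\<omega>. f (Complex \<xi> \<omega>) - u \<omega>)) \<longlongrightarrow> 0) (at_right 0)"
proof -
  define h where "h = line_energy f"
  obtain M where M: "M \<ge> 0" "\<And>\<xi>. \<xi> > 0 \<Longrightarrow> sq_int (\<lambda>\<omega>. f (Complex \<xi> \<omega>)) \<le> ennreal M"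
    using hardy_bound[OF f] by blast
  have bd: "h t \<le> M" if "t > 0" for t
    using M(2)[of "t / 2"] sq_int_eq_integral(2)[OF hardy_L2[OF f, of "t / 2"]] that M(1)
    by (simp add: h_def line_energy_def ennreal_le_iff)
  have mid: "2 * h ((a + b) / 2) \<le> h a + h b" if "a > 0" "b > 0" for a b
    using hardy_sq_int_diff(2)[OF f, of "a / 2" "b / 2"] that by (simp add: h_def add_divide_distrib)
  have anti: "h b \<le> h a" if "0 < a" "a \<le> b" for a b
    using midpoint_convex_bounded_antimono[of h M a b, OF mid bd that] by blast
  \<comment> \<open>Being the supremum of a decreasing function, \<open>L\<close> is its limit at 0.
    The modulus for completeness is L - h(2t): for t' <= t one has h(2t') <= L, and t + t' <= 2t
    gives h(t + t') >= h(2t).\<close>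
  define L where "L = (SUP t\<in>{0<..}. h t)"
  have bdd: "bdd_above (h ` {0<..})" using bd by (auto intro!: bdd_aboveI2)
  have hL: "h t \<le> L" if "t > 0" for t
    unfolding L_def using bdd that by (intro cSUP_upper) auto
  have "((\<lambda>t. L - h (2 * t)) \<longlongrightarrow> 0) (at_right 0)"
  proof (rule tendstoI)
    fix e :: real assume "e > 0"
    then have "L - e < L" by simp
    then obtain t0 where t0: "t0 > 0" "L - e < h t0"
      using less_cSUP_iff[of "{0<..}" h "L - e"] bdd unfolding L_def by auto
    have "eventually (\<lambda>t. 0 < t \<and> t < t0 / 2) (at_right 0)"
      using t0(1) by (auto simp: eventually_at_right_field intro!: exI[of _ "t0 / 2"])
    then show "eventually (\<lambda>t. dist (L - h (2 * t)) 0 < e) (at_right 0)"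
    proof eventually_elim
      case (elim t)
      then show ?case using anti[of "2 * t" t0] hL[of "2 * t"] t0 by (simp add: dist_real_def)
    qed
  qed
  then show ?thesis
  proof (rule L2_complete_at_right_0[rotated 2])
    show "(\<lambda>\<omega>. f (Complex t \<omega>)) \<in> L2" if "t > 0" for t using hardy_L2[OF f that] .
    fix t t' :: real assume t: "0 < t'" "t' \<le> t"
    have "h (2 * t) + h (2 * t') - 2 * h (t + t') \<le> L - h (2 * t)"
      using anti[of "t + t'" "2 * t"] hL[of "2 * t'"] t by simp
    then show "sq_int (\<lambda>\<omega>. f (Complex t \<omega>) - f (Complex t' \<omega>)) \<le> ennreal (L - h (2 * t))"
      using hardy_sq_int_diff(1)[OF f, of t t'] t by (auto simp: h_def intro: ennreal_leI)
  qed
qed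

section \<open>Cauchy's integral formula on a vertical line\<close>

lemma resolvent_L2:
  assumes "Re s \<noteq> \<xi>"
  shows "(\<lambda>\<omega>. 1 / (s - Complex \<xi> \<omega>)) \<in> L2"
    and "sq_int (\<lambda>\<omega>. 1 / (s - Complex \<xi> \<omega>)) = ennreal (pi / \<bar>Re s - \<xi>\<bar>)"
proof -
  have ne: "s - Complex \<xi> \<omega> \<noteq> 0" for \<omega> using assms by (auto simp: complex_eq_iff)
  have "continuous_on UNIV (\<lambda>\<omega>. 1 / (s - Complex \<xi> \<omega>))"
    using ne unfolding Complex_eq by (intro continuous_intros) auto
  then have m: "(\<lambda>\<omega>. 1 / (s - Complex \<xi> \<omega>)) \<in> borel_measurable borel"
    by (rule borel_measurable_continuous_onI)
  have "(cmod (1 / (s - Complex \<xi> \<omega>)))\<^sup>2 = 1 / ((\<omega> - Im s)\<^sup>2 + \<bar>Re s - \<xi>\<bar>\<^sup>2)" for \<omega>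
    by (simp add: norm_divide power_divide cmod_power2 add.commute power2_commute)
  then have "sq_int (\<lambda>\<omega>. 1 / (s - Complex \<xi> \<omega>)) = (\<integral>\<^sup>+\<omega>. ennreal (1 / ((\<omega> - Im s)\<^sup>2 + \<bar>Re s - \<xi>\<bar>\<^sup>2)) \<partial>lborel)"
    unfolding sq_int_def by simp
  also have "\<dots> = ennreal (pi / \<bar>Re s - \<xi>\<bar>)"
    using has_bochner_integral_lorentzian[of "\<bar>Re s - \<xi>\<bar>" "Im s"] assms
    by (subst nn_integral_eq_integral) (auto simp: has_bochner_integral_iff)
  finally show "sq_int (\<lambda>\<omega>. 1 / (s - Complex \<xi> \<omega>)) = ennreal (pi / \<bar>Re s - \<xi>\<bar>)" .
  with m show "(\<lambda>\<omega>. 1 / (s - Complex \<xi> \<omega>)) \<in> L2" by (simp add: L2_def)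
qed

text \<open>The weight separates two effects in the Cauchy formula: a small \<open>t\<close> tames
  the squared norm of f, for which only a fixed bound is available as the line moves right, while
  the growing distance to the pole pays for 1/t.\<close>

lemma mult_le_weighted_squares:
  fixes a b t :: real
  assumes "t > 0"
  shows "a * b \<le> t * a\<^sup>2 + b\<^sup>2 / t"
proof -
  have "0 \<le> t * (a - b / (2 * t))\<^sup>2" using assms by simp
  also have "\<dots> = t * a\<^sup>2 - a * b + b\<^sup>2 / (4 * t)"
    using assms by (simp add: power2_eq_square field_simps)
  finally have "a * b \<le> t * a\<^sup>2 + b\<^sup>2 / (4 * t)" by simp
  also have "b\<^sup>2 / (4 * t) \<le> b\<^sup>2 / t" using assms by (intro divide_left_mono) auto
  finally show ?thesis by simp
qed

text \<open>Subtracting \<open>f s0 * (s0 + c) / (s + c)\<close> removes the pole of \<open>f s / (s0 - s)\<close> without spoiling the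
  decay at infinity. The remaining function has the same integral over all vertical lines to the
  right of \<open>\<xi>\<close>, and this integral tends to 0 as the line moves to the right. The choice of \<open>c\<close>
  turns the integral of the subtracted term over the line \<open>Re s = \<xi>\<close> into a Poisson integral.\<close>

theorem hardy_Cauchy_formula:
  fixes f :: "complex \<Rightarrow> complex"
  assumes f: "hardy f" and \<xi>: "0 < \<xi>" "\<xi> < Re s0"
  shows "(LBINT \<omega>. f (Complex \<xi> \<omega>) / (s0 - Complex \<xi> \<omega>)) = 2 * pi * f s0"
proof -
  \<comment> \<open>\<open>- c\<close> is the mirror image of \<open>s0\<close> in the line Re s =
    \<xi>. On that line \<open>s + c\<close> is the conjugate of \<open>s0 - s\<close>, so their
    product is a squared modulus, and the pole that the subtraction brings in lies to the left of
    the line.\<close>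
  define c where "c = cnj s0 - 2 * complex_of_real \<xi>"
  define A where "A = f s0 * (s0 + c)"
  define S where "S = {s. max 0 (2 * \<xi> - Re s0) < Re s}"
  define Q where "Q s = f s - A / (s + c)" for s
  \<comment> \<open>\<open>Q\<close> vanishes at \<open>s0\<close>, so this is Q s / (s0 - s) with
    its removable singularity filled in.\<close>
  define G where "G s = - (if s = s0 then deriv Q s0 else (Q s - Q s0) / (s - s0))" for s
  obtain M where M: "M \<ge> 0" "\<And>x. x > 0 \<Longrightarrow> sq_int (\<lambda>\<omega>. f (Complex x \<omega>)) \<le> ennreal M"
    using hardy_bound[OF f] by blast
  have S: "open S" "convex S"
    unfolding S_def by (rule open_halfspace_Re_gt, rule convex_halfspace_Re_gt)
  have sc: "s + c \<noteq> 0" if "s \<in> S" for s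
  proof
    assume "s + c = 0"
    then have "Re (s + c) = 0" by simp
    with that show False by (simp add: S_def c_def)
  qed
  have "Q holomorphic_on S" unfolding Q_def
    using sc hardy_holomorphic[OF f] by (intro holomorphic_intros) (auto elim: holomorphic_on_subset simp: S_def rhp_def)
  then have hol: "G holomorphic_on S"
    unfolding G_def by (intro holomorphic_on_minus pole_lemma_open S(1))
  have "s0 \<in> S" using \<xi> by (simp add: S_def)
  then have "Q s0 = 0" using sc[of s0] by (simp add: Q_def A_def)
  then have G: "G s = f s / (s0 - s) - A / ((s + c) * (s0 - s))" if "s \<in> S" "s \<noteq> s0" for s
    using that sc[of s] unfolding G_def Q_def by (simp add: divide_simps) (simp add: algebra_simps)
  \<comment> \<open>\<open>e\<close> bounds the squared distances to \<open>s0\<close> and to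
    \<open>- c\<close> from below at once, so a single Lorentzian in \<omega> can dominate both
    terms of \<open>G\<close>.\<close>
  have G_le: "cmod (G s) \<le> t * (cmod (f s))\<^sup>2 + (1 / t + cmod A) * (1 / e)"
    if "s \<in> S" "e > 0" "t > 0" "e \<le> (cmod (s0 - s))\<^sup>2" "e \<le> (cmod (s + c))\<^sup>2" for s e t
  proof -
    have ne: "s \<noteq> s0" using that by auto
    have "cmod (f s / (s0 - s)) \<le> t * (cmod (f s))\<^sup>2 + (cmod (1 / (s0 - s)))\<^sup>2 / t"
      using mult_le_weighted_squares[OF \<open>t > 0\<close>, of "cmod (f s)" "cmod (1 / (s0 - s))"]
      by (simp add: norm_divide)
    also have "(cmod (1 / (s0 - s)))\<^sup>2 / t \<le> (1 / e) / t"
      using that ne by (intro divide_right_mono) (auto simp: norm_divide power_divide intro!: divide_left_mono)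
    finally have 1: "cmod (f s / (s0 - s)) \<le> t * (cmod (f s))\<^sup>2 + (1 / t) * (1 / e)"
      by (simp add: mult.commute)
    have "sqrt e * sqrt e \<le> cmod (s + c) * cmod (s0 - s)"
      using that by (intro mult_mono real_le_lsqrt) auto
    then have "e \<le> cmod ((s + c) * (s0 - s))" using that by (simp add: norm_mult)
    then have "cmod (A / ((s + c) * (s0 - s))) \<le> cmod A / e"
      unfolding norm_divide using that by (intro divide_left_mono mult_pos_pos) auto
    moreover have "cmod (G s) \<le> cmod (f s / (s0 - s)) + cmod (A / ((s + c) * (s0 - s)))"
      unfolding G[OF \<open>s \<in> S\<close> ne] by (rule norm_triangle_ineq4)
    ultimately show ?thesis using 1 by (simp add: algebra_simps)
  qed
  have line: "Complex x \<omega> \<in> S" if "x \<ge> \<xi>" for x \<omega>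
    using that \<xi> by (simp add: S_def)
  have Im_le: "(\<omega> - Im s0)\<^sup>2 \<le> (cmod (s0 - Complex x \<omega>))\<^sup>2" "(\<omega> - Im s0)\<^sup>2 \<le> (cmod (Complex x \<omega> + c))\<^sup>2" for x \<omega>
    by (simp_all add: cmod_power2 c_def power2_commute[of \<omega>])
  have meas: "(\<lambda>\<omega>. f (Complex x \<omega>)) \<in> borel_measurable borel" if "x \<ge> \<xi>" for x
    using L2_measurable[OF hardy_L2[OF f, of x]] that \<xi> by simp
  have bound: "(\<integral>\<^sup>+\<omega>. ennreal (t * (cmod (f (Complex x \<omega>)))\<^sup>2 + B * (1 / ((\<omega> - Im s0)\<^sup>2 + a\<^sup>2))) \<partial>lborel)
      \<le> ennreal (t * M + B * (pi / a))" if "x \<ge> \<xi>" "t \<ge> 0" "B \<ge> 0" "a > 0" for x t B a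
  proof -
    note [measurable] = meas[OF that(1)]
    have "(\<integral>\<^sup>+\<omega>. ennreal (t * (cmod (f (Complex x \<omega>)))\<^sup>2 + B * (1 / ((\<omega> - Im s0)\<^sup>2 + a\<^sup>2))) \<partial>lborel)
        = ennreal t * sq_int (\<lambda>\<omega>. f (Complex x \<omega>)) + ennreal B * (\<integral>\<^sup>+\<omega>. ennreal (1 / ((\<omega> - Im s0)\<^sup>2 + a\<^sup>2)) \<partial>lborel)"
      unfolding sq_int_def using that
      by (simp add: ennreal_plus ennreal_mult nn_integral_add nn_integral_cmult del: times_divide_eq_right)
    also have "(\<integral>\<^sup>+\<omega>. ennreal (1 / ((\<omega> - Im s0)\<^sup>2 + a\<^sup>2)) \<partial>lborel) = ennreal (pi / a)"
      using has_bochner_integral_lorentzian[of a "Im s0"] that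
      by (subst nn_integral_eq_integral) (auto simp: has_bochner_integral_iff)
    also have "ennreal t * sq_int (\<lambda>\<omega>. f (Complex x \<omega>)) + ennreal B * ennreal (pi / a)
        \<le> ennreal t * ennreal M + ennreal B * ennreal (pi / a)"
      using that \<xi> by (intro add_mono mult_left_mono M) auto
    also have "\<dots> = ennreal (t * M + B * (pi / a))"
      using that M(1) by (simp add: ennreal_plus ennreal_mult del: times_divide_eq_right)
    finally show ?thesis .
  qed
  define J where "J x = (LBINT \<omega>. G (Complex x \<omega>))" for x
  have shift: "J \<xi> = J x" if "x \<ge> \<xi>" for x
    unfolding J_def
  \<comment> \<open>The excluded heights keep the points at distance at least 1 from
    \<open>s0\<close> and \<open>- c\<close>, uniformly in x, even on the line through
    \<open>s0\<close>. The factor 2 comes from 1/d <= 2/(d + 1) for d >= 1.\<close>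
  proof (rule vertical_integral_shift[OF S _ hol that])
    fix x assume x: "\<xi> \<le> x"
    have "(\<integral>\<^sup>+\<omega>. ennreal (cmod (G (Complex x \<omega>))) * indicator (- {- (\<bar>Im s0\<bar> + 1)..\<bar>Im s0\<bar> + 1}) \<omega> \<partial>lborel)
        \<le> (\<integral>\<^sup>+\<omega>. ennreal (1 * (cmod (f (Complex x \<omega>)))\<^sup>2 + (2 * (1 + cmod A)) * (1 / ((\<omega> - Im s0)\<^sup>2 + 1\<^sup>2))) \<partial>lborel)"
    proof (rule nn_integral_mono)
      fix \<omega>
      show "ennreal (cmod (G (Complex x \<omega>))) * indicator (- {- (\<bar>Im s0\<bar> + 1)..\<bar>Im s0\<bar> + 1}) \<omega>
          \<le> ennreal (1 * (cmod (f (Complex x \<omega>)))\<^sup>2 + (2 * (1 + cmod A)) * (1 / ((\<omega> - Im s0)\<^sup>2 + 1\<^sup>2)))"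
      proof (cases "\<omega> \<in> - {- (\<bar>Im s0\<bar> + 1)..\<bar>Im s0\<bar> + 1}")
        case True
        then have "\<bar>\<omega> - Im s0\<bar> \<ge> 1" by auto
        then have one: "(\<omega> - Im s0)\<^sup>2 \<ge> 1" by (metis abs_le_square_iff abs_one one_power2)
        have "cmod (G (Complex x \<omega>)) \<le> 1 * (cmod (f (Complex x \<omega>)))\<^sup>2 + (1 / 1 + cmod A) * (1 / (\<omega> - Im s0)\<^sup>2)"
          using one Im_le by (intro G_le line x) auto
        also have "(1 / 1 + cmod A) * (1 / (\<omega> - Im s0)\<^sup>2)
            \<le> (1 / 1 + cmod A) * (2 * (1 / ((\<omega> - Im s0)\<^sup>2 + 1\<^sup>2)))"
          using one by (intro mult_left_mono) (auto simp: divide_simps)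
        also have "\<dots> = (2 * (1 + cmod A)) * (1 / ((\<omega> - Im s0)\<^sup>2 + 1\<^sup>2))"
          by (simp add: algebra_simps)
        finally have "ennreal (cmod (G (Complex x \<omega>)))
            \<le> ennreal (1 * (cmod (f (Complex x \<omega>)))\<^sup>2 + (2 * (1 + cmod A)) * (1 / ((\<omega> - Im s0)\<^sup>2 + 1\<^sup>2)))"
          by (intro ennreal_leI) simp
        then show ?thesis using True by simp
      qed simp
    qed
    also have "\<dots> \<le> ennreal (1 * M + (2 * (1 + cmod A)) * (pi / 1))"
      using x by (intro bound) auto
    finally show "(\<integral>\<^sup>+\<omega>. ennreal (cmod (G (Complex x \<omega>))) * indicator (- {- (\<bar>Im s0\<bar> + 1)..\<bar>Im s0\<bar> + 1}) \<omega> \<partial>lborel)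
        \<le> ennreal (1 * M + (2 * (1 + cmod A)) * (pi / 1))" .
  qed (use line in auto)
  \<comment> \<open>The integral is evaluated on the line at distance \<open>Y\<close> to the right
    of \<open>s0\<close>. Letting \<open>Y\<close> grow with \<open>t\<close> fixed removes the
    terms in 1/t and A; only then does \<open>t\<close> go to 0.\<close>
  have J_le: "cmod (J \<xi>) \<le> t * M + (1 / t + cmod A) * (pi / Y)" if "t > 0" "Y > 0" for t Y
  proof -
    define x where "x = Re s0 + Y"
    have x: "x \<ge> \<xi>" using \<xi> that by (simp add: x_def)
    have "ennreal (cmod (J x)) \<le> (\<integral>\<^sup>+\<omega>. ennreal (cmod (G (Complex x \<omega>))) \<partial>lborel)"
    \<comment> \<open>A non-integrable function has integral 0 by convention, so the bound is
      trivial in that case.\<close>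
    proof (cases "integrable lborel (\<lambda>\<omega>. G (Complex x \<omega>))")
      case True
      then show ?thesis unfolding J_def by (rule integral_norm_bound_ennreal)
    qed (simp add: J_def not_integrable_integral_eq)
    also have "\<dots> \<le> (\<integral>\<^sup>+\<omega>. ennreal (t * (cmod (f (Complex x \<omega>)))\<^sup>2 + (1 / t + cmod A) * (1 / ((\<omega> - Im s0)\<^sup>2 + Y\<^sup>2))) \<partial>lborel)"
    proof (intro nn_integral_mono ennreal_leI G_le line x that)
      fix \<omega>
      show "0 < (\<omega> - Im s0)\<^sup>2 + Y\<^sup>2" using that by (simp add: add_nonneg_pos)
      show "(\<omega> - Im s0)\<^sup>2 + Y\<^sup>2 \<le> (cmod (s0 - Complex x \<omega>))\<^sup>2"
        by (simp add: cmod_power2 x_def power2_commute)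
      have "Y\<^sup>2 \<le> (x + (Re s0 - 2 * \<xi>))\<^sup>2"
        using \<xi> that by (intro power_mono) (auto simp: x_def)
      then show "(\<omega> - Im s0)\<^sup>2 + Y\<^sup>2 \<le> (cmod (Complex x \<omega> + c))\<^sup>2"
        by (simp add: cmod_power2 c_def)
    qed
    also have "\<dots> \<le> ennreal (t * M + (1 / t + cmod A) * (pi / Y))"
      using that x by (intro bound) auto
    finally show ?thesis
      unfolding shift[OF x] using that M(1) by (subst (asm) ennreal_le_iff) auto
  qed
  have J_le': "cmod (J \<xi>) \<le> t * M" if "t > 0" for t
  proof (rule tendsto_lowerbound)
    show "((\<lambda>Y. t * M + (1 / t + cmod A) * (pi / Y)) \<longlongrightarrow> t * M) at_top"
      by real_asymp
    show "eventually (\<lambda>Y. cmod (J \<xi>) \<le> t * M + (1 / t + cmod A) * (pi / Y)) at_top"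
      using eventually_gt_at_top[of 0] by eventually_elim (rule J_le[OF that])
  qed simp
  have "cmod (J \<xi>) \<le> 0"
  proof (rule tendsto_lowerbound)
    show "((\<lambda>t. t * M) \<longlongrightarrow> 0) (at_right 0)" by real_asymp
    show "eventually (\<lambda>t. cmod (J \<xi>) \<le> t * M) (at_right 0)"
      using eventually_at_right_less[of 0] by eventually_elim (rule J_le')
  qed simp
  then have "J \<xi> = 0" by simp
  have ne: "s0 - Complex \<xi> \<omega> \<noteq> 0" for \<omega> using \<xi> by (auto simp: complex_eq_iff)
  have "G (Complex \<xi> \<omega>) = f (Complex \<xi> \<omega>) / (s0 - Complex \<xi> \<omega>)
      - A * complex_of_real (1 / ((\<omega> - Im s0)\<^sup>2 + (Re s0 - \<xi>)\<^sup>2))" for \<omega>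
  proof -
    have "Complex \<xi> \<omega> + c = cnj (s0 - Complex \<xi> \<omega>)" by (simp add: c_def complex_eq_iff)
    then have "(Complex \<xi> \<omega> + c) * (s0 - Complex \<xi> \<omega>) = complex_of_real ((cmod (s0 - Complex \<xi> \<omega>))\<^sup>2)"
      by (metis complex_norm_square mult.commute)
    also have "(cmod (s0 - Complex \<xi> \<omega>))\<^sup>2 = (\<omega> - Im s0)\<^sup>2 + (Re s0 - \<xi>)\<^sup>2"
      by (simp add: cmod_power2 power2_commute[of \<omega>])
    finally show ?thesis
      using G[of "Complex \<xi> \<omega>"] line[of \<xi> \<omega>] ne[of \<omega>] by (simp add: divide_simps)
  qed
  moreover have "integrable lborel (\<lambda>\<omega>. f (Complex \<xi> \<omega>) / (s0 - Complex \<xi> \<omega>))"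
  proof -
    have "(\<lambda>\<omega>. 1 / (s0 - Complex \<xi> \<omega>)) \<in> L2" using \<xi> by (intro resolvent_L2) auto
    then have "(\<lambda>\<omega>. cnj (1 / (s0 - Complex \<xi> \<omega>))) \<in> L2" by (rule L2_cnj)
    from Cauchy_Schwarz_L2(1)[OF this hardy_L2[OF f \<xi>(1)]] show ?thesis by simp
  qed
  moreover have hb: "has_bochner_integral lborel (\<lambda>\<omega>. A * complex_of_real (1 / ((\<omega> - Im s0)\<^sup>2 + (Re s0 - \<xi>)\<^sup>2)))
      (A * complex_of_real (pi / (Re s0 - \<xi>)))"
    using \<xi> by (intro has_bochner_integral_mult_right has_bochner_integral_of_real has_bochner_integral_lorentzian) auto
  ultimately have "J \<xi> = (LBINT \<omega>. f (Complex \<xi> \<omega>) / (s0 - Complex \<xi> \<omega>)) - A * complex_of_real (pi / (Re s0 - \<xi>))"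
    unfolding J_def by (simp only: has_bochner_integral_iff Bochner_Integration.integral_diff)
  moreover have "A * complex_of_real (pi / (Re s0 - \<xi>)) = 2 * pi * f s0"
  proof -
    have "s0 + c = complex_of_real (2 * (Re s0 - \<xi>))" by (simp add: c_def complex_eq_iff)
    then have "A * complex_of_real (pi / (Re s0 - \<xi>)) = f s0 * complex_of_real (2 * (Re s0 - \<xi>) * (pi / (Re s0 - \<xi>)))"
      unfolding A_def by (simp only: of_real_mult mult.assoc)
    also have "2 * (Re s0 - \<xi>) * (pi / (Re s0 - \<xi>)) = 2 * pi" using \<xi> by (simp add: field_simps)
    finally show ?thesis by simp
  qed
  ultimately show ?thesis using \<open>J \<xi> = 0\<close> by simp
qed

section \<open>Matrix-valued functions and their boundary values\<close>

lemma sq_int_mono: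
  assumes "\<And>x. cmod (u x) \<le> K * cmod (v x)" "K \<ge> 0" and [measurable]: "v \<in> borel_measurable borel"
  shows "sq_int u \<le> ennreal (K\<^sup>2) * sq_int v"
proof -
  have "sq_int u \<le> (\<integral>\<^sup>+x. ennreal (K\<^sup>2) * ennreal ((cmod (v x))\<^sup>2) \<partial>lborel)"
    unfolding sq_int_def
  proof (rule nn_integral_mono)
    fix x
    have "(cmod (u x))\<^sup>2 \<le> (K * cmod (v x))\<^sup>2" using assms by (intro power_mono) auto
    then show "ennreal ((cmod (u x))\<^sup>2) \<le> ennreal (K\<^sup>2) * ennreal ((cmod (v x))\<^sup>2)"
      by (simp add: power_mult_distrib flip: ennreal_mult)
  qed
  also have "\<dots> = ennreal (K\<^sup>2) * sq_int v"
    unfolding sq_int_def by (rule nn_integral_cmult) measurable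
  finally show ?thesis .
qed

lemma hardyI:
  assumes "f holomorphic_on rhp" "\<And>\<xi>. \<xi> > 0 \<Longrightarrow> sq_int (\<lambda>\<omega>. f (Complex \<xi> \<omega>)) \<le> ennreal M"
  shows "hardy f"
  using assms unfolding hardy_def by blast

lemma Complex_in_rhp [simp]: "Complex \<xi> \<omega> \<in> rhp \<longleftrightarrow> \<xi> > 0"
  by (simp add: rhp_def)

lemma hardy_cong:
  assumes "hardy f" "\<And>s. s \<in> rhp \<Longrightarrow> f s = g s"
  shows "hardy g"
proof -
  obtain M where M: "\<And>\<xi>. \<xi> > 0 \<Longrightarrow> sq_int (\<lambda>\<omega>. f (Complex \<xi> \<omega>)) \<le> ennreal M"
    using hardy_bound[OF assms(1)] by blast
  have "g holomorphic_on rhp"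
    using hardy_holomorphic[OF assms(1)] assms(2) by (rule holomorphic_transform)
  moreover have "sq_int (\<lambda>\<omega>. g (Complex \<xi> \<omega>)) \<le> ennreal M" if "\<xi> > 0" for \<xi>
    using M[OF that] assms(2) that by simp
  ultimately show ?thesis by (rule hardyI)
qed

lemma hardy_dominated:
  assumes "hardy g" "f holomorphic_on rhp" "\<And>s. s \<in> rhp \<Longrightarrow> cmod (f s) \<le> K * cmod (g s)"
  shows "hardy f"
proof -
  obtain M where M: "M \<ge> 0" "\<And>\<xi>. \<xi> > 0 \<Longrightarrow> sq_int (\<lambda>\<omega>. g (Complex \<xi> \<omega>)) \<le> ennreal M"
    using hardy_bound[OF assms(1)] by blast
  show ?thesis
  proof (rule hardyI[OF assms(2)])
    fix \<xi> :: real assume \<xi>: "\<xi> > 0"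
    have "sq_int (\<lambda>\<omega>. f (Complex \<xi> \<omega>)) \<le> ennreal (\<bar>K\<bar>\<^sup>2) * sq_int (\<lambda>\<omega>. g (Complex \<xi> \<omega>))"
    proof (rule sq_int_mono)
      show "(\<lambda>\<omega>. g (Complex \<xi> \<omega>)) \<in> borel_measurable borel"
        using hardy_L2[OF assms(1) \<xi>] by (rule L2_measurable)
      fix \<omega>
      have "cmod (f (Complex \<xi> \<omega>)) \<le> K * cmod (g (Complex \<xi> \<omega>))" using assms(3) \<xi> by simp
      also have "\<dots> \<le> \<bar>K\<bar> * cmod (g (Complex \<xi> \<omega>))" by (intro mult_right_mono) auto
      finally show "cmod (f (Complex \<xi> \<omega>)) \<le> \<bar>K\<bar> * cmod (g (Complex \<xi> \<omega>))" .
    qed simp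
    also have "\<dots> \<le> ennreal (\<bar>K\<bar>\<^sup>2) * ennreal M" by (intro mult_left_mono M \<xi>) simp
    finally show "sq_int (\<lambda>\<omega>. f (Complex \<xi> \<omega>)) \<le> ennreal (\<bar>K\<bar>\<^sup>2 * M)"
      using M(1) by (simp add: ennreal_mult)
  qed
qed

lemma hardy_cmult: "hardy f \<Longrightarrow> hardy (\<lambda>s. c * f s)"
  by (rule hardy_dominated[where g = f and K = "cmod c"])
     (simp_all add: norm_mult hardy_holomorphic holomorphic_on_mult)

lemma hardy_add:
  assumes "hardy f" "hardy g"
  shows "hardy (\<lambda>s. f s + g s)"
proof -
  obtain M where M: "M \<ge> 0" "\<And>\<xi>. \<xi> > 0 \<Longrightarrow> sq_int (\<lambda>\<omega>. f (Complex \<xi> \<omega>)) \<le> ennreal M"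
    using hardy_bound[OF assms(1)] by blast
  obtain N where N: "N \<ge> 0" "\<And>\<xi>. \<xi> > 0 \<Longrightarrow> sq_int (\<lambda>\<omega>. g (Complex \<xi> \<omega>)) \<le> ennreal N"
    using hardy_bound[OF assms(2)] by blast
  show ?thesis
  proof (rule hardyI)
    show "(\<lambda>s. f s + g s) holomorphic_on rhp"
      using assms by (intro holomorphic_intros hardy_holomorphic)
    fix \<xi> :: real assume \<xi>: "\<xi> > 0"
    have "sq_int (\<lambda>\<omega>. f (Complex \<xi> \<omega>) + g (Complex \<xi> \<omega>))
        \<le> 2 * sq_int (\<lambda>\<omega>. f (Complex \<xi> \<omega>)) + 2 * sq_int (\<lambda>\<omega>. g (Complex \<xi> \<omega>))"
      using assms \<xi> by (intro sq_int_add_le L2_measurable hardy_L2)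
    also have "\<dots> \<le> 2 * ennreal M + 2 * ennreal N"
      by (intro add_mono mult_left_mono M N \<xi>) auto
    also have "\<dots> = ennreal (2 * M + 2 * N)" using M N by (simp add: ennreal_mult)
    finally show "sq_int (\<lambda>\<omega>. f (Complex \<xi> \<omega>) + g (Complex \<xi> \<omega>)) \<le> ennreal (2 * M + 2 * N)" .
  qed
qed

lemma hardy_diff: "hardy f \<Longrightarrow> hardy g \<Longrightarrow> hardy (\<lambda>s. f s - g s)"
  using hardy_add[of f "\<lambda>s. (-1) * g s"] hardy_cmult[of g "-1"] by simp

text \<open>The bound is independent of \<xi>, since each line Re s = \<xi> > 0 is farther from
  \<open>l\<close> than the imaginary axis is. Norm estimates for functions with a pole at
  \<open>l\<close> are reduced to it.\<close>

lemma hardy_resolvent: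
  assumes "Re l < 0"
  shows "hardy (\<lambda>s. 1 / (s - l))"
    and "\<xi> > 0 \<Longrightarrow> sq_int (\<lambda>\<omega>. 1 / (Complex \<xi> \<omega> - l)) \<le> ennreal (pi / (- Re l))"
proof -
  have *: "sq_int (\<lambda>\<omega>. 1 / (Complex \<xi> \<omega> - l)) \<le> ennreal (pi / (- Re l))" if "\<xi> > 0" for \<xi>
  proof -
    have "sq_int (\<lambda>\<omega>. 1 / (Complex \<xi> \<omega> - l)) = sq_int (\<lambda>\<omega>. 1 / (l - Complex \<xi> \<omega>))"
      unfolding sq_int_def by (simp add: norm_divide norm_minus_commute)
    also have "\<dots> = ennreal (pi / \<bar>Re l - \<xi>\<bar>)"
      using assms that by (intro resolvent_L2) auto
    also have "\<dots> \<le> ennreal (pi / (- Re l))"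
      using assms that by (intro ennreal_leI divide_left_mono mult_pos_pos) auto
    finally show ?thesis .
  qed
  then show "\<xi> > 0 \<Longrightarrow> sq_int (\<lambda>\<omega>. 1 / (Complex \<xi> \<omega> - l)) \<le> ennreal (pi / (- Re l))" .
  have "(\<lambda>s. 1 / (s - l)) holomorphic_on rhp"
    using assms by (intro holomorphic_intros) (auto simp: rhp_def)
  then show "hardy (\<lambda>s. 1 / (s - l))" using * by (rule hardyI)
qed

section \<open>From scalar entries to matrix-valued functions\<close>

lemma nn_integral_frob_sq:
  assumes "\<And>\<omega>. X \<omega> \<in> carrier_mat p m"
    and [measurable]: "\<And>i j. i < p \<Longrightarrow> j < m \<Longrightarrow> (\<lambda>\<omega>. X \<omega> $$ (i, j)) \<in> borel_measurable borel"
  shows "(\<integral>\<^sup>+\<omega>. ennreal (frob_sq (X \<omega>)) \<partial>lborel) = (\<Sum>i<p. \<Sum>j<m. sq_int (\<lambda>\<omega>. X \<omega> $$ (i, j)))"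
proof -
  have "frob_sq (X \<omega>) = (\<Sum>i<p. \<Sum>j<m. (cmod (X \<omega> $$ (i, j)))\<^sup>2)" for \<omega>
    using assms(1)[of \<omega>] by (auto simp: frob_sq_def)
  then have "(\<integral>\<^sup>+\<omega>. ennreal (frob_sq (X \<omega>)) \<partial>lborel)
      = (\<integral>\<^sup>+\<omega>. (\<Sum>i<p. \<Sum>j<m. ennreal ((cmod (X \<omega> $$ (i, j)))\<^sup>2)) \<partial>lborel)"
    by (simp add: sum_ennreal sum_nonneg)
  also have "\<dots> = (\<Sum>i<p. \<integral>\<^sup>+\<omega>. (\<Sum>j<m. ennreal ((cmod (X \<omega> $$ (i, j)))\<^sup>2)) \<partial>lborel)"
    by (rule nn_integral_sum) measurable
  also have "\<dots> = (\<Sum>i<p. \<Sum>j<m. sq_int (\<lambda>\<omega>. X \<omega> $$ (i, j)))"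
    unfolding sq_int_def by (intro sum.cong refl nn_integral_sum) measurable
  finally show ?thesis .
qed

lemma H2_carrier: "F \<in> H2 p m \<Longrightarrow> F s \<in> carrier_mat p m"
  by (simp add: H2_def)

lemma H2_outside: "F \<in> H2 p m \<Longrightarrow> s \<notin> rhp \<Longrightarrow> F s = 0\<^sub>m p m"
  by (simp add: H2_def)

lemma H2_entry_hardy:
  assumes F: "F \<in> H2 p m" and ij: "i < p" "j < m"
  shows "hardy (\<lambda>s. F s $$ (i, j))"
proof (rule hardyI)
  show "(\<lambda>s. F s $$ (i, j)) holomorphic_on rhp" using assms by (simp add: H2_def)
  define B where "B = (SUP \<xi>\<in>{0<..}. \<integral>\<^sup>+\<omega>. ennreal (frob_sq (F (Complex \<xi> \<omega>))) \<partial>lborel)"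
  have "B < \<infinity>" using F by (simp add: H2_def B_def)
  fix \<xi> :: real assume \<xi>: "\<xi> > 0"
  have "sq_int (\<lambda>\<omega>. F (Complex \<xi> \<omega>) $$ (i, j)) \<le> (\<integral>\<^sup>+\<omega>. ennreal (frob_sq (F (Complex \<xi> \<omega>))) \<partial>lborel)"
    unfolding sq_int_def
  proof (intro nn_integral_mono ennreal_leI)
    fix \<omega>
    have "frob_sq (F (Complex \<xi> \<omega>)) = (\<Sum>i<p. \<Sum>j<m. (cmod (F (Complex \<xi> \<omega>) $$ (i, j)))\<^sup>2)"
      using H2_carrier[OF F, of "Complex \<xi> \<omega>"] by (auto simp: frob_sq_def)
    moreover have "(\<Sum>j<m. (cmod (F (Complex \<xi> \<omega>) $$ (i, j)))\<^sup>2) \<ge> (cmod (F (Complex \<xi> \<omega>) $$ (i, j)))\<^sup>2"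
      using ij by (intro member_le_sum) auto
    moreover have "(\<Sum>i<p. \<Sum>j<m. (cmod (F (Complex \<xi> \<omega>) $$ (i, j)))\<^sup>2) \<ge> (\<Sum>j<m. (cmod (F (Complex \<xi> \<omega>) $$ (i, j)))\<^sup>2)"
      using ij by (intro member_le_sum[of i _ "\<lambda>i. \<Sum>j<m. (cmod (F (Complex \<xi> \<omega>) $$ (i, j)))\<^sup>2"]) (auto intro: sum_nonneg)
    ultimately show "(cmod (F (Complex \<xi> \<omega>) $$ (i, j)))\<^sup>2 \<le> frob_sq (F (Complex \<xi> \<omega>))" by linarith
  qed
  also have "\<dots> \<le> B" unfolding B_def using \<xi> by (intro SUP_upper) auto
  also have "\<dots> = ennreal (enn2real B)" using \<open>B < \<infinity>\<close> by (simp add: less_top)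
  finally show "sq_int (\<lambda>\<omega>. F (Complex \<xi> \<omega>) $$ (i, j)) \<le> ennreal (enn2real B)" .
qed

lemma H2I:
  assumes "\<And>s. F s \<in> carrier_mat p m" "\<And>s. s \<notin> rhp \<Longrightarrow> F s = 0\<^sub>m p m"
    and h: "\<And>i j. i < p \<Longrightarrow> j < m \<Longrightarrow> hardy (\<lambda>s. F s $$ (i, j))"
  shows "F \<in> H2 p m"
proof -
  have "\<exists>M. \<forall>i j. i < p \<longrightarrow> j < m \<longrightarrow> (\<forall>\<xi>>0. sq_int (\<lambda>\<omega>. F (Complex \<xi> \<omega>) $$ (i, j)) \<le> ennreal (M i j))"
  proof -
    have "\<forall>i j. \<exists>M. i < p \<longrightarrow> j < m \<longrightarrow> (\<forall>\<xi>>0. sq_int (\<lambda>\<omega>. F (Complex \<xi> \<omega>) $$ (i, j)) \<le> ennreal M)"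
      using h by (auto simp: hardy_def)
    then show ?thesis by metis
  qed
  then obtain M where M: "\<And>i j \<xi>. i < p \<Longrightarrow> j < m \<Longrightarrow> \<xi> > 0 \<Longrightarrow>
      sq_int (\<lambda>\<omega>. F (Complex \<xi> \<omega>) $$ (i, j)) \<le> ennreal (M i j)" by blast
  have "(SUP \<xi>\<in>{0<..}. \<integral>\<^sup>+\<omega>. ennreal (frob_sq (F (Complex \<xi> \<omega>))) \<partial>lborel)
      \<le> (\<Sum>i<p. \<Sum>j<m. ennreal (M i j))"
  proof (rule SUP_least)
    fix \<xi> :: real assume "\<xi> \<in> {0<..}"
    then have \<xi>: "\<xi> > 0" by simp
    have "(\<integral>\<^sup>+\<omega>. ennreal (frob_sq (F (Complex \<xi> \<omega>))) \<partial>lborel) = (\<Sum>i<p. \<Sum>j<m. sq_int (\<lambda>\<omega>. F (Complex \<xi> \<omega>) $$ (i, j)))"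
      using assms(1) L2_measurable[OF hardy_L2[OF h \<xi>]] by (intro nn_integral_frob_sq) auto
    also have "\<dots> \<le> (\<Sum>i<p. \<Sum>j<m. ennreal (M i j))"
      using M \<xi> by (intro sum_mono) auto
    finally show "(\<integral>\<^sup>+\<omega>. ennreal (frob_sq (F (Complex \<xi> \<omega>))) \<partial>lborel) \<le> (\<Sum>i<p. \<Sum>j<m. ennreal (M i j))" .
  qed
  also have "\<dots> < \<infinity>" by simp
  finally show ?thesis using assms hardy_holomorphic[OF h] by (simp add: H2_def)
qed

lemma H2_add:
  assumes "F \<in> H2 p m" "G \<in> H2 p m"
  shows "F + G \<in> H2 p m"
proof (rule H2I)
  note c = H2_carrier[OF assms(1)] H2_carrier[OF assms(2)]
  show "(F + G) s \<in> carrier_mat p m" for s using c by simp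
  show "(F + G) s = 0\<^sub>m p m" if "s \<notin> rhp" for s
    using assms[THEN H2_outside, OF that] by simp
  fix i j assume ij: "i < p" "j < m"
  have "(F + G) s $$ (i, j) = F s $$ (i, j) + G s $$ (i, j)" for s
    using c[of s] ij by simp
  then show "hardy (\<lambda>s. (F + G) s $$ (i, j))"
    using hardy_add[OF assms[THEN H2_entry_hardy, OF ij]] by simp
qed

lemma H2_scale:
  assumes "F \<in> H2 p m"
  shows "h2_scale c F \<in> H2 p m"
proof (rule H2I)
  note c = H2_carrier[OF assms]
  show "h2_scale c F s \<in> carrier_mat p m" for s using c by (simp add: h2_scale_def)
  show "h2_scale c F s = 0\<^sub>m p m" if "s \<notin> rhp" for s
    using assms[THEN H2_outside, OF that] by (simp add: h2_scale_def)
  fix i j assume ij: "i < p" "j < m"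
  have "h2_scale c F s $$ (i, j) = c * F s $$ (i, j)" for s
    using c[of s] ij by (simp add: h2_scale_def)
  then show "hardy (\<lambda>s. h2_scale c F s $$ (i, j))"
    using hardy_cmult[OF assms[THEN H2_entry_hardy, OF ij]] by simp
qed

lemma H2_diff_eq:
  assumes "F \<in> H2 p m" "G \<in> H2 p m"
  shows "F - G = F + h2_scale (-1) G"
proof
  fix s
  show "(F - G) s = (F + h2_scale (-1) G) s"
    using H2_carrier[OF assms(1), of s] H2_carrier[OF assms(2), of s]
    by (intro eq_matI) (auto simp: h2_scale_def)
qed

lemma H2_diff: "F \<in> H2 p m \<Longrightarrow> G \<in> H2 p m \<Longrightarrow> F - G \<in> H2 p m"
  by (simp add: H2_diff_eq H2_add H2_scale)

text \<open>The choice in \<open>h2_boundary\<close> means something only once a witness exists: the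
  scalar boundary values of the entries, assembled into a matrix. The squared Frobenius norm is a
  sum over entries, so their limits add up.\<close>

lemma h2_boundary_spec:
  assumes F: "F \<in> H2 p m"
  shows "h2_boundary p m F \<omega> \<in> carrier_mat p m"
    and "i < p \<Longrightarrow> j < m \<Longrightarrow> (\<lambda>\<omega>. h2_boundary p m F \<omega> $$ (i, j)) \<in> borel_measurable borel"
    and "((\<lambda>\<xi>. \<integral>\<^sup>+\<omega>. ennreal (frob_sq (F (Complex \<xi> \<omega>) - h2_boundary p m F \<omega>)) \<partial>lborel) \<longlongrightarrow> 0) (at_right 0)"
proof -
  let ?P = "\<lambda>g. (\<forall>\<omega>. g \<omega> \<in> carrier_mat p m) \<and>
     (\<forall>i<p. \<forall>j<m. (\<lambda>\<omega>. g \<omega> $$ (i, j)) \<in> borel_measurable borel) \<and>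
     ((\<lambda>\<xi>. \<integral>\<^sup>+\<omega>. ennreal (frob_sq (F (Complex \<xi> \<omega>) - g \<omega>)) \<partial>lborel) \<longlongrightarrow> 0) (at_right 0)"
  let ?Q = "\<lambda>i j u. u \<in> L2 \<and> ((\<lambda>\<xi>. sq_int (\<lambda>\<omega>. F (Complex \<xi> \<omega>) $$ (i, j) - u \<omega>)) \<longlongrightarrow> 0) (at_right 0)"
  define u where "u i j = (SOME u. ?Q i j u)" for i j
  have u: "u i j \<in> L2" "((\<lambda>\<xi>. sq_int (\<lambda>\<omega>. F (Complex \<xi> \<omega>) $$ (i, j) - u i j \<omega>)) \<longlongrightarrow> 0) (at_right 0)"
    if "i < p" "j < m" for i j
    using someI_ex[of "?Q i j"] hardy_boundary_value[OF H2_entry_hardy[OF F that]] unfolding u_def by blast+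
  define g where "g \<omega> = mat p m (\<lambda>(i, j). u i j \<omega>)" for \<omega>
  have "((\<lambda>\<xi>. \<integral>\<^sup>+\<omega>. ennreal (frob_sq (F (Complex \<xi> \<omega>) - g \<omega>)) \<partial>lborel) \<longlongrightarrow> 0) (at_right 0)"
  proof (rule Lim_transform_eventually)
    show "((\<lambda>\<xi>. \<Sum>i<p. \<Sum>j<m. sq_int (\<lambda>\<omega>. F (Complex \<xi> \<omega>) $$ (i, j) - u i j \<omega>)) \<longlongrightarrow> 0) (at_right 0)"
    proof -
      have "((\<lambda>\<xi>. \<Sum>i<p. \<Sum>j<m. sq_int (\<lambda>\<omega>. F (Complex \<xi> \<omega>) $$ (i, j) - u i j \<omega>)) \<longlongrightarrow> (\<Sum>i<p. \<Sum>j<m. 0)) (at_right 0)"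
        by (intro tendsto_sum u(2)) auto
      then show ?thesis by simp
    qed
    show "eventually (\<lambda>\<xi>. (\<Sum>i<p. \<Sum>j<m. sq_int (\<lambda>\<omega>. F (Complex \<xi> \<omega>) $$ (i, j) - u i j \<omega>))
        = (\<integral>\<^sup>+\<omega>. ennreal (frob_sq (F (Complex \<xi> \<omega>) - g \<omega>)) \<partial>lborel)) (at_right 0)"
      using eventually_at_right_less[of 0]
    proof eventually_elim
      case (elim \<xi>)
      have e: "(F (Complex \<xi> \<omega>) - g \<omega>) $$ (i, j) = F (Complex \<xi> \<omega>) $$ (i, j) - u i j \<omega>"
        if "i < p" "j < m" for i j \<omega>
        using that by (simp add: g_def)
      have "(\<integral>\<^sup>+\<omega>. ennreal (frob_sq (F (Complex \<xi> \<omega>) - g \<omega>)) \<partial>lborel)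
          = (\<Sum>i<p. \<Sum>j<m. sq_int (\<lambda>\<omega>. (F (Complex \<xi> \<omega>) - g \<omega>) $$ (i, j)))"
      proof (rule nn_integral_frob_sq)
        show "F (Complex \<xi> \<omega>) - g \<omega> \<in> carrier_mat p m" for \<omega> by (simp add: g_def minus_carrier_mat)
        show "(\<lambda>\<omega>. (F (Complex \<xi> \<omega>) - g \<omega>) $$ (i, j)) \<in> borel_measurable borel" if "i < p" "j < m" for i j
          unfolding e[OF that] using u(1)[OF that] hardy_L2[OF H2_entry_hardy[OF F that] elim]
          by (intro borel_measurable_diff L2_measurable)
      qed
      then show ?case by (simp add: e)
    qed
  qed
  moreover have "(\<lambda>\<omega>. g \<omega> $$ (i, j)) \<in> borel_measurable borel" if "i < p" "j < m" for i j
    using L2_measurable[OF u(1)[OF that]] that by (simp add: g_def)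
  moreover have "g \<omega> \<in> carrier_mat p m" for \<omega> by (simp add: g_def)
  ultimately have "?P g" by blast
  then have "?P (h2_boundary p m F)" unfolding h2_boundary_def by (rule someI[of ?P])
  then show "h2_boundary p m F \<omega> \<in> carrier_mat p m"
    "i < p \<Longrightarrow> j < m \<Longrightarrow> (\<lambda>\<omega>. h2_boundary p m F \<omega> $$ (i, j)) \<in> borel_measurable borel"
    "((\<lambda>\<xi>. \<integral>\<^sup>+\<omega>. ennreal (frob_sq (F (Complex \<xi> \<omega>) - h2_boundary p m F \<omega>)) \<partial>lborel) \<longlongrightarrow> 0) (at_right 0)"
    by blast+
qed

lemma h2_boundary_entry:
  assumes F: "F \<in> H2 p m" and ij: "i < p" "j < m"
  shows "((\<lambda>\<xi>. sq_int (\<lambda>\<omega>. F (Complex \<xi> \<omega>) $$ (i, j) - h2_boundary p m F \<omega> $$ (i, j))) \<longlongrightarrow> 0) (at_right 0)"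
    and "(\<lambda>\<omega>. h2_boundary p m F \<omega> $$ (i, j)) \<in> L2"
proof -
  let ?g = "h2_boundary p m F"
  note b = h2_boundary_spec[OF F]
  have dim: "dim_row (?g \<omega>) = p" "dim_col (?g \<omega>) = m" for \<omega> using b(1)[of \<omega>] by auto
  have le: "sq_int (\<lambda>\<omega>. F (Complex \<xi> \<omega>) $$ (i, j) - ?g \<omega> $$ (i, j))
      \<le> (\<integral>\<^sup>+\<omega>. ennreal (frob_sq (F (Complex \<xi> \<omega>) - ?g \<omega>)) \<partial>lborel)" if "\<xi> > 0" for \<xi>
  proof -
    have e: "(F (Complex \<xi> \<omega>) - ?g \<omega>) $$ (k, l) = F (Complex \<xi> \<omega>) $$ (k, l) - ?g \<omega> $$ (k, l)"
      if "k < p" "l < m" for k l \<omega>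
      using that by (simp add: dim)
    have fr: "(\<integral>\<^sup>+\<omega>. ennreal (frob_sq (F (Complex \<xi> \<omega>) - ?g \<omega>)) \<partial>lborel)
        = (\<Sum>i<p. \<Sum>j<m. sq_int (\<lambda>\<omega>. (F (Complex \<xi> \<omega>) - ?g \<omega>) $$ (i, j)))"
    proof (rule nn_integral_frob_sq)
      show "F (Complex \<xi> \<omega>) - ?g \<omega> \<in> carrier_mat p m" for \<omega> by (simp add: b(1) minus_carrier_mat)
      show "(\<lambda>\<omega>. (F (Complex \<xi> \<omega>) - ?g \<omega>) $$ (k, l)) \<in> borel_measurable borel" if "k < p" "l < m" for k l
        unfolding e[OF that] using that \<open>\<xi> > 0\<close>
        by (intro borel_measurable_diff b(2) L2_measurable[OF hardy_L2[OF H2_entry_hardy[OF F]]])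
    qed
    have row: "(\<Sum>j<m. sq_int (\<lambda>\<omega>. (F (Complex \<xi> \<omega>) - ?g \<omega>) $$ (i, j)))
        \<le> (\<Sum>i<p. \<Sum>j<m. sq_int (\<lambda>\<omega>. (F (Complex \<xi> \<omega>) - ?g \<omega>) $$ (i, j)))"
      using ij by (intro member_le_sum[of i _ "\<lambda>i. \<Sum>j<m. sq_int (\<lambda>\<omega>. (F (Complex \<xi> \<omega>) - ?g \<omega>) $$ (i, j))"]) auto
    have "sq_int (\<lambda>\<omega>. (F (Complex \<xi> \<omega>) - ?g \<omega>) $$ (i, j))
        \<le> (\<Sum>j<m. sq_int (\<lambda>\<omega>. (F (Complex \<xi> \<omega>) - ?g \<omega>) $$ (i, j)))"
      using ij by (intro member_le_sum) auto
    then have "sq_int (\<lambda>\<omega>. (F (Complex \<xi> \<omega>) - ?g \<omega>) $$ (i, j))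
        \<le> (\<integral>\<^sup>+\<omega>. ennreal (frob_sq (F (Complex \<xi> \<omega>) - ?g \<omega>)) \<partial>lborel)"
      unfolding fr using row by (rule order_trans)
    then show ?thesis using ij by (simp add: e)
  qed
  show lim: "((\<lambda>\<xi>. sq_int (\<lambda>\<omega>. F (Complex \<xi> \<omega>) $$ (i, j) - ?g \<omega> $$ (i, j))) \<longlongrightarrow> 0) (at_right 0)"
  proof (rule tendsto_sandwich[OF _ _ tendsto_const b(3)])
    show "eventually (\<lambda>\<xi>. sq_int (\<lambda>\<omega>. F (Complex \<xi> \<omega>) $$ (i, j) - ?g \<omega> $$ (i, j))
      \<le> (\<integral>\<^sup>+\<omega>. ennreal (frob_sq (F (Complex \<xi> \<omega>) - ?g \<omega>)) \<partial>lborel)) (at_right 0)"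
      using eventually_at_right_less[of 0] by eventually_elim (rule le)
  qed simp
  \<comment> \<open>A single line at finite distance suffices: the boundary entry is then a
    difference of two \<open>L2\<close> functions.\<close>
  have "eventually (\<lambda>\<xi>. sq_int (\<lambda>\<omega>. F (Complex \<xi> \<omega>) $$ (i, j) - ?g \<omega> $$ (i, j)) < 1 \<and> \<xi> > 0) (at_right 0)"
    using order_tendstoD(2)[OF lim, of 1] eventually_at_right_less[of 0] by (intro eventually_conj) auto
  then obtain \<xi> where \<xi>: "sq_int (\<lambda>\<omega>. F (Complex \<xi> \<omega>) $$ (i, j) - ?g \<omega> $$ (i, j)) < 1" "\<xi> > 0"
    using eventually_happens'[of "at_right (0::real)"] by force
  note L = hardy_L2[OF H2_entry_hardy[OF F ij] \<xi>(2)]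
  have "(\<lambda>\<omega>. F (Complex \<xi> \<omega>) $$ (i, j) - ?g \<omega> $$ (i, j)) \<in> L2"
    using \<xi>(1) b(2)[OF ij] L2_measurable[OF L] by (auto simp: L2_def elim: less_trans)
  from L2_diff[OF L this] show "(\<lambda>\<omega>. ?g \<omega> $$ (i, j)) \<in> L2" by simp
qed

lemma mat_tr_adjoint_mult:
  assumes "X \<in> carrier_mat p m" "Y \<in> carrier_mat p m"
  shows "mat_tr (mat_adjoint X * Y) = (\<Sum>i<p. \<Sum>j<m. cnj (X $$ (i, j)) * Y $$ (i, j))"
proof -
  have "mat_tr (mat_adjoint X * Y) = (\<Sum>j<m. \<Sum>i<p. cnj (X $$ (i, j)) * Y $$ (i, j))"
    using assms
    by (auto simp: mat_tr_def mat_adjoint_def times_mat_def scalar_prod_def mat_of_rows_def lessThan_atLeast0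
        intro!: sum.cong)
  then show ?thesis by (subst sum.swap)
qed

definition line_inner :: "nat \<Rightarrow> nat \<Rightarrow> real \<Rightarrow> (complex \<Rightarrow> complex mat) \<Rightarrow> (complex \<Rightarrow> complex mat) \<Rightarrow> complex" where
  "line_inner p m \<xi> F G = complex_of_real (1 / (2 * pi)) *
     (\<Sum>i<p. \<Sum>j<m. LBINT \<omega>. cnj (F (Complex \<xi> \<omega>) $$ (i, j)) * G (Complex \<xi> \<omega>) $$ (i, j))"

theorem tendsto_line_inner:
  assumes F: "F \<in> H2 p m" and G: "G \<in> H2 p m"
  shows "((\<lambda>\<xi>. line_inner p m \<xi> F G) \<longlongrightarrow> h2_inner p m F G) (at_right 0)"
proof -
  let ?f = "h2_boundary p m F" and ?g = "h2_boundary p m G"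
  have "(LINT \<omega>|lborel. mat_tr (mat_adjoint (?f \<omega>) * ?g \<omega>))
      = (LBINT \<omega>. \<Sum>i<p. \<Sum>j<m. cnj (?f \<omega> $$ (i, j)) * ?g \<omega> $$ (i, j))"
    by (simp only: mat_tr_adjoint_mult[OF h2_boundary_spec(1)[OF F] h2_boundary_spec(1)[OF G]])
  also have "\<dots> = (\<Sum>i<p. LBINT \<omega>. \<Sum>j<m. cnj (?f \<omega> $$ (i, j)) * ?g \<omega> $$ (i, j))"
    using h2_boundary_entry(2)[OF F] h2_boundary_entry(2)[OF G]
    by (subst Bochner_Integration.integral_sum) (auto intro!: Bochner_Integration.integrable_sum Cauchy_Schwarz_L2(1))
  also have "\<dots> = (\<Sum>i<p. \<Sum>j<m. LBINT \<omega>. cnj (?f \<omega> $$ (i, j)) * ?g \<omega> $$ (i, j))"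
    using h2_boundary_entry(2)[OF F] h2_boundary_entry(2)[OF G]
    by (intro sum.cong refl, subst Bochner_Integration.integral_sum) (simp_all add: Cauchy_Schwarz_L2(1))
  finally have eq: "h2_inner p m F G = complex_of_real (1 / (2 * pi)) *
     (\<Sum>i<p. \<Sum>j<m. LBINT \<omega>. cnj (?f \<omega> $$ (i, j)) * ?g \<omega> $$ (i, j))"
    by (simp add: h2_inner_def)
  show ?thesis
    unfolding eq line_inner_def
  proof (intro tendsto_mult tendsto_const tendsto_sum)
    fix i j assume "i \<in> {..<p}" "j \<in> {..<m}"
    then have ij: "i < p" "j < m" by auto
    have L: "eventually (\<lambda>\<xi>. (\<lambda>\<omega>. K (Complex \<xi> \<omega>) $$ (i, j)) \<in> L2) (at_right 0)" if "K \<in> H2 p m" for K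
      using eventually_at_right_less[of 0]
      by eventually_elim (rule hardy_L2[OF H2_entry_hardy[OF that ij]])
    show "((\<lambda>\<xi>. LBINT \<omega>. cnj (F (Complex \<xi> \<omega>) $$ (i, j)) * G (Complex \<xi> \<omega>) $$ (i, j))
      \<longlongrightarrow> (LBINT \<omega>. cnj (?f \<omega> $$ (i, j)) * ?g \<omega> $$ (i, j))) (at_right 0)"
      by (rule tendsto_L2_inner[OF L[OF F] h2_boundary_entry(2,1)[OF F ij] L[OF G] h2_boundary_entry(2,1)[OF G ij]])
  qed
qed

section \<open>The inner product and its reproducing kernel\<close>

lemma line_inner_add_left:
  assumes "F \<in> H2 p m" "G \<in> H2 p m" "V \<in> H2 p m" "\<xi> > 0"
  shows "line_inner p m \<xi> (F + G) V = line_inner p m \<xi> F V + line_inner p m \<xi> G V"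
proof -
  have "(LBINT \<omega>. cnj ((F + G) (Complex \<xi> \<omega>) $$ (i, j)) * V (Complex \<xi> \<omega>) $$ (i, j))
      = (LBINT \<omega>. cnj (F (Complex \<xi> \<omega>) $$ (i, j)) * V (Complex \<xi> \<omega>) $$ (i, j))
      + (LBINT \<omega>. cnj (G (Complex \<xi> \<omega>) $$ (i, j)) * V (Complex \<xi> \<omega>) $$ (i, j))"
    if ij: "i < p" "j < m" for i j
  proof -
    have e: "cnj ((F + G) (Complex \<xi> \<omega>) $$ (i, j)) = cnj (F (Complex \<xi> \<omega>) $$ (i, j)) + cnj (G (Complex \<xi> \<omega>) $$ (i, j))" for \<omega>
      using H2_carrier[OF assms(1), of "Complex \<xi> \<omega>"] H2_carrier[OF assms(2), of "Complex \<xi> \<omega>"] ij by simp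
    show ?thesis
      unfolding e distrib_right
      using assms ij by (intro Bochner_Integration.integral_add Cauchy_Schwarz_L2 hardy_L2 H2_entry_hardy)
  qed
  then show ?thesis by (simp add: line_inner_def sum.distrib distrib_left)
qed

lemma line_inner_scale_left:
  assumes "F \<in> H2 p m"
  shows "line_inner p m \<xi> (h2_scale c F) V = cnj c * line_inner p m \<xi> F V"
proof -
  have "(LBINT \<omega>. cnj ((h2_scale c F) (Complex \<xi> \<omega>) $$ (i, j)) * V (Complex \<xi> \<omega>) $$ (i, j))
      = cnj c * (LBINT \<omega>. cnj (F (Complex \<xi> \<omega>) $$ (i, j)) * V (Complex \<xi> \<omega>) $$ (i, j))"
    if ij: "i < p" "j < m" for i j
  proof -
    have e: "cnj ((h2_scale c F) (Complex \<xi> \<omega>) $$ (i, j)) = cnj c * cnj (F (Complex \<xi> \<omega>) $$ (i, j))" for \<omega>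
      using H2_carrier[OF assms(1), of "Complex \<xi> \<omega>"] ij by (simp add: h2_scale_def)
    show ?thesis unfolding e mult.assoc by simp
  qed
  then show ?thesis by (simp add: line_inner_def sum_distrib_left mult.left_commute)
qed

lemma line_inner_commute: "line_inner p m \<xi> G F = cnj (line_inner p m \<xi> F G)"
proof -
  have "(LBINT \<omega>. cnj (G (Complex \<xi> \<omega>) $$ (i, j)) * F (Complex \<xi> \<omega>) $$ (i, j))
      = cnj (LBINT \<omega>. cnj (F (Complex \<xi> \<omega>) $$ (i, j)) * G (Complex \<xi> \<omega>) $$ (i, j))" for i j
    by (simp flip: Bochner_Integration.integral_cnj add: mult.commute)
  then show ?thesis by (simp add: line_inner_def)
qed

lemma h2_inner_add_left:
  assumes "F \<in> H2 p m" "G \<in> H2 p m" "V \<in> H2 p m"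
  shows "h2_inner p m (F + G) V = h2_inner p m F V + h2_inner p m G V"
proof (rule tendsto_unique)
  show "((\<lambda>\<xi>. line_inner p m \<xi> (F + G) V) \<longlongrightarrow> h2_inner p m (F + G) V) (at_right 0)"
    by (intro tendsto_line_inner H2_add assms)
  have "((\<lambda>\<xi>. line_inner p m \<xi> F V + line_inner p m \<xi> G V) \<longlongrightarrow> h2_inner p m F V + h2_inner p m G V) (at_right 0)"
    by (intro tendsto_add tendsto_line_inner assms)
  moreover have "eventually (\<lambda>\<xi>. line_inner p m \<xi> F V + line_inner p m \<xi> G V = line_inner p m \<xi> (F + G) V) (at_right 0)"
    using eventually_at_right_less[of 0] by eventually_elim (simp add: line_inner_add_left assms)
  ultimately show "((\<lambda>\<xi>. line_inner p m \<xi> (F + G) V) \<longlongrightarrow> h2_inner p m F V + h2_inner p m G V) (at_right 0)"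
    by (rule Lim_transform_eventually)
qed simp

lemma h2_inner_scale_left:
  assumes "F \<in> H2 p m" "V \<in> H2 p m"
  shows "h2_inner p m (h2_scale c F) V = cnj c * h2_inner p m F V"
proof (rule tendsto_unique)
  show "((\<lambda>\<xi>. line_inner p m \<xi> (h2_scale c F) V) \<longlongrightarrow> h2_inner p m (h2_scale c F) V) (at_right 0)"
    by (intro tendsto_line_inner H2_scale assms)
  show "((\<lambda>\<xi>. line_inner p m \<xi> (h2_scale c F) V) \<longlongrightarrow> cnj c * h2_inner p m F V) (at_right 0)"
    unfolding line_inner_scale_left[OF assms(1)]
    by (intro tendsto_mult tendsto_const tendsto_line_inner assms)
qed simp

lemma h2_inner_commute:
  assumes "F \<in> H2 p m" "G \<in> H2 p m"
  shows "h2_inner p m G F = cnj (h2_inner p m F G)"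
proof (rule tendsto_unique)
  show "((\<lambda>\<xi>. line_inner p m \<xi> G F) \<longlongrightarrow> h2_inner p m G F) (at_right 0)"
    by (intro tendsto_line_inner assms)
  show "((\<lambda>\<xi>. line_inner p m \<xi> G F) \<longlongrightarrow> cnj (h2_inner p m F G)) (at_right 0)"
    unfolding line_inner_commute[of p m _ G F]
    by (intro tendsto_cnj tendsto_line_inner assms)
qed simp

lemma h2_inner_diff_left:
  assumes "F \<in> H2 p m" "G \<in> H2 p m" "V \<in> H2 p m"
  shows "h2_inner p m (F - G) V = h2_inner p m F V - h2_inner p m G V"
  using assms by (simp add: H2_diff_eq h2_inner_add_left h2_inner_scale_left H2_scale)

lemma h2_inner_diff_right:
  assumes "F \<in> H2 p m" "G \<in> H2 p m" "V \<in> H2 p m"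
  shows "h2_inner p m V (F - G) = h2_inner p m V F - h2_inner p m V G"
  using h2_inner_diff_left[OF assms] assms
  by (simp add: h2_inner_commute[of _ p m V] H2_diff)

lemma h2_inner_scale_right:
  assumes "F \<in> H2 p m" "V \<in> H2 p m"
  shows "h2_inner p m V (h2_scale c F) = c * h2_inner p m V F"
  using h2_inner_scale_left[OF assms, of c] assms
  by (simp add: h2_inner_commute[of _ p m V] H2_scale)

lemma line_inner_self:
  assumes F: "F \<in> H2 p m" and \<xi>: "\<xi> > 0"
  shows "line_inner p m \<xi> F F = complex_of_real (1 / (2 * pi) *
      (\<Sum>i<p. \<Sum>j<m. enn2real (sq_int (\<lambda>\<omega>. F (Complex \<xi> \<omega>) $$ (i, j)))))"
proof -
  have "(LBINT \<omega>. cnj (F (Complex \<xi> \<omega>) $$ (i, j)) * F (Complex \<xi> \<omega>) $$ (i, j))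
      = complex_of_real (enn2real (sq_int (\<lambda>\<omega>. F (Complex \<xi> \<omega>) $$ (i, j))))" if "i < p" "j < m" for i j
    using sq_int_eq_integral[OF hardy_L2[OF H2_entry_hardy[OF F that] \<xi>]] by simp
  then show ?thesis by (simp add: line_inner_def)
qed

text \<open>\<open>h2_norm\<close> is the root of a real part. It squares back to the inner product
  because that is real by symmetry and nonnegative as a limit of values on interior lines.\<close>

lemma h2_inner_self:
  assumes F: "F \<in> H2 p m"
  shows "h2_inner p m F F = complex_of_real ((h2_norm p m F)\<^sup>2)"
proof -
  have "Im (h2_inner p m F F) = 0"
    using arg_cong[OF h2_inner_commute[OF F F], of Im] unfolding cnj.sel by linarith
  moreover have "Re (h2_inner p m F F) \<ge> 0"
  proof (rule tendsto_lowerbound)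
    show "((\<lambda>\<xi>. Re (line_inner p m \<xi> F F)) \<longlongrightarrow> Re (h2_inner p m F F)) (at_right 0)"
      by (intro tendsto_Re tendsto_line_inner F)
    show "eventually (\<lambda>\<xi>. Re (line_inner p m \<xi> F F) \<ge> 0) (at_right 0)"
      using eventually_at_right_less[of 0]
      by eventually_elim (simp add: line_inner_self[OF F] sum_nonneg)
  qed simp
  ultimately show ?thesis by (simp add: h2_norm_def complex_eq_iff)
qed

lemma h2_norm_nonneg: "F \<in> H2 p m \<Longrightarrow> h2_norm p m F \<ge> 0"
  unfolding h2_norm_def using arg_cong[OF h2_inner_self, of F p m Re]
  by (metis Re_complex_of_real real_sqrt_ge_0_iff zero_le_power2)

text \<open>Bounds that hold on every interior line pass to the limit, so a norm can be estimated
  without touching the boundary function.\<close>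

lemma h2_norm_sq_le:
  assumes F: "F \<in> H2 p m"
    and le: "\<And>i j \<xi>. i < p \<Longrightarrow> j < m \<Longrightarrow> \<xi> > 0 \<Longrightarrow> sq_int (\<lambda>\<omega>. F (Complex \<xi> \<omega>) $$ (i, j)) \<le> ennreal (B i j)"
    and B: "\<And>i j. B i j \<ge> 0"
  shows "(h2_norm p m F)\<^sup>2 \<le> 1 / (2 * pi) * (\<Sum>i<p. \<Sum>j<m. B i j)"
proof -
  have "Re (h2_inner p m F F) \<le> 1 / (2 * pi) * (\<Sum>i<p. \<Sum>j<m. B i j)"
  proof (rule tendsto_upperbound)
    show "((\<lambda>\<xi>. Re (line_inner p m \<xi> F F)) \<longlongrightarrow> Re (h2_inner p m F F)) (at_right 0)"
      by (intro tendsto_Re tendsto_line_inner F)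
    show "eventually (\<lambda>\<xi>. Re (line_inner p m \<xi> F F) \<le> 1 / (2 * pi) * (\<Sum>i<p. \<Sum>j<m. B i j)) (at_right 0)"
      using eventually_at_right_less[of 0]
    proof eventually_elim
      case (elim \<xi>)
      have "enn2real (sq_int (\<lambda>\<omega>. F (Complex \<xi> \<omega>) $$ (i, j))) \<le> B i j" if "i < p" "j < m" for i j
        using le[OF that elim] B by (intro enn2real_leI) auto
      then have "(\<Sum>i<p. \<Sum>j<m. enn2real (sq_int (\<lambda>\<omega>. F (Complex \<xi> \<omega>) $$ (i, j)))) \<le> (\<Sum>i<p. \<Sum>j<m. B i j)"
        by (intro sum_mono) auto
      then show ?case by (simp add: line_inner_self[OF F elim] divide_right_mono)
    qed
  qed simp
  then show ?thesis by (simp add: h2_inner_self[OF F])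
qed

theorem h2_Cauchy_Schwarz:
  assumes F: "F \<in> H2 p m" and G: "G \<in> H2 p m"
  shows "cmod (h2_inner p m F G) \<le> h2_norm p m F * h2_norm p m G"
proof -
  define a b z where "a = (h2_norm p m F)\<^sup>2" and "b = (h2_norm p m G)\<^sup>2" and "z = h2_inner p m F G"
  have quad: "0 \<le> a - 2 * x * (cmod z)\<^sup>2 + x\<^sup>2 * (cmod z)\<^sup>2 * b" for x
  proof -
    \<comment> \<open>The inner product is linear in its second argument; the factor
      \<open>cnj z\<close> turns both cross terms into the real number x |z|^2.\<close>
    define c where "c = complex_of_real x * cnj z"
    have cG: "h2_scale c G \<in> H2 p m" by (rule H2_scale[OF G])
    have zz: "z * cnj z = complex_of_real ((cmod z)\<^sup>2)" by (simp only: complex_norm_square)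
    have "complex_of_real ((h2_norm p m (F - h2_scale c G))\<^sup>2) = h2_inner p m (F - h2_scale c G) (F - h2_scale c G)"
      by (rule h2_inner_self[symmetric]) (intro H2_diff F cG)
    also have "\<dots> = complex_of_real a - c * z - cnj c * cnj z + cnj c * c * complex_of_real b"
    proof -
      have "h2_inner p m (F - h2_scale c G) F = complex_of_real a - cnj c * cnj z"
        unfolding h2_inner_diff_left[OF F cG F] h2_inner_scale_left[OF G F] h2_inner_commute[OF F G]
          h2_inner_self[OF F] a_def z_def ..
      moreover have "h2_inner p m (F - h2_scale c G) (h2_scale c G) = c * (z - cnj c * complex_of_real b)"
        unfolding h2_inner_scale_right[OF G H2_diff[OF F cG]] h2_inner_diff_left[OF F cG G]
          h2_inner_scale_left[OF G G] h2_inner_self[OF G] b_def z_def ..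
      ultimately show ?thesis
        unfolding h2_inner_diff_right[OF F cG H2_diff[OF F cG]] by (simp add: algebra_simps)
    qed
    also have "\<dots> = complex_of_real a - 2 * complex_of_real x * (z * cnj z)
        + (complex_of_real x)\<^sup>2 * (z * cnj z) * complex_of_real b"
      unfolding c_def by (simp add: algebra_simps power2_eq_square)
    also have "\<dots> = complex_of_real (a - 2 * x * (cmod z)\<^sup>2 + x\<^sup>2 * (cmod z)\<^sup>2 * b)"
      unfolding zz by simp
    finally have "(h2_norm p m (F - h2_scale c G))\<^sup>2 = a - 2 * x * (cmod z)\<^sup>2 + x\<^sup>2 * (cmod z)\<^sup>2 * b"
      by (simp only: of_real_eq_iff)
    then show ?thesis using zero_le_power2[of "h2_norm p m (F - h2_scale c G)"] by linarith
  qed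
  have "(cmod z)\<^sup>2 \<le> a * b"
  \<comment> \<open>For b = 0 the expression is affine in x, and the chosen x would make it equal to
    -1 if z were nonzero. For b > 0 the choice x = 1/b minimizes it.\<close>
  proof (cases "b = 0")
    case True
    have "(cmod z)\<^sup>2 = 0"
    proof (rule ccontr)
      assume "(cmod z)\<^sup>2 \<noteq> 0"
      then have "2 * ((a + 1) / (2 * (cmod z)\<^sup>2)) * (cmod z)\<^sup>2 = a + 1" by simp
      with quad[of "(a + 1) / (2 * (cmod z)\<^sup>2)"] show False unfolding True by linarith
    qed
    with True show ?thesis by simp
  next
    case False
    then have b: "b > 0" by (simp add: b_def)
    then have "0 \<le> (a - 2 * (1 / b) * (cmod z)\<^sup>2 + (1 / b)\<^sup>2 * (cmod z)\<^sup>2 * b) * b"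
      using quad[of "1 / b"] by (intro mult_nonneg_nonneg) auto
    also have "\<dots> = a * b - 2 * (b / b) * (cmod z)\<^sup>2 + (b / b)\<^sup>2 * (cmod z)\<^sup>2"
      by (simp add: power2_eq_square algebra_simps)
    finally show ?thesis using b by simp
  qed
  then have "(cmod z)\<^sup>2 \<le> (h2_norm p m F * h2_norm p m G)\<^sup>2"
    by (simp add: a_def b_def power_mult_distrib)
  then show ?thesis unfolding z_def
    using h2_norm_nonneg[OF F] h2_norm_nonneg[OF G] by (auto intro: power2_le_imp_le[OF _ mult_nonneg_nonneg])
qed

section \<open>Rank-one functions and the evaluation kernel\<close>

definition rank_one :: "nat \<Rightarrow> nat \<Rightarrow> complex vec \<Rightarrow> complex vec \<Rightarrow> (complex \<Rightarrow> complex) \<Rightarrow> complex \<Rightarrow> complex mat" where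
  "rank_one p m c b q = (\<lambda>s. if s \<in> rhp then mat p m (\<lambda>(k, l). vec_index c k * cnj (vec_index b l) * q s) else 0\<^sub>m p m)"

lemma rank_one_index:
  "s \<in> rhp \<Longrightarrow> k < p \<Longrightarrow> l < m \<Longrightarrow> rank_one p m c b q s $$ (k, l) = vec_index c k * cnj (vec_index b l) * q s"
  by (simp add: rank_one_def)

lemma rank_one_H2:
  assumes "hardy q"
  shows "rank_one p m c b q \<in> H2 p m"
proof (rule H2I)
  fix i j assume ij: "i < p" "j < m"
  have "hardy (\<lambda>s. vec_index c i * cnj (vec_index b j) * q s)" by (rule hardy_cmult[OF assms])
  then show "hardy (\<lambda>s. rank_one p m c b q s $$ (i, j))"
    by (rule hardy_cong) (simp add: rank_one_index ij)
qed (auto simp: rank_one_def)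

lemma rank_one_norm_le:
  assumes q: "hardy q" and B: "B \<ge> 0" "\<And>\<xi>. \<xi> > 0 \<Longrightarrow> sq_int (\<lambda>\<omega>. q (Complex \<xi> \<omega>)) \<le> ennreal B"
  shows "(h2_norm p m (rank_one p m c b q))\<^sup>2
    \<le> 1 / (2 * pi) * (\<Sum>i<p. \<Sum>j<m. (cmod (vec_index c i * cnj (vec_index b j)))\<^sup>2 * B)"
proof (rule h2_norm_sq_le[OF rank_one_H2[OF q]])
  fix i j and \<xi> :: real assume ij: "i < p" "j < m" and \<xi>: "\<xi> > 0"
  let ?a = "vec_index c i * cnj (vec_index b j)"
  have "sq_int (\<lambda>\<omega>. rank_one p m c b q (Complex \<xi> \<omega>) $$ (i, j)) = sq_int (\<lambda>\<omega>. ?a * q (Complex \<xi> \<omega>))"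
    using ij \<xi> by (simp add: rank_one_index)
  also have "\<dots> = ennreal ((cmod ?a)\<^sup>2) * sq_int (\<lambda>\<omega>. q (Complex \<xi> \<omega>))"
    using hardy_L2[OF q \<xi>] by (intro sq_int_cmult L2_measurable)
  also have "\<dots> \<le> ennreal ((cmod ?a)\<^sup>2) * ennreal B" by (intro mult_left_mono B \<xi>) simp
  also have "\<dots> = ennreal ((cmod ?a)\<^sup>2 * B)" using B(1) by (simp add: ennreal_mult)
  finally show "sq_int (\<lambda>\<omega>. rank_one p m c b q (Complex \<xi> \<omega>) $$ (i, j)) \<le> ennreal ((cmod ?a)\<^sup>2 * B)" .
qed (use B in auto)

definition bilin :: "nat \<Rightarrow> nat \<Rightarrow> complex vec \<Rightarrow> complex mat \<Rightarrow> complex vec \<Rightarrow> complex" where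
  "bilin p m c X b = (\<Sum>k<p. \<Sum>l<m. cnj (vec_index c k) * X $$ (k, l) * vec_index b l)"

text \<open>On the line Re s = \<xi> the conjugate of 1 / (s - l) is 1 / (s0 - s), where
  \<open>s0\<close> is the reflection of \<open>l\<close> in that line. Cauchy's formula thus gives
  the exact value at \<open>s0\<close>, which tends to \<open>- cnj l\<close> as \<xi> tends to 0.
  The result is conjugated because \<open>E\<close> stands in the antilinear argument.\<close>

theorem h2_inner_kernel:
  assumes E: "E \<in> H2 p m" and l: "Re l < 0"
  shows "h2_inner p m E (rank_one p m c b (\<lambda>s. 1 / (s - l))) = cnj (bilin p m c (E (- cnj l)) b)"
proof (rule tendsto_unique)
  let ?R = "rank_one p m c b (\<lambda>s. 1 / (s - l))"
  show "((\<lambda>\<xi>. line_inner p m \<xi> E ?R) \<longlongrightarrow> h2_inner p m E ?R) (at_right 0)"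
    by (intro tendsto_line_inner E rank_one_H2 hardy_resolvent l)
  have "line_inner p m \<xi> E ?R = cnj (bilin p m c (E (- cnj l + 2 * complex_of_real \<xi>)) b)" if \<xi>: "\<xi> > 0" for \<xi>
  proof -
    define s0 where "s0 = - cnj l + 2 * complex_of_real \<xi>"
    have "(LBINT \<omega>. cnj (E (Complex \<xi> \<omega>) $$ (i, j)) * ?R (Complex \<xi> \<omega>) $$ (i, j))
        = complex_of_real (2 * pi) * cnj (cnj (vec_index c i) * E s0 $$ (i, j) * vec_index b j)" if ij: "i < p" "j < m" for i j
    proof -
      have "cnj (s0 - Complex \<xi> \<omega>) = Complex \<xi> \<omega> - l" for \<omega>
        by (simp add: s0_def complex_eq_iff)
      then have "(LBINT \<omega>. cnj (E (Complex \<xi> \<omega>) $$ (i, j)) * ?R (Complex \<xi> \<omega>) $$ (i, j))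
          = (LBINT \<omega>. (vec_index c i * cnj (vec_index b j)) * cnj (E (Complex \<xi> \<omega>) $$ (i, j) / (s0 - Complex \<xi> \<omega>)))"
        using ij \<xi> by (simp add: rank_one_index mult_ac)
      also have "\<dots> = (vec_index c i * cnj (vec_index b j)) * cnj (LBINT \<omega>. E (Complex \<xi> \<omega>) $$ (i, j) / (s0 - Complex \<xi> \<omega>))"
        by (simp only: integral_mult_right_zero Bochner_Integration.integral_cnj)
      also have "(LBINT \<omega>. E (Complex \<xi> \<omega>) $$ (i, j) / (s0 - Complex \<xi> \<omega>)) = 2 * pi * E s0 $$ (i, j)"
        using l \<xi> by (intro hardy_Cauchy_formula[OF H2_entry_hardy[OF E ij]]) (auto simp: s0_def)
      finally show ?thesis by simp
    qed
    then show ?thesis by (simp add: line_inner_def bilin_def s0_def sum_distrib_left[symmetric])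
  qed
  then have "eventually (\<lambda>\<xi>. cnj (bilin p m c (E (- cnj l + 2 * complex_of_real \<xi>)) b) = line_inner p m \<xi> E ?R) (at_right 0)"
    using eventually_at_right_less[of 0] by (auto elim: eventually_mono)
  moreover have "((\<lambda>\<xi>. cnj (bilin p m c (E (- cnj l + 2 * complex_of_real \<xi>)) b)) \<longlongrightarrow> cnj (bilin p m c (E (- cnj l)) b)) (at_right 0)"
    unfolding bilin_def
  proof (intro tendsto_cnj tendsto_sum tendsto_mult tendsto_const)
    fix i j assume "i \<in> {..<p}" "j \<in> {..<m}"
    then have "(\<lambda>s. E s $$ (i, j)) holomorphic_on rhp"
      using hardy_holomorphic[OF H2_entry_hardy[OF E]] by auto
    moreover have "- cnj l \<in> rhp" using l by (simp add: rhp_def)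
    ultimately have cont: "isCont (\<lambda>s. E s $$ (i, j)) (- cnj l)"
      using open_rhp by (metis holomorphic_on_imp_continuous_on continuous_on_eq_continuous_at)
    have "((\<lambda>\<xi>. - cnj l + 2 * complex_of_real \<xi>) \<longlongrightarrow> - cnj l + 2 * complex_of_real 0) (at_right 0)"
      by (intro tendsto_intros)
    then have lim: "((\<lambda>\<xi>. - cnj l + 2 * complex_of_real \<xi>) \<longlongrightarrow> - cnj l) (at_right 0)"
      by simp
    show "((\<lambda>\<xi>. E (- cnj l + 2 * complex_of_real \<xi>) $$ (i, j)) \<longlongrightarrow> E (- cnj l) $$ (i, j)) (at_right 0)"
      by (rule isCont_tendsto_compose[OF cont lim])
  qed
  ultimately show "((\<lambda>\<xi>. line_inner p m \<xi> E ?R) \<longlongrightarrow> cnj (bilin p m c (E (- cnj l)) b)) (at_right 0)"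
    by (rule Lim_transform_eventually[rotated])
qed simp

section \<open>Realizations and partial fractions\<close>

text \<open>\<open>mat_inverse\<close> returns an option: invertibility excludes
  \<open>None\<close>, and uniqueness of inverses identifies the value.\<close>

lemma the_mat_inverse_eq:
  fixes M :: "complex mat"
  assumes M: "M \<in> carrier_mat n n" and X: "X \<in> carrier_mat n n" and MX: "M * X = 1\<^sub>m n"
  shows "the (mat_inverse M) = X"
proof -
  have XM: "X * M = 1\<^sub>m n" by (rule mat_mult_left_right_inverse[OF M X MX])
  have "M \<in> Units (ring_mat TYPE(complex) n ())"
    unfolding Units_def ring_mat_def using M X MX XM by auto
  with mat_inverse(1)[OF M, where b = "()"] obtain B where B: "mat_inverse M = Some B" by fastforce
  from mat_inverse(2)[OF M B] have *: "B * M = 1\<^sub>m n" "B \<in> carrier_mat n n" by auto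
  have "X = (B * M) * X" using * X by simp
  also have "\<dots> = B * (M * X)" using * M X by (intro assoc_mult_mat)
  also have "\<dots> = B" using * MX by simp
  finally show ?thesis using B by simp
qed

lemma poly_char_poly:
  fixes A :: "complex mat"
  assumes "A \<in> carrier_mat n n"
  shows "poly (char_poly A) s = det (s \<cdot>\<^sub>m 1\<^sub>m n - A)"
  unfolding char_poly_def
  by (rule poly_det_cong[of _ n]) (use assms in \<open>auto simp: char_poly_matrix_def\<close>)

lemma transfer_index:
  assumes r: "realization p m r A B C" and X: "X \<in> carrier_mat r r" "(s \<cdot>\<^sub>m 1\<^sub>m r - A) * X = 1\<^sub>m r"
    and kl: "k < p" "l < m"
  shows "transfer A B C s $$ (k, l) = (\<Sum>a<r. C $$ (k, a) * (\<Sum>b<r. X $$ (a, b) * B $$ (b, l)))"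
proof -
  have dims: "A \<in> carrier_mat r r" "B \<in> carrier_mat r m" "C \<in> carrier_mat p r"
    using r by (auto simp: realization_def)
  have "the (mat_inverse (s \<cdot>\<^sub>m 1\<^sub>m r - A)) = X"
    using dims X by (intro the_mat_inverse_eq[of _ r]) auto
  then have "transfer A B C s = C * X * B" using dims by (simp add: transfer_def)
  then show ?thesis
    using dims X(1) kl by (auto simp: scalar_prod_def lessThan_atLeast0 intro!: sum.cong)
qed

lemma transfer_carrier:
  "realization p m r A B C \<Longrightarrow> transfer A B C s \<in> carrier_mat p m"
  by (auto simp: transfer_def realization_def)

text \<open>Cramer's rule: the entries of the resolvent are cofactors of sI - A, polynomial in s,
  over the characteristic polynomial. The degree of this common denominator is the order of the
  realization, which bounds the number of distinct poles.\<close>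

lemma transfer_rational:
  assumes r: "realization p m r A B C"
  shows "\<exists>N. \<forall>s k l. poly (char_poly A) s \<noteq> 0 \<longrightarrow> k < p \<longrightarrow> l < m \<longrightarrow>
    transfer A B C s $$ (k, l) = poly (N k l) s / poly (char_poly A) s"
proof -
  have dims: "A \<in> carrier_mat r r" "B \<in> carrier_mat r m" "C \<in> carrier_mat p r"
    using r by (auto simp: realization_def)
  \<comment> \<open>The indices are swapped because the adjugate is the transpose of the cofactor
    matrix.\<close>
  define Q where "Q a b = [:(-1) ^ (b + a):] * det (mat_delete (char_poly_matrix A) b a)" for a b
  define N where "N k l = (\<Sum>a<r. [:C $$ (k, a):] * (\<Sum>b<r. Q a b * [:B $$ (b, l):]))" for k l
  have "transfer A B C s $$ (k, l) = poly (N k l) s / poly (char_poly A) s"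
    if ne: "poly (char_poly A) s \<noteq> 0" and kl: "k < p" "l < m" for s k l
  proof -
    define M where "M = s \<cdot>\<^sub>m 1\<^sub>m r - A"
    have M: "M \<in> carrier_mat r r" using dims by (auto simp: M_def)
    have det: "poly (char_poly A) s = det M" unfolding M_def by (rule poly_char_poly[OF dims(1)])
    define X where "X = (1 / det M) \<cdot>\<^sub>m adj_mat M"
    have X: "X \<in> carrier_mat r r" using adj_mat(1)[OF M] by (simp add: X_def)
    have "M * X = (1 / det M) \<cdot>\<^sub>m (M * adj_mat M)"
      unfolding X_def by (rule mult_smult_distrib[OF M adj_mat(1)[OF M]])
    also have "\<dots> = 1\<^sub>m r" using ne det by (auto simp: adj_mat(2)[OF M])
    finally have MX: "M * X = 1\<^sub>m r" .
    have XQ: "X $$ (a, b) = poly (Q a b) s / det M" if "a < r" "b < r" for a b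
    proof -
      have "poly (det (mat_delete (char_poly_matrix A) b a)) s = det (mat_delete M b a)"
      proof (rule poly_det_cong[of _ "r - 1"])
        fix i j assume ij: "i < r - 1" "j < r - 1"
        show "poly (mat_delete (char_poly_matrix A) b a $$ (i, j)) s = mat_delete M b a $$ (i, j)"
          using ij dims that by (auto simp: mat_delete_def char_poly_matrix_def M_def)
      qed (rule mat_delete_carrier[OF M] mat_delete_carrier[OF char_poly_matrix_closed[OF dims(1)]])+
      then show ?thesis using that M by (simp add: X_def adj_mat_def cofactor_def Q_def)
    qed
    have "transfer A B C s $$ (k, l) = (\<Sum>a<r. C $$ (k, a) * (\<Sum>b<r. X $$ (a, b) * B $$ (b, l)))"
      using MX unfolding M_def by (rule transfer_index[OF r X _ kl])
    also have "\<dots> = (\<Sum>a<r. C $$ (k, a) * (\<Sum>b<r. poly (Q a b) s / det M * B $$ (b, l)))"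
      by (simp add: XQ)
    also have "\<dots> = poly (N k l) s / det M"
      by (simp add: N_def poly_sum sum_divide_distrib[symmetric] mult.commute[of _ "B $$ _"])
    finally show ?thesis unfolding det .
  qed
  then show ?thesis by blast
qed

section \<open>Pole-residue sums and minimality\<close>

definition diag_part :: "nat \<Rightarrow> (nat \<Rightarrow> complex) \<Rightarrow> complex mat" where
  "diag_part r lam = mat r r (\<lambda>(i, j). if i = j then lam i else 0)"

definition pole_sum ::
  "nat \<Rightarrow> nat \<Rightarrow> nat \<Rightarrow> (nat \<Rightarrow> complex) \<Rightarrow> (nat \<Rightarrow> complex vec) \<Rightarrow> (nat \<Rightarrow> complex vec) \<Rightarrow> complex \<Rightarrow> complex mat" where
  "pole_sum p m r lam b c s =
     mat p m (\<lambda>(k, l). \<Sum>i<r. vec_index (c i) k * cnj (vec_index (b i) l) / (s - lam i))"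

lemma char_poly_diag_part: "poly (char_poly (diag_part r lam)) s = 0 \<longleftrightarrow> s \<in> lam ` {..<r}"
proof -
  have "char_poly (diag_part r lam) = (\<Prod>a\<leftarrow>diag_mat (diag_part r lam). [:- a, 1:])"
    by (rule char_poly_upper_triangular[of _ r]) (auto simp: diag_part_def upper_triangular_def)
  also have "diag_mat (diag_part r lam) = map lam [0..<r]"
    by (auto simp: diag_mat_def diag_part_def)
  finally show ?thesis
    by (auto simp: poly_prod_list prod_list_zero_iff o_def)
qed

lemma eigenvalue_diag_part: "eigenvalue (diag_part r lam) s \<longleftrightarrow> s \<in> lam ` {..<r}"
  by (subst eigenvalue_root_char_poly[of _ r]) (auto simp: diag_part_def[of r] char_poly_diag_part[unfolded diag_part_def])

text \<open>The Gilbert realization: the conjugated vectors \<open>b i\<close> are the rows of B and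
  the vectors \<open>c i\<close> the columns of C.\<close>

lemma diagonal_realization:
  fixes lam :: "nat \<Rightarrow> complex" and r :: nat
  defines "A \<equiv> diag_part r lam"
  obtains B C where "realization p m r A B C"
    "\<And>s. s \<notin> lam ` {..<r} \<Longrightarrow> transfer A B C s = pole_sum p m r lam b c s"
proof -
  define B where "B = mat r m (\<lambda>(i, l). cnj (vec_index (b i) l))"
  define C where "C = mat p r (\<lambda>(k, i). vec_index (c i) k)"
  have r: "realization p m r A B C"
    by (simp add: realization_def A_def B_def C_def diag_part_def)
  have "transfer A B C s = pole_sum p m r lam b c s" if s: "s \<notin> lam ` {..<r}" for s
  proof (rule eq_matI)
    define X where "X = mat r r (\<lambda>(i, j). if i = j then 1 / (s - lam i) else 0)"
    have X: "X \<in> carrier_mat r r" by (simp add: X_def)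
    have MX: "(s \<cdot>\<^sub>m 1\<^sub>m r - A) * X = 1\<^sub>m r"
    proof (rule eq_matI)
      fix i j assume "i < dim_row (1\<^sub>m r :: complex mat)" "j < dim_col (1\<^sub>m r :: complex mat)"
      then have ij: "i < r" "j < r" by auto
      have "((s \<cdot>\<^sub>m 1\<^sub>m r - A) * X) $$ (i, j)
          = (\<Sum>k<r. (if i = k then s - lam i else 0) * (if k = j then 1 / (s - lam k) else 0))"
        using ij by (auto simp: A_def diag_part_def X_def scalar_prod_def lessThan_atLeast0 intro!: sum.cong)
      also have "\<dots> = (\<Sum>k<r. if k = i then (s - lam i) * (if i = j then 1 / (s - lam i) else 0) else 0)"
        by (intro sum.cong) auto
      also have "\<dots> = 1\<^sub>m r $$ (i, j)" using ij s by auto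
      finally show "((s \<cdot>\<^sub>m 1\<^sub>m r - A) * X) $$ (i, j) = 1\<^sub>m r $$ (i, j)" .
    qed (simp_all add: A_def diag_part_def X_def)
    fix k l assume "k < dim_row (pole_sum p m r lam b c s)" "l < dim_col (pole_sum p m r lam b c s)"
    then have kl: "k < p" "l < m" by (auto simp: pole_sum_def)
    have "transfer A B C s $$ (k, l) = (\<Sum>i<r. C $$ (k, i) * (\<Sum>j<r. X $$ (i, j) * B $$ (j, l)))"
      by (rule transfer_index[OF r X MX kl])
    also have "\<dots> = (\<Sum>i<r. vec_index (c i) k * cnj (vec_index (b i) l) / (s - lam i))"
    proof (rule sum.cong[OF refl])
      fix i assume "i \<in> {..<r}"
      then have i: "i < r" by simp
      have "(\<Sum>j<r. X $$ (i, j) * B $$ (j, l)) = (\<Sum>j<r. if j = i then B $$ (i, l) / (s - lam i) else 0)"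
        using i by (intro sum.cong) (auto simp: X_def)
      also have "\<dots> = B $$ (i, l) / (s - lam i)" using i by simp
      finally show "C $$ (k, i) * (\<Sum>j<r. X $$ (i, j) * B $$ (j, l))
          = vec_index (c i) k * cnj (vec_index (b i) l) / (s - lam i)"
        using i kl by (simp add: B_def C_def)
    qed
    finally show "transfer A B C s $$ (k, l) = pole_sum p m r lam b c s $$ (k, l)"
      using kl by (simp add: pole_sum_def)
  qed (use transfer_carrier[OF r] in \<open>auto simp: pole_sum_def\<close>)
  with r that show ?thesis by blast
qed

text \<open>Clearing denominators gives a polynomial identity, which can be evaluated at the poles.\<close>

lemma partial_fraction_identity:
  fixes lam a :: "nat \<Rightarrow> complex" and N \<psi> :: "complex poly"
  assumes I: "finite I" and inj: "inj_on lam I" and S: "infinite S"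
    and eq: "\<And>s. s \<in> S \<Longrightarrow> poly \<psi> s \<noteq> 0 \<and> s \<notin> lam ` I \<and> poly N s / poly \<psi> s = (\<Sum>i\<in>I. a i / (s - lam i))"
  shows partial_fraction_eq: "poly \<psi> s \<noteq> 0 \<Longrightarrow> s \<notin> lam ` I \<Longrightarrow> poly N s / poly \<psi> s = (\<Sum>i\<in>I. a i / (s - lam i))"
    and partial_fraction_residue: "i \<in> I \<Longrightarrow> poly \<psi> (lam i) \<noteq> 0 \<Longrightarrow> a i = 0"
proof -
  define L where "L = (\<Prod>j\<in>I. [:- lam j, 1:])"
  define R where "R = (\<Sum>i\<in>I. Polynomial.smult (a i) (\<Prod>j\<in>I - {i}. [:- lam j, 1:]))"
  have L: "poly L s = (\<Prod>j\<in>I. s - lam j)" for s by (simp add: L_def poly_prod)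
  have R: "poly R s = (\<Sum>i\<in>I. a i * (\<Prod>j\<in>I - {i}. s - lam j))" for s
    by (simp add: R_def poly_sum poly_prod)
  have LR: "(\<Sum>i\<in>I. a i / (s - lam i)) * poly L s = poly R s" if "s \<notin> lam ` I" for s
    unfolding R sum_distrib_right
  proof (rule sum.cong[OF refl])
    fix i assume i: "i \<in> I"
    have "poly L s = (s - lam i) * (\<Prod>j\<in>I - {i}. s - lam j)"
      unfolding L by (rule prod.remove[OF I i])
    then show "a i / (s - lam i) * poly L s = a i * (\<Prod>j\<in>I - {i}. s - lam j)"
      using that i by auto
  qed
  have L0: "poly L s \<noteq> 0" if "s \<notin> lam ` I" for s using that I by (auto simp: L)
  have "S \<subseteq> {s. poly (N * L - \<psi> * R) s = 0}"
  proof
    fix s assume "s \<in> S"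
    from eq[OF this] have s: "poly \<psi> s \<noteq> 0" "s \<notin> lam ` I" "poly N s = (\<Sum>i\<in>I. a i / (s - lam i)) * poly \<psi> s"
      by (auto simp: field_simps)
    have "poly N s * poly L s = poly \<psi> s * poly R s" unfolding s(3) LR[OF s(2), symmetric] by simp
    then show "s \<in> {s. poly (N * L - \<psi> * R) s = 0}" by simp
  qed
  then have "infinite {s. poly (N * L - \<psi> * R) s = 0}" using S finite_subset by blast
  then have "N * L - \<psi> * R = 0" using poly_roots_finite by blast
  then have id: "poly N s * poly L s = poly \<psi> s * poly R s" for s
    by (metis eq_iff_diff_eq_0 poly_mult)
  show "poly N s / poly \<psi> s = (\<Sum>i\<in>I. a i / (s - lam i))" if "poly \<psi> s \<noteq> 0" "s \<notin> lam ` I"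
  proof -
    have "poly N s * poly L s = poly \<psi> s * ((\<Sum>i\<in>I. a i / (s - lam i)) * poly L s)"
      unfolding LR[OF that(2)] by (rule id)
    then have "poly N s = poly \<psi> s * (\<Sum>i\<in>I. a i / (s - lam i))"
      using L0[OF that(2)] by simp
    then show ?thesis using that(1) by simp
  qed
  \<comment> \<open>At \<open>lam i\<close> the product \<open>L\<close> vanishes, hence so does
    \<open>R\<close>, in which only the i-th summand survives there.\<close>
  show "a i = 0" if i: "i \<in> I" "poly \<psi> (lam i) \<noteq> 0"
  proof -
    have "poly L (lam i) = 0" using i I by (auto simp: L)
    then have "poly R (lam i) = 0" using id[of "lam i"] i by simp
    moreover have "poly R (lam i) = a i * (\<Prod>j\<in>I - {i}. lam i - lam j)
        + (\<Sum>k\<in>I - {i}. a k * (\<Prod>j\<in>I - {k}. lam i - lam j))"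
      unfolding R by (rule sum.remove[OF I i(1)])
    moreover have "(\<Sum>k\<in>I - {i}. a k * (\<Prod>j\<in>I - {k}. lam i - lam j)) = 0"
      using i I by (intro sum.neutral) auto
    moreover have "(\<Prod>j\<in>I - {i}. lam i - lam j) \<noteq> 0"
      using i I inj by (auto simp: inj_on_def)
    ultimately show ?thesis by simp
  qed
qed

text \<open>For minimality: in every realization of the same function each \<open>lam i\<close> is a
  root of the characteristic polynomial, because otherwise its residue would vanish. There are r
  distinct roots, hence the order is at least r.\<close>

lemma pole_sum_mem_rat_manifold:
  assumes neg: "\<And>i. i < r \<Longrightarrow> Re (lam i) < 0" and inj: "inj_on lam {..<r}"
    and nz: "\<And>i. i < r \<Longrightarrow> \<exists>k<p. \<exists>l<m. vec_index (c i) k * cnj (vec_index (b i) l) \<noteq> 0"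
  shows "(\<lambda>s. if s \<in> rhp then pole_sum p m r lam b c s else 0\<^sub>m p m) \<in> rat_manifold p m r"
proof -
  define A where "A = diag_part r lam"
  obtain B C where r: "realization p m r A B C"
    and t: "\<And>s. s \<notin> lam ` {..<r} \<Longrightarrow> transfer A B C s = pole_sum p m r lam b c s"
    unfolding A_def using diagonal_realization[of p m r lam b c] by blast
  have eig: "eigenvalue A s \<longleftrightarrow> s \<in> lam ` {..<r}" for s
    unfolding A_def by (rule eigenvalue_diag_part)
  have "\<not> (\<exists>q<r. \<exists>A' B' C'. realization p m q A' B' C' \<and>
         (\<forall>s. \<not> eigenvalue A s \<and> \<not> eigenvalue A' s \<longrightarrow> transfer A' B' C' s = transfer A B C s))"
  proof safe
    fix q A' B' C' assume q: "q < r" and r': "realization p m q A' B' C'"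
      and eq: "\<forall>s. \<not> eigenvalue A s \<and> \<not> eigenvalue A' s \<longrightarrow> transfer A' B' C' s = transfer A B C s"
    have A': "A' \<in> carrier_mat q q" using r' by (simp add: realization_def)
    let ?\<psi> = "char_poly A'"
    have deg: "degree ?\<psi> = q" "?\<psi> \<noteq> 0" using degree_monic_char_poly[OF A'] by auto
    obtain N where N: "\<And>s k l. poly ?\<psi> s \<noteq> 0 \<Longrightarrow> k < p \<Longrightarrow> l < m \<Longrightarrow>
        transfer A' B' C' s $$ (k, l) = poly (N k l) s / poly ?\<psi> s"
      using transfer_rational[OF r'] by blast
    define S where "S = - ({s. poly ?\<psi> s = 0} \<union> lam ` {..<r})"
    have S: "infinite S"
      unfolding S_def using poly_roots_finite[OF deg(2)] infinite_UNIV_char_0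
      by (metis finite_Un finite_compl finite_imageI finite_lessThan)
    have "poly ?\<psi> (lam i) = 0" if i: "i < r" for i
    proof (rule ccontr)
      assume ne: "poly ?\<psi> (lam i) \<noteq> 0"
      obtain k l where kl: "k < p" "l < m" and a: "vec_index (c i) k * cnj (vec_index (b i) l) \<noteq> 0"
        using nz[OF i] by blast
      have "vec_index (c i) k * cnj (vec_index (b i) l) = 0"
      proof (rule partial_fraction_residue[where a = "\<lambda>i. vec_index (c i) k * cnj (vec_index (b i) l)" and i = i, OF _ inj S])
        fix s assume "s \<in> S"
        then have s: "poly ?\<psi> s \<noteq> 0" "s \<notin> lam ` {..<r}" by (auto simp: S_def)
        then have "transfer A' B' C' s = pole_sum p m r lam b c s"
          using eq t eig eigenvalue_root_char_poly[OF A'] by auto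
        then show "poly ?\<psi> s \<noteq> 0 \<and> s \<notin> lam ` {..<r} \<and>
            poly (N k l) s / poly ?\<psi> s = (\<Sum>i\<in>{..<r}. vec_index (c i) k * cnj (vec_index (b i) l) / (s - lam i))"
          using s N[OF s(1) kl] kl by (simp add: pole_sum_def)
      qed (use i ne in auto)
      with a show False by contradiction
    qed
    then have "lam ` {..<r} \<subseteq> {s. poly ?\<psi> s = 0}" by auto
    then have "card (lam ` {..<r}) \<le> card {s. poly ?\<psi> s = 0}"
      by (rule card_mono[OF poly_roots_finite[OF deg(2)]])
    also have "\<dots> \<le> q" using card_poly_roots_bound[OF deg(2)] deg(1) by simp
    finally show False using q card_image[OF inj] by simp
  qed
  with r have "minimal_realization p m r A B C" by (simp add: minimal_realization_def)
  moreover have "hurwitz A" using neg by (auto simp: hurwitz_def eig)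
  moreover have "(\<lambda>s. if s \<in> rhp then pole_sum p m r lam b c s else 0\<^sub>m p m)
      = (\<lambda>s. if s \<in> rhp then transfer A B C s else 0\<^sub>m p m)"
  proof
    fix s
    have "transfer A B C s = pole_sum p m r lam b c s" if "s \<in> rhp"
      using that neg by (intro t) (force simp: rhp_def)
    then show "(if s \<in> rhp then pole_sum p m r lam b c s else 0\<^sub>m p m)
        = (if s \<in> rhp then transfer A B C s else 0\<^sub>m p m)" by simp
  qed
  ultimately show ?thesis unfolding rat_manifold_def by blast
qed

text \<open>The form by itself does not say where the poles lie. A term with zero residue could be
  dropped, giving a realization of order r - 1 against minimality; a nonzero residue forces
  \<open>lam i\<close> to be an eigenvalue of the Hurwitz matrix A.\<close>

lemma rat_manifold_pole_residue:
  assumes F: "F \<in> rat_manifold p m r" and form: "pole_residue_form p m r lam b c F"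
    and inj: "inj_on lam {..<r}" and i: "i < r"
  shows "Re (lam i) < 0" and "\<exists>k<p. \<exists>l<m. vec_index (c i) k * cnj (vec_index (b i) l) \<noteq> 0"
proof -
  let ?a = "\<lambda>k l i. vec_index (c i) k * cnj (vec_index (b i) l)"
  obtain A B C where min: "minimal_realization p m r A B C" and hur: "hurwitz A"
    and F_eq: "F = (\<lambda>s. if s \<in> rhp then transfer A B C s else 0\<^sub>m p m)"
    using F by (auto simp: rat_manifold_def)
  have r: "realization p m r A B C" using min by (simp add: minimal_realization_def)
  then have A: "A \<in> carrier_mat r r" by (simp add: realization_def)
  let ?\<psi> = "char_poly A"
  have eig: "eigenvalue A s \<longleftrightarrow> poly ?\<psi> s = 0" for s by (rule eigenvalue_root_char_poly[OF A])
  obtain N where N: "\<And>s k l. poly ?\<psi> s \<noteq> 0 \<Longrightarrow> k < p \<Longrightarrow> l < m \<Longrightarrow>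
      transfer A B C s $$ (k, l) = poly (N k l) s / poly ?\<psi> s"
    using transfer_rational[OF r] by blast
  define S where "S = rhp - lam ` {..<r}"
  have "infinite rhp"
    using finite_imp_not_open[OF _ open_rhp] Complex_in_rhp[of 1 0] by fastforce
  then have S: "infinite S" unfolding S_def by (intro Diff_infinite_finite) auto
  have on_S: "poly ?\<psi> s \<noteq> 0 \<and> s \<notin> lam ` {..<r} \<and>
      poly (N k l) s / poly ?\<psi> s = (\<Sum>i\<in>{..<r}. ?a k l i / (s - lam i))" if "s \<in> S" "k < p" "l < m" for s k l
  proof -
    have s: "s \<in> rhp" "s \<notin> lam ` {..<r}" using that by (auto simp: S_def)
    have ne: "poly ?\<psi> s \<noteq> 0" using hur s(1) eig[of s] by (auto simp: hurwitz_def rhp_def)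
    have "F s = mat p m (\<lambda>(k, l). \<Sum>i<r. ?a k l i / (s - lam i))"
      using form s by (auto simp: pole_residue_form_def)
    then have "transfer A B C s $$ (k, l) = (\<Sum>i<r. ?a k l i / (s - lam i))"
      using s that by (simp add: F_eq)
    then show ?thesis using ne s N[OF ne that(2,3)] by simp
  qed
  show ex: "\<exists>k<p. \<exists>l<m. ?a k l i \<noteq> 0"
  proof (rule ccontr)
    assume "\<not> ?thesis"
    then have zero: "?a k l i = 0" if "k < p" "l < m" for k l using that by blast
    define g where "g j = (if j < i then j else Suc j)" for j
    have bij: "bij_betw g {..<r - 1} ({..<r} - {i})"
      using i by (intro bij_betw_byWitness[where f' = "\<lambda>j. if j < i then j else j - 1"])
        (auto simp: g_def)
    define A' where "A' = diag_part (r - 1) (lam \<circ> g)"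
    obtain B' C' where r': "realization p m (r - 1) A' B' C'"
      and t': "\<And>s. s \<notin> (lam \<circ> g) ` {..<r - 1} \<Longrightarrow> transfer A' B' C' s = pole_sum p m (r - 1) (lam \<circ> g) (b \<circ> g) (c \<circ> g) s"
      unfolding A'_def using diagonal_realization[of p m "r - 1" "lam \<circ> g" "b \<circ> g" "c \<circ> g"] by blast
    have img: "(lam \<circ> g) ` {..<r - 1} = lam ` ({..<r} - {i})"
      using bij by (metis bij_betw_imp_surj_on image_comp)
    have "transfer A' B' C' s = transfer A B C s" if "\<not> eigenvalue A s" "\<not> eigenvalue A' s" for s
    proof (rule eq_matI)
      have s: "poly ?\<psi> s \<noteq> 0" "s \<notin> lam ` ({..<r} - {i})"
        using that by (auto simp: eig A'_def eigenvalue_diag_part img[symmetric])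
      fix k l assume "k < dim_row (transfer A B C s)" "l < dim_col (transfer A B C s)"
      then have kl: "k < p" "l < m" using transfer_carrier[OF r, of s] by auto
      have "transfer A' B' C' s $$ (k, l) = (\<Sum>j<r - 1. ?a k l (g j) / (s - lam (g j)))"
        using t'[of s] s(2) kl unfolding img by (simp add: pole_sum_def)
      also have "\<dots> = (\<Sum>j\<in>{..<r} - {i}. ?a k l j / (s - lam j))"
        by (rule sum.reindex_bij_betw[OF bij])
      also have "\<dots> = poly (N k l) s / poly ?\<psi> s"
      \<comment> \<open>The form is known on part of the right half-plane, whereas minimality tests
        all points off both spectra; a rational identity extends from an infinite set. The index i
        is left out of the sum because \<open>s = lam i\<close> can be such a point.\<close>
      proof (rule partial_fraction_eq[where a = "?a k l", symmetric, OF _ _ S _ s])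
        fix s assume "s \<in> S"
        have "(\<Sum>j<r. ?a k l j / (s - lam j)) = (\<Sum>j\<in>{..<r} - {i}. ?a k l j / (s - lam j))"
          using i zero[OF kl] by (subst sum.remove[of _ i]) auto
        then show "poly ?\<psi> s \<noteq> 0 \<and> s \<notin> lam ` ({..<r} - {i}) \<and>
            poly (N k l) s / poly ?\<psi> s = (\<Sum>j\<in>{..<r} - {i}. ?a k l j / (s - lam j))"
          using on_S[OF \<open>s \<in> S\<close> kl] by auto
      qed (use inj in \<open>auto intro: inj_on_subset\<close>)
      also have "\<dots> = transfer A B C s $$ (k, l)" using N[OF s(1) kl] by simp
      finally show "transfer A' B' C' s $$ (k, l) = transfer A B C s $$ (k, l)" .
    qed (use transfer_carrier[OF r, of s] transfer_carrier[OF r', of s] in auto)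
    moreover have "r - 1 < r" using i by simp
    ultimately show False using min r' unfolding minimal_realization_def by blast
  qed
  show "Re (lam i) < 0"
  proof -
    obtain k l where kl: "k < p" "l < m" "?a k l i \<noteq> 0" using ex by blast
    have "poly ?\<psi> (lam i) = 0"
    proof (rule ccontr)
      assume "poly ?\<psi> (lam i) \<noteq> 0"
      then have "?a k l i = 0"
        using partial_fraction_residue[where a = "?a k l" and i = i, OF _ inj S on_S[OF _ kl(1,2)]] i by simp
      with kl show False by simp
    qed
    then show ?thesis using hur eig by (auto simp: hurwitz_def)
  qed
qed

section \<open>Gradient and tangent vectors\<close>

lemma H2_zero: "(\<lambda>s. 0\<^sub>m p m) \<in> H2 p m"
proof (rule H2I)
  fix i j assume "i < p" "j < m"
  moreover have "hardy (\<lambda>s. 0)"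
    by (rule hardyI[where M = 0]) (auto simp: sq_int_def)
  ultimately show "hardy (\<lambda>s. 0\<^sub>m p m $$ (i, j))" by simp
qed auto

text \<open>The boundary function of 0 is a choice as well, so the value is taken from homogeneity
  with factor 0 instead of a computation.\<close>

lemma h2_norm_zero: "h2_norm p m (\<lambda>s. 0\<^sub>m p m) = 0"
proof -
  have "h2_scale 0 (\<lambda>s. 0\<^sub>m p m) = (\<lambda>s. 0\<^sub>m p m)" by (auto simp: h2_scale_def)
  with h2_inner_scale_left[OF H2_zero[of p m] H2_zero[of p m], of 0] show ?thesis by (simp add: h2_norm_def)
qed

lemma h2_norm_scale:
  assumes "F \<in> H2 p m"
  shows "h2_norm p m (h2_scale c F) = cmod c * h2_norm p m F"
proof -
  have "complex_of_real ((h2_norm p m (h2_scale c F))\<^sup>2) = (cnj c * c) * complex_of_real ((h2_norm p m F)\<^sup>2)"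
    unfolding h2_inner_self[OF assms, symmetric] h2_inner_self[OF H2_scale[OF assms], symmetric]
      h2_inner_scale_left[OF assms H2_scale[OF assms]] h2_inner_scale_right[OF assms assms] by simp
  also have "cnj c * c = complex_of_real ((cmod c)\<^sup>2)" by (metis complex_norm_square mult.commute)
  finally have "(h2_norm p m (h2_scale c F))\<^sup>2 = (cmod c * h2_norm p m F)\<^sup>2"
    by (simp only: of_real_mult[symmetric] of_real_eq_iff power_mult_distrib)
  then show ?thesis
    using h2_norm_nonneg[OF assms] h2_norm_nonneg[OF H2_scale[OF assms]] by (auto simp: power2_eq_iff_nonneg)
qed

lemma h2_norm_diff_sq:
  assumes "F \<in> H2 p m" "V \<in> H2 p m"
  shows "(h2_norm p m (F - V))\<^sup>2 = (h2_norm p m F)\<^sup>2 - 2 * Re (h2_inner p m F V) + (h2_norm p m V)\<^sup>2"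
proof -
  have "complex_of_real ((h2_norm p m (F - V))\<^sup>2)
      = complex_of_real ((h2_norm p m F)\<^sup>2) - cnj (h2_inner p m F V) - (h2_inner p m F V - complex_of_real ((h2_norm p m V)\<^sup>2))"
    unfolding h2_inner_self[OF assms(1), symmetric] h2_inner_self[OF assms(2), symmetric]
      h2_inner_self[OF H2_diff[OF assms], symmetric] h2_inner_commute[OF assms, symmetric]
      h2_inner_diff_right[OF assms H2_diff[OF assms]] h2_inner_diff_left[OF assms assms(1)] h2_inner_diff_left[OF assms assms(2)] ..
  from arg_cong[OF this, of Re] show ?thesis by simp
qed

lemma bilin_unit_vec:
  assumes "k < p" "l < m"
  shows "bilin p m (z \<cdot>\<^sub>v unit_vec p k) X (unit_vec m l) = cnj z * X $$ (k, l)"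
proof -
  have "cnj (vec_index (z \<cdot>\<^sub>v unit_vec p k) i) * X $$ (i, j) * vec_index (unit_vec m l) j
      = (if i = k then (if j = l then cnj z * X $$ (k, l) else 0) else 0)" if "i < p" "j < m" for i j
    using that assms by auto
  then have "bilin p m (z \<cdot>\<^sub>v unit_vec p k) X (unit_vec m l)
      = (\<Sum>i<p. \<Sum>j<m. if i = k then (if j = l then cnj z * X $$ (k, l) else 0) else 0)"
    unfolding bilin_def by (intro sum.cong refl) auto
  also have "\<dots> = (\<Sum>i<p. if i = k then (\<Sum>j<m. if j = l then cnj z * X $$ (k, l) else 0) else 0)"
    by (intro sum.cong) auto
  finally show ?thesis using assms by simp
qed

text \<open>The kernel with pole at \<open>- cnj s\<close> reproduces the value at s. Multiplying it
  by 1 and by the imaginary unit recovers the real and the imaginary part of each entry.\<close>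

lemma h2_inner_Re_nondegenerate:
  assumes F: "F \<in> H2 p m" and zero: "\<And>V. V \<in> H2 p m \<Longrightarrow> Re (h2_inner p m F V) = 0"
  shows "F = (\<lambda>s. 0\<^sub>m p m)"
proof
  fix s
  show "F s = 0\<^sub>m p m"
  proof (cases "s \<in> rhp")
    case True
    show ?thesis
    proof (rule eq_matI)
      fix k l assume "k < dim_row (0\<^sub>m p m :: complex mat)" "l < dim_col (0\<^sub>m p m :: complex mat)"
      then have kl: "k < p" "l < m" by auto
      have neg: "Re (- cnj s) < 0" using True by (simp add: rhp_def)
      have "Re (cnj (cnj z * F s $$ (k, l))) = 0" for z
        using zero[OF rank_one_H2[OF hardy_resolvent(1)[OF neg]], of "z \<cdot>\<^sub>v unit_vec p k" "unit_vec m l"]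
        unfolding h2_inner_kernel[OF F neg] bilin_unit_vec[OF kl] by simp
      from this[of 1] this[of \<i>] show "F s $$ (k, l) = 0\<^sub>m p m $$ (k, l)"
        using kl by (simp add: complex_eq_iff)
    qed (use H2_carrier[OF F, of s] in auto)
  qed (rule H2_outside[OF F])
qed

text \<open>\<open>THE\<close> requires uniqueness. The remainder of the expansion at
  \<open>G\<close> is exactly the squared norm of the increment, which gives existence. The
  difference of two gradients has a real inner product with V that is of smaller order than the norm
  of V; scaling V makes it 0, and nondegeneracy concludes.\<close>

lemma wirtinger_gradient_distance_sq:
  assumes H: "H \<in> H2 p m" and G: "G \<in> H2 p m"
  shows "(THE W. is_wirtinger_gradient p m (\<lambda>G. (h2_norm p m (H - G))\<^sup>2) G W) = G - H"
proof (rule the_equality)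
  let ?f = "\<lambda>G. (h2_norm p m (H - G))\<^sup>2"
  have GH: "G - H \<in> H2 p m" by (rule H2_diff[OF G H])
  have exact: "?f (G + V) - ?f G - 2 * Re (h2_inner p m (G - H) V) = (h2_norm p m V)\<^sup>2" if V: "V \<in> H2 p m" for V
  proof -
    have "H - (G + V) = (H - G) - V"
    proof
      fix s show "(H - (G + V)) s = ((H - G) - V) s"
        using H2_carrier[OF H, of s] H2_carrier[OF G, of s] H2_carrier[OF V, of s]
        by (intro eq_matI) auto
    qed
    then show ?thesis
      using h2_norm_diff_sq[OF H2_diff[OF H G] V]
      by (simp add: h2_inner_diff_left[OF G H V] h2_inner_diff_left[OF H G V])
  qed
  show grad: "is_wirtinger_gradient p m ?f G (G - H)"
    unfolding is_wirtinger_gradient_def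
  proof (intro conjI allI impI GH)
    fix \<epsilon> :: real assume "\<epsilon> > 0"
    show "\<exists>\<delta>>0. \<forall>V\<in>H2 p m. h2_norm p m V < \<delta> \<longrightarrow>
        \<bar>?f (G + V) - ?f G - 2 * Re (h2_inner p m (G - H) V)\<bar> \<le> \<epsilon> * h2_norm p m V"
    \<comment> \<open>The remainder is the square of the norm, so the radius may be \<epsilon>
      itself.\<close>
    proof (intro exI[of _ \<epsilon>] conjI ballI impI \<open>\<epsilon> > 0\<close>)
      fix V assume V: "V \<in> H2 p m" "h2_norm p m V < \<epsilon>"
      show "\<bar>?f (G + V) - ?f G - 2 * Re (h2_inner p m (G - H) V)\<bar> \<le> \<epsilon> * h2_norm p m V"
        unfolding exact[OF V(1)] using V(2) h2_norm_nonneg[OF V(1)]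
        by (simp add: power2_eq_square mult_right_mono)
    qed
  qed
  fix W assume W: "is_wirtinger_gradient p m ?f G W"
  then have WH: "W \<in> H2 p m" by (simp add: is_wirtinger_gradient_def)
  have diff: "W - (G - H) \<in> H2 p m" by (rule H2_diff[OF WH GH])
  have "Re (h2_inner p m (W - (G - H)) V) = 0" if V: "V \<in> H2 p m" for V
  proof -
    have "\<bar>Re (h2_inner p m (W - (G - H)) V)\<bar> \<le> 0 + e" if "e > 0" for e
    proof -
      let ?N = "h2_norm p m V"
      define \<epsilon> where "\<epsilon> = e / (?N + 1)"
      have N: "?N \<ge> 0" by (rule h2_norm_nonneg[OF V])
      have \<epsilon>: "\<epsilon> > 0" using N that by (simp add: \<epsilon>_def)
      obtain d1 where d1: "d1 > 0" "\<And>V. V \<in> H2 p m \<Longrightarrow> h2_norm p m V < d1 \<Longrightarrow>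
          \<bar>?f (G + V) - ?f G - 2 * Re (h2_inner p m W V)\<bar> \<le> \<epsilon> * h2_norm p m V"
        using W \<epsilon> unfolding is_wirtinger_gradient_def by blast
      obtain d2 where d2: "d2 > 0" "\<And>V. V \<in> H2 p m \<Longrightarrow> h2_norm p m V < d2 \<Longrightarrow>
          \<bar>?f (G + V) - ?f G - 2 * Re (h2_inner p m (G - H) V)\<bar> \<le> \<epsilon> * h2_norm p m V"
        using grad \<epsilon> unfolding is_wirtinger_gradient_def by blast
      \<comment> \<open>This scales \<open>V\<close> below both radii; adding 1 to the norm avoids a
        division by 0.\<close>
      define t where "t = min d1 d2 / (2 * (?N + 1))"
      have t: "t > 0" using d1(1) d2(1) N by (simp add: t_def)
      define U where "U = h2_scale (complex_of_real t) V"
      have U: "U \<in> H2 p m" unfolding U_def by (rule H2_scale[OF V])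
      have nU: "h2_norm p m U = t * ?N" unfolding U_def h2_norm_scale[OF V] using t by simp
      have "t * ?N \<le> min d1 d2 / 2"
      proof -
        have "t * ?N \<le> t * (?N + 1)" using t by simp
        also have "\<dots> = min d1 d2 / 2" using N by (simp add: t_def field_simps)
        finally show ?thesis .
      qed
      then have small: "h2_norm p m U < d1" "h2_norm p m U < d2" unfolding nU using d1(1) d2(1) by auto
      have "h2_inner p m (W - (G - H)) U = h2_inner p m W U - h2_inner p m (G - H) U"
        by (rule h2_inner_diff_left[OF WH GH U])
      then have "\<bar>Re (h2_inner p m (W - (G - H)) U)\<bar> \<le> \<epsilon> * h2_norm p m U"
        using d1(2)[OF U small(1)] d2(2)[OF U small(2)] by simp
      moreover have "h2_inner p m (W - (G - H)) U = complex_of_real t * h2_inner p m (W - (G - H)) V"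
        unfolding U_def by (rule h2_inner_scale_right[OF V diff])
      ultimately have "t * \<bar>Re (h2_inner p m (W - (G - H)) V)\<bar> \<le> t * (\<epsilon> * ?N)"
        unfolding nU using t by (simp add: abs_mult mult.left_commute)
      then have "\<bar>Re (h2_inner p m (W - (G - H)) V)\<bar> \<le> \<epsilon> * ?N" using t by simp
      also have "\<dots> \<le> e" using N that by (simp add: \<epsilon>_def field_simps)
      finally show ?thesis by simp
    qed
    then have "\<bar>Re (h2_inner p m (W - (G - H)) V)\<bar> \<le> 0" by (rule field_le_epsilon)
    then show ?thesis by simp
  qed
  then have zero: "W - (G - H) = (\<lambda>s. 0\<^sub>m p m)" by (rule h2_inner_Re_nondegenerate[OF diff])
  show "W = G - H"
  proof
    fix s
    have "W s $$ (i, j) = (G - H) s $$ (i, j)" if "i < p" "j < m" for i j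
      using arg_cong[OF fun_cong[OF zero, of s], of "\<lambda>X. X $$ (i, j)"] that
        H2_carrier[OF WH, of s] H2_carrier[OF H, of s] by simp
    then show "W s = (G - H) s"
      using H2_carrier[OF WH, of s] H2_carrier[OF H, of s] by (intro eq_matI) auto
  qed
qed

section \<open>Tangent vectors from explicit curves\<close>

lemma tangent_space_H2:
  assumes "V \<in> tangent_space p m r G"
  shows "V \<in> H2 p m" and "G \<in> H2 p m"
proof -
  obtain \<epsilon> \<Gamma> where "\<epsilon> > 0" and \<Gamma>: "\<forall>n. \<forall>t\<in>{-\<epsilon><..<\<epsilon>}. \<Gamma> n t \<in> H2 p m \<and> h2_has_derivative_at p m (\<Gamma> n) (\<Gamma> (Suc n) t) t"
    "\<Gamma> 0 0 = G" "V = \<Gamma> 1 0"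
    using assms unfolding tangent_space_def by blast
  have "0 \<in> {-\<epsilon><..<\<epsilon>}" using \<open>\<epsilon> > 0\<close> by simp
  with \<Gamma> show "V \<in> H2 p m" "G \<in> H2 p m" by blast+
qed

text \<open>A segment inside the manifold is a smooth curve with derivatives V, 0, 0, ..., whose
  difference quotients are exact for every nonzero step. It serves the directions in which the
  pole-residue form is affine.\<close>

lemma line_tangent:
  assumes G: "G \<in> H2 p m" and V: "V \<in> H2 p m" and \<epsilon>: "\<epsilon> > 0"
    and mem: "\<And>t. \<bar>t\<bar> < \<epsilon> \<Longrightarrow> G + h2_scale (complex_of_real t) V \<in> rat_manifold p m r"
  shows "V \<in> tangent_space p m r G"
proof -
  define \<Gamma> where "\<Gamma> n t = (if n = 0 then G + h2_scale (complex_of_real t) V else if n = 1 then V else (\<lambda>s. 0\<^sub>m p m))"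
    for n :: nat and t :: real
  note c = H2_carrier[OF G] H2_carrier[OF V]
  have H2: "\<Gamma> n t \<in> H2 p m" for n t
    by (simp add: \<Gamma>_def H2_add G V H2_scale H2_zero)
  have zero: "h2_scale (complex_of_real (1 / h)) (\<Gamma> n (t + h) - \<Gamma> n t) - \<Gamma> (Suc n) t = (\<lambda>s. 0\<^sub>m p m)" if "h \<noteq> 0" for n t h
  proof
    fix s
    show "(h2_scale (complex_of_real (1 / h)) (\<Gamma> n (t + h) - \<Gamma> n t) - \<Gamma> (Suc n) t) s = 0\<^sub>m p m"
      using c[of s] that by (intro eq_matI) (auto simp: \<Gamma>_def h2_scale_def field_simps)
  qed
  have deriv: "h2_has_derivative_at p m (\<Gamma> n) (\<Gamma> (Suc n) t) t" for n t
    unfolding h2_has_derivative_at_def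
  proof (rule tendsto_eventually)
    show "eventually (\<lambda>h. h2_norm p m (h2_scale (complex_of_real (1 / h)) (\<Gamma> n (t + h) - \<Gamma> n t) - \<Gamma> (Suc n) t) = 0) (at 0)"
      using eventually_neq_at_within[of 0] by eventually_elim (subst zero, auto simp: h2_norm_zero)
  qed
  have "G + h2_scale 0 V = G"
  proof
    fix s show "(G + h2_scale 0 V) s = G s"
      using c[of s] by (intro eq_matI) (auto simp: h2_scale_def)
  qed
  then have "\<Gamma> 0 0 = G" "V = \<Gamma> 1 0" by (simp_all add: \<Gamma>_def)
  moreover have "\<forall>t\<in>{-\<epsilon><..<\<epsilon>}. \<Gamma> 0 t \<in> rat_manifold p m r"
    using mem by (auto simp: \<Gamma>_def)
  ultimately show ?thesis
    unfolding tangent_space_def using \<epsilon> H2 deriv by blast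
qed

text \<open>The n-th derivative of 1 / (s - l) with respect to the pole \<open>l\<close>. A curve
  with a moving pole must supply all of them.\<close>

definition res_pow :: "nat \<Rightarrow> complex \<Rightarrow> complex \<Rightarrow> complex" where
  "res_pow n l s = fact n / (s - l) ^ Suc n"

lemma norm_diff_ge_neg_Re:
  assumes "s \<in> rhp"
  shows "cmod (s - l) \<ge> - Re l"
  using complex_Re_le_cmod[of "s - l"] assms by (simp add: rhp_def)

text \<open>All factors but one are bounded through the distance \<open>d\<close>; the remaining
  first power carries the square-integrability in s.\<close>

lemma res_pow_bound:
  assumes "d > 0" "d \<le> cmod (s - l)"
  shows "cmod (res_pow n l s) \<le> fact n / d ^ n * cmod (1 / (s - l))"
proof -
  have "cmod (res_pow n l s) = fact n * (1 / cmod (s - l)) ^ n * cmod (1 / (s - l))"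
    by (simp add: res_pow_def norm_divide norm_mult norm_power power_divide)
  also have "\<dots> \<le> fact n * (1 / d) ^ n * cmod (1 / (s - l))"
    using assms by (intro mult_right_mono mult_left_mono power_mono divide_left_mono mult_pos_pos) auto
  finally show ?thesis by (simp add: power_divide)
qed

lemma res_pow_hardy:
  assumes "Re l < 0"
  shows "hardy (res_pow n l)"
proof (rule hardy_dominated[OF hardy_resolvent(1)[OF assms]])
  show "res_pow n l holomorphic_on rhp"
    unfolding res_pow_def using assms by (intro holomorphic_intros) (auto simp: rhp_def)
  show "cmod (res_pow n l s) \<le> fact n / (- Re l) ^ n * cmod (1 / (s - l))" if "s \<in> rhp" for s
    using assms norm_diff_ge_neg_Re[OF that] by (intro res_pow_bound) auto
qed

lemma res_pow_has_field_derivative: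
  assumes "s \<noteq> l"
  shows "((\<lambda>l. res_pow n l s) has_field_derivative res_pow (Suc n) l s) (at l within A)"
proof -
  have "((\<lambda>l. inverse (s - l)) has_field_derivative (inverse (s - l))\<^sup>2) (at l within A)"
    using assms by (auto intro!: derivative_eq_intros simp: power2_eq_square)
  from DERIV_cmult[OF DERIV_power[OF this, of "Suc n"], of "fact n"] show ?thesis
    by (simp add: res_pow_def divide_inverse power_inverse power2_eq_square mult_ac)
qed

text \<open>Taylor's formula in the pole, with s fixed. The factor 1 / (s - l) is kept in the bound
  because a constant in s would not be square-integrable along a line. Intermediate poles stay
  within half the distance from \<open>l\<close> to the axis.\<close>

lemma res_pow_remainder:
  assumes l: "Re l < 0" and h: "cmod h \<le> - Re l / 2" and s: "s \<in> rhp"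
  shows "cmod (res_pow n (l + h) s - res_pow n l s - h * res_pow (Suc n) l s)
    \<le> 2 * fact (Suc (Suc n)) / (- Re l / 2) ^ Suc (Suc n) * (cmod h)\<^sup>2 * cmod (1 / (s - l))"
proof -
  define d where "d = - Re l"
  have d: "d > 0" using l by (simp add: d_def)
  have sl: "cmod (s - l) \<ge> d" using norm_diff_ge_neg_Re[OF s] by (simp add: d_def)
  \<comment> \<open>Moving the pole by at most d/2 costs at most half of |s - l|, which is at least
    d. The second bound is the source of the factor 2 in \<open>?B\<close>.\<close>
  have near: "cmod (s - z) \<ge> d / 2" "cmod (s - z) \<ge> cmod (s - l) / 2" if "z \<in> cball l (d / 2)" for z
  proof -
    have "cmod (s - l) \<le> cmod (s - z) + cmod (z - l)"
      using norm_triangle_ineq[of "s - z" "z - l"] by simp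
    moreover have "cmod (z - l) \<le> d / 2" using that by (simp add: dist_norm norm_minus_commute)
    ultimately show "cmod (s - z) \<ge> d / 2" "cmod (s - z) \<ge> cmod (s - l) / 2" using sl by simp_all
  qed
  let ?B = "fact (Suc (Suc n)) / (d / 2) ^ Suc (Suc n) * (2 * cmod (1 / (s - l)))"
  have "cmod (res_pow (n + 0) (l + h) s - (\<Sum>i\<le>1. res_pow (n + i) l s * ((l + h) - l) ^ i / fact i))
      \<le> ?B * cmod ((l + h) - l) ^ Suc 1 / fact 1"
  proof (rule field_Taylor[where f = "\<lambda>i l. res_pow (n + i) l s" and S = "cball l (d / 2)"])
    show "((\<lambda>l. res_pow (n + i) l s) has_field_derivative res_pow (n + Suc i) z s) (at z within cball l (d / 2))"
      if "z \<in> cball l (d / 2)" for i z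
    proof -
      have "s \<noteq> z" using near(1)[OF that] d by auto
      from res_pow_has_field_derivative[OF this, of "n + i"] show ?thesis by simp
    qed
    fix z assume z: "z \<in> cball l (d / 2)"
    have "cmod (res_pow (Suc (Suc n)) z s) \<le> fact (Suc (Suc n)) / (d / 2) ^ Suc (Suc n) * cmod (1 / (s - z))"
      using near(1)[OF z] d by (intro res_pow_bound) auto
    also have "\<dots> \<le> ?B"
    proof (rule mult_left_mono)
      show "cmod (1 / (s - z)) \<le> 2 * cmod (1 / (s - l))"
      proof -
        have "cmod (s - l) > 0" "cmod (s - z) > 0" using sl near(1)[OF z] d by linarith+
        then show ?thesis using near(2)[OF z] by (simp add: norm_divide field_simps)
      qed
    qed (use d in auto)
    finally show "cmod (res_pow (n + Suc 1) z s) \<le> ?B" by simp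
  qed (use h d in \<open>auto simp: d_def dist_norm\<close>)
  then show ?thesis by (simp add: d_def power2_eq_square mult_ac diff_diff_eq)
qed

lemma rank_one_difference_quotient:
  assumes h: "h \<noteq> 0"
  shows "h2_scale (complex_of_real (1 / h)) (rank_one p m c b q1 - rank_one p m c b q2) - rank_one p m c b q3
    = rank_one p m c b (\<lambda>s. (q1 s - q2 s) / complex_of_real h - q3 s)"
proof
  fix s
  show "(h2_scale (complex_of_real (1 / h)) (rank_one p m c b q1 - rank_one p m c b q2) - rank_one p m c b q3) s
    = rank_one p m c b (\<lambda>s. (q1 s - q2 s) / complex_of_real h - q3 s) s"
    using h by (intro eq_matI) (auto simp: h2_scale_def rank_one_def field_simps)
qed

text \<open>Divided by h, the Taylor remainder is at most K |h| times the modulus of the resolvent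
  at the undisplaced pole, whose norms on interior lines are uniformly bounded. The error in norm is
  therefore of order |h|.\<close>

lemma rank_one_res_pow_has_derivative:
  assumes l: "Re l + t < 0"
  shows "h2_has_derivative_at p m (\<lambda>t. rank_one p m c b (res_pow n (l + complex_of_real t)))
    (rank_one p m c b (res_pow (Suc n) (l + complex_of_real t))) t"
  unfolding h2_has_derivative_at_def
proof (rule tendsto_sandwich[OF _ _ tendsto_const])
  define l' where "l' = l + complex_of_real t"
  have l': "Re l' < 0" using l by (simp add: l'_def)
  define d where "d = - Re l' / 2"
  have d: "d > 0" using l' by (simp add: d_def)
  define K where "K = 2 * fact (Suc (Suc n)) / d ^ Suc (Suc n)"
  have K: "K \<ge> 0" using d by (simp add: K_def)
  define B where "B = pi / (- Re l')"
  have B: "B \<ge> 0" unfolding B_def using l' by (intro divide_nonneg_nonneg) auto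
  define M where "M = 1 / (2 * pi) * (\<Sum>i<p. \<Sum>j<m. (cmod (vec_index c i * cnj (vec_index b j)))\<^sup>2 * (K\<^sup>2 * B))"
  let ?D = "\<lambda>h. h2_scale (complex_of_real (1 / h))
      (rank_one p m c b (res_pow n (l + complex_of_real (t + h))) - rank_one p m c b (res_pow n (l + complex_of_real t)))
      - rank_one p m c b (res_pow (Suc n) (l + complex_of_real t))"
  define q where "q h = (\<lambda>s. (res_pow n (l' + complex_of_real h) s - res_pow n l' s) / complex_of_real h - res_pow (Suc n) l' s)" for h
  have D: "?D h = rank_one p m c b (q h)" if "h \<noteq> 0" for h
    unfolding rank_one_difference_quotient[OF that] by (simp add: q_def l'_def add.assoc)
  have small: "eventually (\<lambda>h. \<bar>h\<bar> \<le> d \<and> h \<noteq> 0) (at 0)"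
    unfolding eventually_at using d by (intro exI[of _ d]) (auto simp: dist_real_def)
  have norm: "h2_norm p m (?D h) \<ge> 0 \<and> h2_norm p m (?D h) \<le> \<bar>h\<bar> * sqrt M" if h: "\<bar>h\<bar> \<le> d" "h \<noteq> 0" for h
  proof -
    have Re: "Re (l' + complex_of_real h) < 0" using h d l' by (simp add: d_def)
    have hq: "hardy (q h)"
      unfolding q_def
      using hardy_diff[OF hardy_cmult[OF hardy_diff[OF res_pow_hardy[OF Re] res_pow_hardy[OF l']], of "1 / complex_of_real h"]
          res_pow_hardy[OF l']]
      by simp
    have q_le: "cmod (q h s) \<le> (K * \<bar>h\<bar>) * cmod (1 / (s - l'))" if "s \<in> rhp" for s
    proof -
      have "q h s = (res_pow n (l' + complex_of_real h) s - res_pow n l' s - complex_of_real h * res_pow (Suc n) l' s) / complex_of_real h"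
        using h by (simp add: q_def field_simps)
      then have "cmod (q h s) = cmod (res_pow n (l' + complex_of_real h) s - res_pow n l' s - complex_of_real h * res_pow (Suc n) l' s) / \<bar>h\<bar>"
        by (simp add: norm_divide)
      also have "\<dots> \<le> (K * \<bar>h\<bar>\<^sup>2 * cmod (1 / (s - l'))) / \<bar>h\<bar>"
        using res_pow_remainder[OF l' _ that, of "complex_of_real h" n] h
        by (intro divide_right_mono) (auto simp: K_def d_def)
      also have "\<dots> = (K * \<bar>h\<bar>) * cmod (1 / (s - l'))" using h by (cases "h > 0") (auto simp: power2_eq_square)
      finally show ?thesis .
    qed
    have "sq_int (\<lambda>\<omega>. q h (Complex \<xi> \<omega>)) \<le> ennreal ((K * \<bar>h\<bar>)\<^sup>2 * B)" if "\<xi> > 0" for \<xi>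
    proof -
      have "sq_int (\<lambda>\<omega>. q h (Complex \<xi> \<omega>)) \<le> ennreal ((K * \<bar>h\<bar>)\<^sup>2) * sq_int (\<lambda>\<omega>. 1 / (Complex \<xi> \<omega> - l'))"
        using q_le that K by (intro sq_int_mono L2_measurable[OF hardy_L2[OF hardy_resolvent(1)[OF l']]]) auto
      also have "\<dots> \<le> ennreal ((K * \<bar>h\<bar>)\<^sup>2) * ennreal B"
        unfolding B_def by (intro mult_left_mono hardy_resolvent(2)[OF l'] that) auto
      finally show ?thesis using B by (simp add: ennreal_mult)
    qed
    then have "(h2_norm p m (rank_one p m c b (q h)))\<^sup>2
        \<le> 1 / (2 * pi) * (\<Sum>i<p. \<Sum>j<m. (cmod (vec_index c i * cnj (vec_index b j)))\<^sup>2 * ((K * \<bar>h\<bar>)\<^sup>2 * B))"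
      using B by (intro rank_one_norm_le[OF hq]) auto
    also have "\<dots> = \<bar>h\<bar>\<^sup>2 * M"
      by (simp add: M_def sum_distrib_left power_mult_distrib mult_ac)
    finally have "h2_norm p m (rank_one p m c b (q h)) \<le> sqrt (\<bar>h\<bar>\<^sup>2 * M)"
      by (rule real_le_rsqrt)
    then show ?thesis
      unfolding D[OF h(2)] using h2_norm_nonneg[OF rank_one_H2[OF hq]] by (simp add: real_sqrt_mult)
  qed
  show "eventually (\<lambda>h. h2_norm p m (?D h) \<le> \<bar>h\<bar> * sqrt M) (at 0)"
    using small by eventually_elim (use norm in blast)
  show "eventually (\<lambda>h. 0 \<le> h2_norm p m (?D h)) (at 0)"
    using small by eventually_elim (use norm in blast)
  have "((\<lambda>h. \<bar>h\<bar> * sqrt M) \<longlongrightarrow> \<bar>0\<bar> * sqrt M) (at 0)"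
    by (intro tendsto_intros)
  then show "((\<lambda>h. \<bar>h\<bar> * sqrt M) \<longlongrightarrow> 0) (at 0)" by simp
qed

text \<open>The curve replaces one summand of \<open>G\<close>. The fixed part cancels in all
  differences, so the higher derivatives are those of the moving summand alone.\<close>

lemma moving_pole_tangent:
  assumes G: "G \<in> H2 p m" and l: "Re l < 0" and \<epsilon>: "\<epsilon> > 0"
    and mem: "\<And>t. \<bar>t\<bar> < \<epsilon> \<Longrightarrow> G + (rank_one p m c b (res_pow 0 (l + complex_of_real t)) - rank_one p m c b (res_pow 0 l))
      \<in> rat_manifold p m r"
  shows "rank_one p m c b (res_pow 1 l) \<in> tangent_space p m r G"
proof -
  define R where "R n t = rank_one p m c b (res_pow n (l + complex_of_real t))" for n t
  define \<Gamma> where "\<Gamma> n t = (if n = 0 then G + (R 0 t - R 0 0) else R n t)" for n :: nat and t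
  \<comment> \<open>The second bound keeps the moving pole in the open left half-plane, where all
    derivatives of the curve lie in the Hardy space.\<close>
  define \<epsilon>' where "\<epsilon>' = min \<epsilon> (- Re l)"
  have \<epsilon>': "\<epsilon>' > 0" "\<epsilon>' \<le> \<epsilon>" using \<epsilon> l by (auto simp: \<epsilon>'_def)
  have neg: "Re l + t < 0" if "t \<in> {-\<epsilon>'<..<\<epsilon>'}" for t using that by (auto simp: \<epsilon>'_def)
  have R: "R n t \<in> H2 p m" if "t \<in> {-\<epsilon>'<..<\<epsilon>'}" for n t
    unfolding R_def using neg[OF that] by (intro rank_one_H2 res_pow_hardy) simp
  have zero: "0 \<in> {-\<epsilon>'<..<\<epsilon>'}" using \<epsilon>' by simp
  have carrier: "R n t s \<in> carrier_mat p m" for n t s by (simp add: R_def rank_one_def)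
  have H2: "\<Gamma> n t \<in> H2 p m" if "t \<in> {-\<epsilon>'<..<\<epsilon>'}" for n t
    using R[OF that] R[OF zero] by (simp add: \<Gamma>_def H2_add H2_diff G)
  have diff: "\<Gamma> n (t + h) - \<Gamma> n t = R n (t + h) - R n t" for n t h
  proof
    fix s
    show "(\<Gamma> n (t + h) - \<Gamma> n t) s = (R n (t + h) - R n t) s"
      using H2_carrier[OF G, of s] carrier[of n t s] carrier[of n "t + h" s] carrier[of 0 0 s]
      by (intro eq_matI) (auto simp: \<Gamma>_def)
  qed
  have "h2_has_derivative_at p m (R n) (R (Suc n) t) t" if "t \<in> {-\<epsilon>'<..<\<epsilon>'}" for n t
    unfolding R_def by (rule rank_one_res_pow_has_derivative[OF neg[OF that]])
  then have deriv: "h2_has_derivative_at p m (\<Gamma> n) (\<Gamma> (Suc n) t) t" if "t \<in> {-\<epsilon>'<..<\<epsilon>'}" for n t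
    using that unfolding h2_has_derivative_at_def diff by (simp add: \<Gamma>_def)
  have "G + (R 0 0 - R 0 0) = G"
  proof
    fix s show "(G + (R 0 0 - R 0 0)) s = G s"
      using H2_carrier[OF G, of s] carrier[of 0 0 s] by (intro eq_matI) auto
  qed
  then have "\<Gamma> 0 0 = G" "rank_one p m c b (res_pow 1 l) = \<Gamma> 1 0" by (simp_all add: \<Gamma>_def R_def)
  moreover have "\<forall>t\<in>{-\<epsilon>'<..<\<epsilon>'}. \<Gamma> 0 t \<in> rat_manifold p m r"
    using mem \<epsilon>' by (auto simp: \<Gamma>_def R_def)
  ultimately show ?thesis
    unfolding tangent_space_def using \<epsilon>'(1) H2 deriv by blast
qed

lemma res_pow_0: "res_pow 0 l = (\<lambda>s. 1 / (s - l))"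
  by (rule ext) (simp add: res_pow_def)

lemma pole_residue_form_eq:
  assumes G: "G \<in> rat_manifold p m r" and form: "pole_residue_form p m r lam b c G"
    and inj: "inj_on lam {..<r}"
  shows "G = (\<lambda>s. if s \<in> rhp then pole_sum p m r lam b c s else 0\<^sub>m p m)"
proof
  fix s
  show "G s = (if s \<in> rhp then pole_sum p m r lam b c s else 0\<^sub>m p m)"
  proof (cases "s \<in> rhp")
    case True
    then have "\<forall>i<r. s \<noteq> lam i"
      using rat_manifold_pole_residue(1)[OF G form inj] by (force simp: rhp_def)
    then show ?thesis using form True by (simp add: pole_residue_form_def pole_sum_def)
  next
    case False
    then show ?thesis using G by (auto simp: rat_manifold_def)
  qed
qed

lemma sum_change_one:
  fixes f g :: "nat \<Rightarrow> complex"
  assumes "i < r" "\<And>j. j < r \<Longrightarrow> j \<noteq> i \<Longrightarrow> f j = g j"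
  shows "(\<Sum>j<r. f j) = (\<Sum>j<r. g j) + (f i - g i)"
proof -
  have "(\<Sum>j\<in>{..<r} - {i}. f j) = (\<Sum>j\<in>{..<r} - {i}. g j)"
    using assms(2) by (intro sum.cong) auto
  then show ?thesis
    using sum.remove[of "{..<r}" i f] sum.remove[of "{..<r}" i g] assms(1) by simp
qed

text \<open>Keeps one entry of a residue nonzero along a short segment, so that the perturbed system
  still has order r.\<close>

lemma nonzero_perturbation:
  fixes a d :: complex
  assumes "a \<noteq> 0"
  shows "\<exists>\<epsilon>>0. \<forall>t::real. \<bar>t\<bar> < \<epsilon> \<longrightarrow> a + complex_of_real t * d \<noteq> 0"
proof (intro exI[of _ "cmod a / (cmod d + 1)"] conjI allI impI notI)
  show "0 < cmod a / (cmod d + 1)" using assms by (simp add: add_nonneg_pos)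
  fix t :: real assume t: "\<bar>t\<bar> < cmod a / (cmod d + 1)" and "a + complex_of_real t * d = 0"
  then have "cmod a = \<bar>t\<bar> * cmod d"
    by (metis add_eq_0_iff norm_minus_cancel norm_mult norm_of_real)
  also have "\<dots> \<le> \<bar>t\<bar> * (cmod d + 1)" by (intro mult_left_mono) auto
  also have "\<dots> < cmod a" using t by (simp add: pos_less_divide_eq add_nonneg_pos)
  finally show False by simp
qed

text \<open>Membership of \<open>G\<close> in the Hardy space is an assumption of the locale; the
  final proof obtains it from the projector.\<close>

locale pole_data =
  fixes p m r :: nat and lam :: "nat \<Rightarrow> complex" and b c :: "nat \<Rightarrow> complex vec"
    and G :: "complex \<Rightarrow> complex mat"
  assumes mem: "G \<in> rat_manifold p m r" and form: "pole_residue_form p m r lam b c G"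
    and inj: "inj_on lam {..<r}" and H2: "G \<in> H2 p m"
begin

lemma neg: "i < r \<Longrightarrow> Re (lam i) < 0"
  and nz: "i < r \<Longrightarrow> \<exists>k<p. \<exists>l<m. vec_index (c i) k * cnj (vec_index (b i) l) \<noteq> 0"
  using rat_manifold_pole_residue[OF mem form inj] by blast+

lemma dims: "i < r \<Longrightarrow> b i \<in> carrier_vec m" "i < r \<Longrightarrow> c i \<in> carrier_vec p"
  using form by (auto simp: pole_residue_form_def)

lemma G_index: "s \<in> rhp \<Longrightarrow> k < p \<Longrightarrow> l < m \<Longrightarrow>
    G s $$ (k, l) = (\<Sum>i<r. vec_index (c i) k * cnj (vec_index (b i) l) / (s - lam i))"
  by (simp add: pole_residue_form_eq[OF mem form inj] pole_sum_def)

text \<open>The form is affine in \<open>c i\<close>, so a change in that vector traces a segment,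
  which stays in the manifold while the residue is nonzero.\<close>

lemma left_tangent:
  assumes i: "i < r" and e: "e \<in> carrier_vec p"
  shows "rank_one p m e (b i) (res_pow 0 (lam i)) \<in> tangent_space p m r G"
proof -
  obtain k l where kl: "k < p" "l < m" "vec_index (c i) k * cnj (vec_index (b i) l) \<noteq> 0"
    using nz[OF i] by blast
  then obtain \<epsilon> where \<epsilon>: "\<epsilon> > 0" "\<And>t. \<bar>t\<bar> < \<epsilon> \<Longrightarrow> vec_index (c i) k + complex_of_real t * vec_index e k \<noteq> 0"
    using nonzero_perturbation[of "vec_index (c i) k" "vec_index e k"] by auto
  show ?thesis
  proof (rule line_tangent[OF H2 rank_one_H2[OF res_pow_hardy[OF neg[OF i]]] \<epsilon>(1)])
    fix t :: real assume t: "\<bar>t\<bar> < \<epsilon>"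
    define c' where "c' = c(i := c i + complex_of_real t \<cdot>\<^sub>v e)"
    have c'i: "vec_index (c' i) k = vec_index (c i) k + complex_of_real t * vec_index e k" if "k < p" for k
      using that dims(2)[OF i] e by (simp add: c'_def)
    have "G + h2_scale (complex_of_real t) (rank_one p m e (b i) (res_pow 0 (lam i)))
        = (\<lambda>s. if s \<in> rhp then pole_sum p m r lam b c' s else 0\<^sub>m p m)" (is "?L = ?R")
    proof
      fix s
      show "?L s = ?R s"
      proof (cases "s \<in> rhp")
        case True
        show ?thesis
        proof (rule eq_matI)
          fix u v assume "u < dim_row (?R s)"
            "v < dim_col (?R s)"
          then have uv: "u < p" "v < m" using True by (auto simp: pole_sum_def)
          have "(\<Sum>j<r. vec_index (c' j) u * cnj (vec_index (b j) v) / (s - lam j))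
              = (\<Sum>j<r. vec_index (c j) u * cnj (vec_index (b j) v) / (s - lam j))
                + (vec_index (c' i) u * cnj (vec_index (b i) v) / (s - lam i) - vec_index (c i) u * cnj (vec_index (b i) v) / (s - lam i))"
            by (rule sum_change_one[OF i]) (simp add: c'_def)
          then show "?L s $$ (u, v) = ?R s $$ (u, v)"
            using True uv G_index[OF True uv]
            by (simp add: h2_scale_def rank_one_def pole_sum_def res_pow_0 c'i add_divide_distrib distrib_right)
        qed (use True in \<open>auto simp: h2_scale_def rank_one_def pole_sum_def\<close>)
      next
        case False
        then show ?thesis by (simp add: H2_outside[OF H2] h2_scale_def rank_one_def)
      qed
    qed
    also have "\<dots> \<in> rat_manifold p m r"
    proof (rule pole_sum_mem_rat_manifold[OF neg inj])
      fix j assume j: "j < r"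
      show "\<exists>k<p. \<exists>l<m. vec_index (c' j) k * cnj (vec_index (b j) l) \<noteq> 0"
      proof (cases "j = i")
        case True
        then have "vec_index (c' j) k * cnj (vec_index (b j) l) \<noteq> 0"
          using kl(3) \<epsilon>(2)[OF t] c'i[OF kl(1)] by simp
        then show ?thesis using kl(1,2) by blast
      next
        case False
        then show ?thesis using nz[OF j] by (simp add: c'_def)
      qed
    qed
    finally show "?L \<in> rat_manifold p m r" .
  qed
qed

text \<open>The vector \<open>b i\<close> enters conjugated, but the curve parameter is real and
  passes through the conjugation, so this change also traces a segment.\<close>

lemma right_tangent:
  assumes i: "i < r" and e: "e \<in> carrier_vec m"
  shows "rank_one p m (c i) e (res_pow 0 (lam i)) \<in> tangent_space p m r G"
proof -
  obtain k l where kl: "k < p" "l < m" "vec_index (c i) k * cnj (vec_index (b i) l) \<noteq> 0"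
    using nz[OF i] by blast
  then obtain \<epsilon> where \<epsilon>: "\<epsilon> > 0" "\<And>t. \<bar>t\<bar> < \<epsilon> \<Longrightarrow> vec_index (b i) l + complex_of_real t * vec_index e l \<noteq> 0"
    using nonzero_perturbation[of "vec_index (b i) l" "vec_index e l"] by auto
  show ?thesis
  proof (rule line_tangent[OF H2 rank_one_H2[OF res_pow_hardy[OF neg[OF i]]] \<epsilon>(1)])
    fix t :: real assume t: "\<bar>t\<bar> < \<epsilon>"
    define b' where "b' = b(i := b i + complex_of_real t \<cdot>\<^sub>v e)"
    have b'i: "vec_index (b' i) l = vec_index (b i) l + complex_of_real t * vec_index e l" if "l < m" for l
      using that dims(1)[OF i] e by (simp add: b'_def)
    have "G + h2_scale (complex_of_real t) (rank_one p m (c i) e (res_pow 0 (lam i)))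
        = (\<lambda>s. if s \<in> rhp then pole_sum p m r lam b' c s else 0\<^sub>m p m)" (is "?L = ?R")
    proof
      fix s
      show "?L s = ?R s"
      proof (cases "s \<in> rhp")
        case True
        show ?thesis
        proof (rule eq_matI)
          fix u v assume "u < dim_row (?R s)"
            "v < dim_col (?R s)"
          then have uv: "u < p" "v < m" using True by (auto simp: pole_sum_def)
          have "(\<Sum>j<r. vec_index (c j) u * cnj (vec_index (b' j) v) / (s - lam j))
              = (\<Sum>j<r. vec_index (c j) u * cnj (vec_index (b j) v) / (s - lam j))
                + (vec_index (c i) u * cnj (vec_index (b' i) v) / (s - lam i) - vec_index (c i) u * cnj (vec_index (b i) v) / (s - lam i))"
            by (rule sum_change_one[OF i]) (simp add: b'_def)
          then show "?L s $$ (u, v) = ?R s $$ (u, v)"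
            using True uv G_index[OF True uv]
            by (simp add: h2_scale_def rank_one_def pole_sum_def res_pow_0 b'i add_divide_distrib distrib_left)
        qed (use True in \<open>auto simp: h2_scale_def rank_one_def pole_sum_def\<close>)
      next
        case False
        then show ?thesis by (simp add: H2_outside[OF H2] h2_scale_def rank_one_def)
      qed
    qed
    also have "\<dots> \<in> rat_manifold p m r"
    proof (rule pole_sum_mem_rat_manifold[OF neg inj])
      fix j assume j: "j < r"
      show "\<exists>k<p. \<exists>l<m. vec_index (c j) k * cnj (vec_index (b' j) l) \<noteq> 0"
      proof (cases "j = i")
        case True
        then have "vec_index (c j) k * cnj (vec_index (b' j) l) \<noteq> 0"
          using kl(3) \<epsilon>(2)[OF t] by (simp only: b'i[OF kl(2)] mult_eq_0_iff complex_cnj_zero_iff) simp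
        then show ?thesis using kl(1,2) by blast
      next
        case False
        then show ?thesis using nz[OF j] by (simp add: b'_def)
      qed
    qed
    finally show "?L \<in> rat_manifold p m r" .
  qed
qed

lemma pole_tangent:
  assumes i: "i < r"
  shows "rank_one p m (c i) (b i) (res_pow 1 (lam i)) \<in> tangent_space p m r G"
proof -
  \<comment> \<open>Within this radius the moving pole stays stable and apart from the other poles.
    The inserted element keeps the set nonempty when there is only one pole.\<close>
  define \<epsilon> where "\<epsilon> = Min (insert (- Re (lam i)) ((\<lambda>j. cmod (lam i - lam j)) ` ({..<r} - {i})))"
  have \<epsilon>: "\<epsilon> > 0"
    unfolding \<epsilon>_def using neg[OF i] inj i by (subst Min_gr_iff) (auto simp: inj_on_def)
  show ?thesis
  proof (rule moving_pole_tangent[OF H2 neg[OF i] \<epsilon>])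
    fix t :: real assume t: "\<bar>t\<bar> < \<epsilon>"
    define lam' where "lam' = lam(i := lam i + complex_of_real t)"
    have far: "\<bar>t\<bar> < - Re (lam i)" "\<And>j. j < r \<Longrightarrow> j \<noteq> i \<Longrightarrow> \<bar>t\<bar> < cmod (lam i - lam j)"
      using t unfolding \<epsilon>_def by (subst (asm) Min_gr_iff; auto)+
    have "G + (rank_one p m (c i) (b i) (res_pow 0 (lam i + complex_of_real t)) - rank_one p m (c i) (b i) (res_pow 0 (lam i)))
        = (\<lambda>s. if s \<in> rhp then pole_sum p m r lam' b c s else 0\<^sub>m p m)" (is "?L = ?R")
    proof
      fix s
      show "?L s = ?R s"
      proof (cases "s \<in> rhp")
        case True
        show ?thesis
        proof (rule eq_matI)
          fix u v assume "u < dim_row (?R s)"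
            "v < dim_col (?R s)"
          then have uv: "u < p" "v < m" using True by (auto simp: pole_sum_def)
          have "(\<Sum>j<r. vec_index (c j) u * cnj (vec_index (b j) v) / (s - lam' j))
              = (\<Sum>j<r. vec_index (c j) u * cnj (vec_index (b j) v) / (s - lam j))
                + (vec_index (c i) u * cnj (vec_index (b i) v) / (s - lam' i) - vec_index (c i) u * cnj (vec_index (b i) v) / (s - lam i))"
            by (rule sum_change_one[OF i]) (simp add: lam'_def)
          then show "?L s $$ (u, v) = ?R s $$ (u, v)"
            using True uv G_index[OF True uv]
            by (simp add: rank_one_def pole_sum_def res_pow_0 lam'_def)
        qed (use True in \<open>auto simp: rank_one_def pole_sum_def\<close>)
      next
        case False
        then show ?thesis by (auto simp: H2_outside[OF H2] rank_one_def)
      qed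
    qed
    also have "\<dots> \<in> rat_manifold p m r"
    proof (rule pole_sum_mem_rat_manifold[OF _ _ nz])
      show "Re (lam' j) < 0" if "j < r" for j
        using neg[OF that] far(1) by (auto simp: lam'_def)
      have ne: "lam i + complex_of_real t \<noteq> lam j" if "j < r" "j \<noteq> i" for j
      proof
        assume "lam i + complex_of_real t = lam j"
        then have "lam i - lam j = - complex_of_real t" by (simp add: algebra_simps)
        then have "cmod (lam i - lam j) = \<bar>t\<bar>" by simp
        with far(2)[OF that] show False by simp
      qed
      show "inj_on lam' {..<r}"
      proof (rule inj_onI)
        fix x y assume xy: "x \<in> {..<r}" "y \<in> {..<r}" "lam' x = lam' y"
        show "x = y"
          using xy ne[of x] ne[of y] inj by (cases "x = i"; cases "y = i") (auto simp: lam'_def inj_on_def)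
      qed
    qed
    finally show "?L \<in> rat_manifold p m r" .
  qed
qed

end

section \<open>From orthogonality to the interpolation conditions\<close>

lemma bilin_unit_left:
  assumes "k < p"
  shows "bilin p m (unit_vec p k) X b = (\<Sum>l<m. X $$ (k, l) * vec_index b l)"
proof -
  have "bilin p m (unit_vec p k) X b = (\<Sum>i<p. if i = k then (\<Sum>l<m. X $$ (k, l) * vec_index b l) else 0)"
    unfolding bilin_def using assms by (intro sum.cong refl) auto
  then show ?thesis using assms by simp
qed

lemma bilin_unit_right:
  assumes "l < m"
  shows "bilin p m c X (unit_vec m l) = (\<Sum>k<p. cnj (vec_index c k) * X $$ (k, l))"
proof -
  have "(\<Sum>j<m. cnj (vec_index c k) * X $$ (k, j) * vec_index (unit_vec m l) j) = cnj (vec_index c k) * X $$ (k, l)" for k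
  proof -
    have "(\<Sum>j<m. cnj (vec_index c k) * X $$ (k, j) * vec_index (unit_vec m l) j)
        = (\<Sum>j<m. if j = l then cnj (vec_index c k) * X $$ (k, l) else 0)"
      using assms by (intro sum.cong) auto
    then show ?thesis using assms by simp
  qed
  then show ?thesis by (simp add: bilin_def)
qed

lemma bilin_eq_adj:
  assumes "X \<in> carrier_mat p m" "b \<in> carrier_vec m" "c \<in> carrier_vec p"
  shows "scalar_prod (adj_vec_mult_mat c X) b = bilin p m c X b"
proof -
  have "vec_index (adj_vec_mult_mat c X) l = (\<Sum>k<p. cnj (vec_index c k) * X $$ (k, l))" if "l < m" for l
    using assms that by (auto simp: adj_vec_mult_mat_def scalar_prod_def lessThan_atLeast0 mult.commute intro!: sum.cong)
  then have "scalar_prod (adj_vec_mult_mat c X) b = (\<Sum>l<m. \<Sum>k<p. cnj (vec_index c k) * X $$ (k, l) * vec_index b l)"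
    using assms by (auto simp: scalar_prod_def lessThan_atLeast0 sum_distrib_right intro!: sum.cong)
  then show ?thesis unfolding bilin_def by (subst sum.swap)
qed

lemma bilin_diff:
  assumes "X \<in> carrier_mat p m" "Y \<in> carrier_mat p m"
  shows "bilin p m c (X - Y) b = bilin p m c X b - bilin p m c Y b"
  using assms by (simp add: bilin_def sum_subtractf algebra_simps)

lemma H2_entry_has_deriv:
  assumes E: "E \<in> H2 p m" and kl: "k < p" "l < m" and s: "s \<in> rhp"
  shows "((\<lambda>z. E z $$ (k, l)) has_field_derivative mat_deriv p m E s $$ (k, l)) (at s)"
  using holomorphic_derivI[OF hardy_holomorphic[OF H2_entry_hardy[OF E kl]] open_rhp s] kl
  by (simp add: mat_deriv_def)

lemma mat_deriv_diff:
  assumes F: "F \<in> H2 p m" and G: "G \<in> H2 p m" and s: "s \<in> rhp"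
  shows "mat_deriv p m (F - G) s = mat_deriv p m F s - mat_deriv p m G s"
proof (rule eq_matI)
  fix k l assume "k < dim_row (mat_deriv p m F s - mat_deriv p m G s)" "l < dim_col (mat_deriv p m F s - mat_deriv p m G s)"
  then have kl: "k < p" "l < m" by (auto simp: mat_deriv_def)
  have e: "(F - G) z $$ (k, l) = F z $$ (k, l) - G z $$ (k, l)" for z
    using H2_carrier[OF G, of z] kl by simp
  have "((\<lambda>z. (F - G) z $$ (k, l)) has_field_derivative
      mat_deriv p m F s $$ (k, l) - mat_deriv p m G s $$ (k, l)) (at s)"
    unfolding e by (intro DERIV_diff H2_entry_has_deriv F G kl s)
  from DERIV_unique[OF this H2_entry_has_deriv[OF H2_diff[OF F G] kl s]]
  show "mat_deriv p m (F - G) s $$ (k, l) = (mat_deriv p m F s - mat_deriv p m G s) $$ (k, l)"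
    using kl by (simp add: mat_deriv_def)
qed (auto simp: mat_deriv_def)

text \<open>The derivative condition comes from the kernel at \<open>l + h\<close>: its difference quotient in \<open>h\<close>
  converges to \<open>c b\<^sup>* / (s - l)\<^sup>2\<close> in norm.\<close>

lemma perp_double_pole_deriv:
  assumes E: "E \<in> H2 p m" and l: "Re l < 0"
    and perp: "h2_inner p m E (rank_one p m c b (res_pow 1 l)) = 0"
  shows "bilin p m c (mat_deriv p m E (- cnj l)) b = 0"
proof -
  define \<sigma> where "\<sigma> = - cnj l"
  have \<sigma>: "\<sigma> \<in> rhp" using l by (simp add: \<sigma>_def rhp_def)
  define \<phi> where "\<phi> z = bilin p m c (E z) b" for z
  define d where "d = bilin p m c (mat_deriv p m E \<sigma>) b"
  define R where "R h = rank_one p m c b (res_pow 0 (l + complex_of_real h))" for h :: real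
  define V where "V = rank_one p m c b (res_pow 1 l)"
  have V: "V \<in> H2 p m" unfolding V_def by (intro rank_one_H2 res_pow_hardy l)
  let ?D = "\<lambda>h. h2_scale (complex_of_real (1 / h)) (R (0 + h) - R 0) - V"
  have R: "R h \<in> H2 p m" and RE: "h2_inner p m E (R h) = cnj (\<phi> (\<sigma> - complex_of_real h))" if "\<bar>h\<bar> < - Re l" for h
  proof -
    have neg: "Re (l + complex_of_real h) < 0" using that by simp
    show "R h \<in> H2 p m" unfolding R_def by (intro rank_one_H2 res_pow_hardy neg)
    show "h2_inner p m E (R h) = cnj (\<phi> (\<sigma> - complex_of_real h))"
      unfolding R_def res_pow_0 h2_inner_kernel[OF E neg] \<phi>_def \<sigma>_def by simp
  qed
  have small: "eventually (\<lambda>h. \<bar>h\<bar> < - Re l) (at 0)"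
    unfolding eventually_at using l by (intro exI[of _ "- Re l"]) (auto simp: dist_real_def)
  \<comment> \<open>Orthogonality removes \<open>V\<close>, and only kernel values remain: moving
    the pole by a real h moves the evaluation point by -h.\<close>
  have D: "h2_inner p m E (?D h) = (cnj (\<phi> (\<sigma> - complex_of_real h)) - cnj (\<phi> \<sigma>)) / complex_of_real h"
    and DH: "?D h \<in> H2 p m" if "\<bar>h\<bar> < - Re l" for h
  proof -
    have 0: "R (0 + h) \<in> H2 p m" "R 0 \<in> H2 p m" using R[of h] R[of 0] that l by auto
    note S = H2_scale[OF H2_diff[OF 0], of "complex_of_real (1 / h)"]
    show "?D h \<in> H2 p m" by (rule H2_diff[OF S V])
    show "h2_inner p m E (?D h) = (cnj (\<phi> (\<sigma> - complex_of_real h)) - cnj (\<phi> \<sigma>)) / complex_of_real h"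
      using RE[of h] RE[of 0] that l perp
      unfolding h2_inner_diff_right[OF S V E] h2_inner_scale_right[OF H2_diff[OF 0] E] h2_inner_diff_right[OF 0 E] V_def[symmetric]
      by simp
  qed
  have "((\<lambda>h. h2_norm p m (?D h)) \<longlongrightarrow> 0) (at 0)"
    using rank_one_res_pow_has_derivative[of l 0 p m c b 0] l
    unfolding h2_has_derivative_at_def R_def V_def by simp
  then have lim0: "((\<lambda>h. h2_norm p m E * h2_norm p m (?D h)) \<longlongrightarrow> 0) (at 0)"
    by (rule tendsto_mult_right_zero)
  have "((\<lambda>h. h2_inner p m E (?D h)) \<longlongrightarrow> 0) (at 0)"
  proof (rule Lim_null_comparison[OF _ lim0])
    show "eventually (\<lambda>h. norm (h2_inner p m E (?D h)) \<le> h2_norm p m E * h2_norm p m (?D h)) (at 0)"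
      using small by eventually_elim (intro h2_Cauchy_Schwarz E DH)
  qed
  then have "((\<lambda>h. cnj (h2_inner p m E (?D h))) \<longlongrightarrow> cnj 0) (at 0)" by (rule tendsto_cnj)
  moreover have "eventually (\<lambda>h. cnj (h2_inner p m E (?D h)) = (\<phi> (\<sigma> - complex_of_real h) - \<phi> \<sigma>) / complex_of_real h) (at 0)"
    using small by eventually_elim (simp only: D complex_cnj_divide complex_cnj_diff complex_cnj_cnj complex_cnj_complex_of_real)
  ultimately have lim1: "((\<lambda>h. (\<phi> (\<sigma> - complex_of_real h) - \<phi> \<sigma>) / complex_of_real h) \<longlongrightarrow> 0) (at 0)"
    by (simp add: tendsto_cong)
  \<comment> \<open>Approached along -h with h real, the difference quotient of
    \<open>\<phi>\<close> divided by h instead of -h tends to -d. It also tends to 0 by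
    Cauchy-Schwarz, so d = 0.\<close>
  have "(\<phi> has_field_derivative d) (at \<sigma>)"
    unfolding \<phi>_def d_def bilin_def
    by (intro DERIV_sum DERIV_cmult_right DERIV_cmult H2_entry_has_deriv[OF E _ _ \<sigma>]) auto
  then have "((\<lambda>k. (\<phi> (\<sigma> + k) - \<phi> \<sigma>) / k) \<longlongrightarrow> d) (at 0)" by (simp add: DERIV_def)
  moreover have "filterlim (\<lambda>h::real. - complex_of_real h) (at 0) (at 0)"
    unfolding filterlim_at
  proof
    have "((\<lambda>h::real. - complex_of_real h) \<longlongrightarrow> - complex_of_real 0) (at 0)" by (intro tendsto_intros)
    then show "((\<lambda>h::real. - complex_of_real h) \<longlongrightarrow> 0) (at 0)" by simp
  qed (auto simp: eventually_at intro!: exI[of _ 1])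
  ultimately have "((\<lambda>h. (\<phi> (\<sigma> + - complex_of_real h) - \<phi> \<sigma>) / (- complex_of_real h)) \<longlongrightarrow> d) (at 0)"
    by (rule filterlim_compose)
  then have "((\<lambda>h. - ((\<phi> (\<sigma> + - complex_of_real h) - \<phi> \<sigma>) / (- complex_of_real h))) \<longlongrightarrow> - d) (at 0)"
    by (rule tendsto_minus)
  then have "((\<lambda>h. (\<phi> (\<sigma> - complex_of_real h) - \<phi> \<sigma>) / complex_of_real h) \<longlongrightarrow> - d) (at 0)"
    by simp
  from tendsto_unique[OF _ this lim1] show ?thesis by (simp add: d_def \<sigma>_def)
qed

text \<open>The free vector in the first two families of tangent vectors is set to unit vectors,
  which yields the two vector identities entry by entry.\<close>

theorem perp_tangent_space_imp_hermite_interpolant: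
  assumes "pole_data p m r lam b c G" and F: "F \<in> H2 p m" and K: "K \<in> H2 p m"
    and perp: "h2_perp p m (F - K) (tangent_space p m r G)"
  shows "hermite_interpolant p m r lam b c F K"
  unfolding hermite_interpolant_def Let_def
proof (intro allI impI conjI)
  interpret pole_data p m r lam b c G by fact
  fix i assume i: "i < r"
  let ?\<sigma> = "- cnj (lam i)"
  let ?E = "F - K"
  have E: "?E \<in> H2 p m" by (rule H2_diff[OF F K])
  have \<sigma>: "?\<sigma> \<in> rhp" using neg[OF i] by (simp add: rhp_def)
  note cF = H2_carrier[OF F, of ?\<sigma>] and cK = H2_carrier[OF K, of ?\<sigma>]
  have left: "bilin p m e (?E ?\<sigma>) (b i) = 0" if "e \<in> carrier_vec p" for e
    using perp left_tangent[OF i that] h2_inner_kernel[OF E neg[OF i], of e "b i"]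
    unfolding h2_perp_def res_pow_0 by (metis complex_cnj_zero_iff)
  have right: "bilin p m (c i) (?E ?\<sigma>) e = 0" if "e \<in> carrier_vec m" for e
    using perp right_tangent[OF i that] h2_inner_kernel[OF E neg[OF i], of "c i" e]
    unfolding h2_perp_def res_pow_0 by (metis complex_cnj_zero_iff)
  have pole: "bilin p m (c i) (mat_deriv p m ?E ?\<sigma>) (b i) = 0"
    using perp pole_tangent[OF i] unfolding h2_perp_def
    by (intro perp_double_pole_deriv[OF E neg[OF i]]) blast
  show "F ?\<sigma> *\<^sub>v b i = K ?\<sigma> *\<^sub>v b i"
  proof (rule eq_vecI)
    fix k assume "k < dim_vec (K ?\<sigma> *\<^sub>v b i)"
    then have k: "k < p" using cK by simp
    have "(\<Sum>l<m. (F ?\<sigma> $$ (k, l) - K ?\<sigma> $$ (k, l)) * vec_index (b i) l) = 0"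
      using left[of "unit_vec p k"] cF cK k by (simp add: bilin_unit_left)
    then show "vec_index (F ?\<sigma> *\<^sub>v b i) k = vec_index (K ?\<sigma> *\<^sub>v b i) k"
      using k cF cK dims(1)[OF i]
      by (simp add: scalar_prod_def lessThan_atLeast0 left_diff_distrib sum_subtractf)
  qed (use cF cK in auto)
  show "adj_vec_mult_mat (c i) (F ?\<sigma>) = adj_vec_mult_mat (c i) (K ?\<sigma>)"
  proof (rule eq_vecI)
    fix l assume "l < dim_vec (adj_vec_mult_mat (c i) (K ?\<sigma>))"
    then have l: "l < m" using cK by (simp add: adj_vec_mult_mat_def)
    have "(\<Sum>k<p. cnj (vec_index (c i) k) * (F ?\<sigma> $$ (k, l) - K ?\<sigma> $$ (k, l))) = 0"
      using right[of "unit_vec m l"] cF cK l by (simp add: bilin_unit_right)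
    then show "vec_index (adj_vec_mult_mat (c i) (F ?\<sigma>)) l = vec_index (adj_vec_mult_mat (c i) (K ?\<sigma>)) l"
      using l cF cK dims(2)[OF i]
      by (simp add: adj_vec_mult_mat_def scalar_prod_def lessThan_atLeast0 right_diff_distrib sum_subtractf mult.commute)
  qed (use cF cK in \<open>auto simp: adj_vec_mult_mat_def\<close>)
  have cd: "mat_deriv p m X s \<in> carrier_mat p m" for X s by (simp add: mat_deriv_def)
  show "scalar_prod (adj_vec_mult_mat (c i) (mat_deriv p m F ?\<sigma>)) (b i)
      = scalar_prod (adj_vec_mult_mat (c i) (mat_deriv p m K ?\<sigma>)) (b i)"
    using pole unfolding mat_deriv_diff[OF F K \<sigma>] bilin_diff[OF cd cd] bilin_eq_adj[OF cd dims[OF i]] by simp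
qed

section \<open>The gradient step\<close>

theorem theorem8p1:
  fixes p m r :: nat
    and H Hk Hk1 Halpha :: "complex \<Rightarrow> complex mat"
    and \<alpha> :: real
    and f :: "(complex \<Rightarrow> complex mat) \<Rightarrow> real"
    and P R :: "(complex \<Rightarrow> complex mat) \<Rightarrow> (complex \<Rightarrow> complex mat) \<Rightarrow> complex \<Rightarrow> complex mat"
    and D :: "(complex \<Rightarrow> complex mat) \<Rightarrow> (complex \<Rightarrow> complex mat) set"
  assumes "H \<in> H2 p m"
    and "Hk \<in> rat_manifold p m r"
    and "\<alpha> > 0"
    and "f = (\<lambda>G. (h2_norm p m (H - G))\<^sup>2)"
    and "\<forall>G\<in>rat_manifold p m r. orthogonal_projector p m (tangent_space p m r G) (P G)"
    and "orthographic_retraction p m r D R"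
    and "h2_scale (- complex_of_real \<alpha>) (riemannian_gradient p m P f Hk) \<in> D Hk"
    and "Hk1 = R Hk (h2_scale (- complex_of_real \<alpha>) (riemannian_gradient p m P f Hk))"
    and "Halpha = h2_scale (complex_of_real (1 - \<alpha>)) Hk + h2_scale (complex_of_real \<alpha>) H"
  shows "h2_perp p m (Halpha - Hk1) (tangent_space p m r Hk) \<and>
    (\<forall>lam b c. pole_residue_form p m r lam b c Hk \<and> inj_on lam {..<r} \<longrightarrow>
       hermite_interpolant p m r lam b c Halpha Hk1)"
proof -
  let ?T = "tangent_space p m r Hk"
  have mem_H2: "G \<in> H2 p m" if "G \<in> rat_manifold p m r" for G
  proof -
    \<comment> \<open>That the manifold lies in the Hardy space is read off from the projector: its
      value at 0 is a tangent vector at \<open>G\<close>, and a tangent vector comes with a curve in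
      the Hardy space through \<open>G\<close>.\<close>
    have "P G (\<lambda>s. 0\<^sub>m p m) \<in> tangent_space p m r G"
      using assms(5) that H2_zero[of p m] unfolding orthogonal_projector_def by blast
    then show ?thesis by (rule tangent_space_H2(2))
  qed
  note H = assms(1)
  have Hk: "Hk \<in> H2 p m" by (rule mem_H2[OF assms(2)])
  define X where "X = Hk - H"
  have X: "X \<in> H2 p m" unfolding X_def by (rule H2_diff[OF Hk H])
  have grad: "riemannian_gradient p m P f Hk = P Hk X"
    unfolding riemannian_gradient_def assms(4) wirtinger_gradient_distance_sq[OF H Hk] X_def ..
  have proj: "P Hk X \<in> ?T" "h2_perp p m (X - P Hk X) ?T"
    using assms(2,5) X unfolding orthogonal_projector_def by blast+
  have PX: "P Hk X \<in> H2 p m" by (rule tangent_space_H2(1)[OF proj(1)])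
  define V where "V = h2_scale (- complex_of_real \<alpha>) (P Hk X)"
  have V: "V \<in> H2 p m" unfolding V_def by (rule H2_scale[OF PX])
  have retr: "Hk1 \<in> rat_manifold p m r" "h2_perp p m (Hk + V - Hk1) ?T"
    using assms(2,6,7) unfolding orthographic_retraction_def assms(8) grad V_def by blast+
  have Hk1: "Hk1 \<in> H2 p m" by (rule mem_H2[OF retr(1)])
  have Halpha: "Halpha \<in> H2 p m" unfolding assms(9) by (intro H2_add H2_scale Hk H)
  have split: "Halpha - Hk1 = (Hk + V - Hk1) - h2_scale (complex_of_real \<alpha>) (X - P Hk X)"
  proof
    fix s
    show "(Halpha - Hk1) s = ((Hk + V - Hk1) - h2_scale (complex_of_real \<alpha>) (X - P Hk X)) s"
      using H2_carrier[OF H, of s] H2_carrier[OF Hk, of s] H2_carrier[OF Hk1, of s] H2_carrier[OF PX, of s]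
      unfolding assms(9) V_def X_def
      by (intro eq_matI) (auto simp: h2_scale_def algebra_simps)
  qed
  have perp: "h2_perp p m (Halpha - Hk1) ?T"
    unfolding h2_perp_def
  proof
    fix U assume U: "U \<in> ?T"
    note UH = tangent_space_H2(1)[OF U]
    have "h2_inner p m (Hk + V - Hk1) U = 0" "h2_inner p m (X - P Hk X) U = 0"
      using retr(2) proj(2) U unfolding h2_perp_def by blast+
    then show "h2_inner p m (Halpha - Hk1) U = 0"
      unfolding split
      by (simp add: h2_inner_diff_left[OF H2_diff[OF H2_add[OF Hk V] Hk1] H2_scale[OF H2_diff[OF X PX]] UH]
          h2_inner_scale_left[OF H2_diff[OF X PX] UH])
  qed
  moreover have "hermite_interpolant p m r lam b c Halpha Hk1"
    if "pole_residue_form p m r lam b c Hk" "inj_on lam {..<r}" for lam b c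
  proof -
    have "pole_data p m r lam b c Hk" by (rule pole_data.intro[OF assms(2) that Hk])
    then show ?thesis by (rule perp_tangent_space_imp_hermite_interpolant[OF _ Halpha Hk1 perp])
  qed
  ultimately show ?thesis by blast
qed

end
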